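(* Let $T$ be a rooted tree as in the context and let $\varphi\in C(\partial T)$ be a continuous real-valued function on $\partial T$. Then the Poisson integral $\mathcal{P}(\varphi)(x)=\int_{\partial T}\varphi\,d\lambda_x$, $x\in V(T)$, satisfies $$\Delta\mathcal{P}(\varphi)=0\quad\text{on }V(T)\setminus\{o\},$$ and $$\lim_{x\to\zeta}\mathcal{P}(\varphi)(x)=\varphi(\zeta)\quad\text{for every regular point }\zeta\in\partial T,$$ where the limit is the radial limit along the geodesic $\zeta$.
   Context: Tree: $T$ is a locally finite tree (connected graph without cycles, every vertex having finitely many neighbours) with vertex set $V(T)$, edge set $E(T)$ and a distinguished root edge $\omega$. One endpoint $o=b(\omega)$ of $\omega$ is an endpoint of no other edge, and every vertex other than $o$ is an endpoint of at least two edges (no leaves). The boundary $\partial T$ is the set of infinite geodesics (infinite edge paths without backtracking) starting with $\omega$; $\partial T_\alpha$ is the set of those passing through the edge $\alpha$, and the sets $\partial T_\alpha$, $\alpha\in E(T)$, form a basis of the topology of $\partial T$; $T\cup\partial T$ is a compactification of $T$. For $\zeta\in\partial T$, $\alpha<\zeta$ means that the edge $\alpha$ belongs to $\zeta$. If $x_0=o,x_1,x_2,\dots$ are the successive vertices of $\zeta$, the radial limit is $\lim_{x\to\zeta}g(x):=\lim_{j\to\infty}g(x_j)$. Laplacian: $\Delta g(x)=\sum_{y\sim x}(g(y)-g(x))$, the sum being over neighbours $y$ of $x$. Harmonic measure: let $(Z_n)$ be the simple random walk on $V(T)$ (uniform choice among neighbours) stopped when it hits $o$, and let $\mathbb{P}_x$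 be its law started at $x$. There is a random variable $Z_\infty$ with values in $\partial T\cup\{o\}$ such that $Z_n\to Z_\infty$ $\mathbb{P}_x$-almost surely for every $x$. For Borel $E\subseteq\partial T\cup\{o\}$ put $\lambda_x(E)=\mathbb{P}_x(Z_\infty\in E)$. Regular points ($p=2$): for $f:E(T)\to[0,\infty)$ let $If(\zeta)=\sum_{\alpha<\zeta}f(\alpha)$. For Borel $E\subseteq\partial T$, $c(E)=c_2(E)=\inf\{\sum_\alpha f(\alpha)^2:\ f\ge0,\ If\ge1\text{ on }E\}$. There is a unique $f^{\partial T}:E(T)\to[0,\infty)$ with $If^{\partial T}=1$ on $\partial T$ except on a set of capacity zero and $\sum_\alpha f^{\partial T}(\alpha)^2=c(\partial T)$ (a known fact). A point $\zeta\in\partial T$ is regular if $If^{\partial T}(\zeta)=1$, and irregular otherwise. *)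

theory Defs
  imports "HOL-Probability.Probability"
begin

section \<open>Rooted trees\<close>

text \<open>
  Edges are two-element sets of vertices. The field \<open>base\<close> is the endpoint \<open>o = b(\<omega>)\<close> of the
  root edge \<open>\<omega>\<close>.
\<close>

record 'a edge_rooted_graph =
  verts :: "'a set"
  edges :: "'a set set"
  root_edge :: "'a set"
  base :: 'a

definition adj :: "'a edge_rooted_graph \<Rightarrow> 'a \<Rightarrow> 'a \<Rightarrow> bool" where
  "adj T x y \<longleftrightarrow> {x, y} \<in> edges T"

definition nbrs :: "'a edge_rooted_graph \<Rightarrow> 'a \<Rightarrow> 'a set" where
  "nbrs T x = {y \<in> verts T. adj T x y}"

definition simple_path :: "'a edge_rooted_graph \<Rightarrow> 'a \<Rightarrow> 'a list \<Rightarrow> 'a \<Rightarrow> bool" where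
  "simple_path T x xs y \<longleftrightarrow>
     xs \<noteq> [] \<and> hd xs = x \<and> last xs = y \<and> set xs \<subseteq> verts T \<and> distinct xs \<and> successively (adj T) xs"

definition is_cycle :: "'a edge_rooted_graph \<Rightarrow> 'a list \<Rightarrow> bool" where
  "is_cycle T xs \<longleftrightarrow>
     length xs \<ge> 3 \<and> set xs \<subseteq> verts T \<and> distinct xs \<and> successively (adj T) xs \<and> adj T (last xs) (hd xs)"

locale rooted_tree =
  fixes T :: "'a edge_rooted_graph"
  assumes edges_wf: "e \<in> edges T \<Longrightarrow> \<exists>x\<in>verts T. \<exists>y\<in>verts T. x \<noteq> y \<and> e = {x, y}"
    and connected: "x \<in> verts T \<Longrightarrow> y \<in> verts T \<Longrightarrow> \<exists>xs. simple_path T x xs y"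
    and acyclic: "\<nexists>xs. is_cycle T xs"
    and locally_finite: "x \<in> verts T \<Longrightarrow> finite (nbrs T x)"
    and root_edge_in: "root_edge T \<in> edges T"
    and base_edges: "{e \<in> edges T. base T \<in> e} = {root_edge T}"
    and no_leaves: "x \<in> verts T \<Longrightarrow> x \<noteq> base T \<Longrightarrow> card {e \<in> edges T. x \<in> e} \<ge> 2"

definition laplacian :: "'a edge_rooted_graph \<Rightarrow> ('a \<Rightarrow> real) \<Rightarrow> 'a \<Rightarrow> real" where
  "laplacian T g x = (\<Sum>y\<in>nbrs T x. g y - g x)"

section \<open>Boundary and compactification\<close>

text \<open>
  A point of the boundary is an infinite geodesic starting with the root edge, represented by the
  sequence of its successive vertices.
\<close>

definition boundary :: "'a edge_rooted_graph \<Rightarrow> (nat \<Rightarrow> 'a) set" where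
  "boundary T = {\<zeta>. range \<zeta> \<subseteq> verts T \<and> \<zeta> 0 = base T \<and> {\<zeta> 0, \<zeta> 1} = root_edge T \<and>
     (\<forall>n. adj T (\<zeta> n) (\<zeta> (Suc n))) \<and> (\<forall>n. \<zeta> (Suc (Suc n)) \<noteq> \<zeta> n)}"

definition geodesic_edges :: "(nat \<Rightarrow> 'a) \<Rightarrow> 'a set set" where
  "geodesic_edges \<zeta> = range (\<lambda>n. {\<zeta> n, \<zeta> (Suc n)})"

definition boundary_at :: "'a edge_rooted_graph \<Rightarrow> 'a set \<Rightarrow> (nat \<Rightarrow> 'a) set" where
  "boundary_at T \<alpha> = {\<zeta> \<in> boundary T. \<alpha> \<in> geodesic_edges \<zeta>}"

definition boundary_topology :: "'a edge_rooted_graph \<Rightarrow> (nat \<Rightarrow> 'a) topology" where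
  "boundary_topology T = topology_generated_by (boundary_at T ` edges T)"

definition path_edges :: "'a list \<Rightarrow> 'a set set" where
  "path_edges xs = {{xs ! i, xs ! Suc i} | i. Suc i < length xs}"

definition verts_at :: "'a edge_rooted_graph \<Rightarrow> 'a set \<Rightarrow> 'a set" where
  "verts_at T \<alpha> = {x. \<exists>xs. simple_path T (base T) xs x \<and> \<alpha> \<in> path_edges xs}"

datatype 'a compact_point = Vertex 'a | End (geodesic: "nat \<Rightarrow> 'a")

text \<open>
  The topology of \<open>V(T) \<union> \<partial>T\<close>: vertices are isolated, and the neighbourhoods of an end are
  generated by the sets of all vertices and ends lying beyond an edge \<open>\<alpha>\<close> as seen from \<open>o\<close>.
\<close>

definition compactification :: "'a edge_rooted_graph \<Rightarrow> 'a compact_point topology" where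
  "compactification T = topology_generated_by
     ((\<lambda>x. {Vertex x}) ` verts T \<union>
      (\<lambda>\<alpha>. Vertex ` verts_at T \<alpha> \<union> End ` boundary_at T \<alpha>) ` edges T)"

definition exit_points :: "'a edge_rooted_graph \<Rightarrow> 'a compact_point set" where
  "exit_points T = insert (Vertex (base T)) (End ` boundary T)"

definition exit_borel :: "'a edge_rooted_graph \<Rightarrow> 'a compact_point measure" where
  "exit_borel T = sigma (exit_points T) {U. openin (subtopology (compactification T) (exit_points T)) U}"

section \<open>Simple random walk stopped at the root, harmonic measure\<close>

definition walk_step :: "'a edge_rooted_graph \<Rightarrow> 'a \<Rightarrow> 'a pmf" where
  "walk_step T x = (if x = base T then return_pmf x else pmf_of_set (nbrs T x))"

definition walk_kernel :: "'a edge_rooted_graph \<Rightarrow> 'a \<Rightarrow> nat \<Rightarrow> (nat \<Rightarrow> 'a) \<Rightarrow> 'a measure" where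
  "walk_kernel T x n z = measure_pmf (case n of 0 \<Rightarrow> return_pmf x | Suc m \<Rightarrow> walk_step T (z m))"

lemma Ionescu_Tulcea_walk_kernel: "Ionescu_Tulcea (walk_kernel T x) (\<lambda>_. count_space UNIV)"
proof (rule Ionescu_Tulcea.intro)
  fix n :: nat
  show "walk_kernel T x n \<in>
    measurable (PiM {0..<n} (\<lambda>_. count_space UNIV)) (subprob_algebra (count_space UNIV))"
  proof (cases n)
    case 0
    then have "walk_kernel T x n = (\<lambda>_. measure_pmf (return_pmf x))"
      by (auto simp: walk_kernel_def)
    then show ?thesis
      by (auto intro!: measurable_const simp: measure_pmf_in_subprob_algebra)
  next
    case (Suc m)
    then have eq: "walk_kernel T x n = (\<lambda>y. measure_pmf (walk_step T y)) \<circ> (\<lambda>z. z m)"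
      by (auto simp: walk_kernel_def)
    show ?thesis
      unfolding eq
    proof (rule measurable_comp)
      show "(\<lambda>z. z m) \<in> measurable (PiM {0..<n} (\<lambda>_. count_space UNIV)) (count_space UNIV)"
        using Suc by (intro measurable_component_singleton) auto
      show "(\<lambda>y. measure_pmf (walk_step T y)) \<in>
          measurable (count_space UNIV) (subprob_algebra (count_space UNIV))"
        by (auto simp: measure_pmf_in_subprob_algebra)
    qed
  qed
qed (simp add: walk_kernel_def measure_pmf.prob_space_axioms)

interpretation walk: Ionescu_Tulcea "walk_kernel T x" "\<lambda>_. count_space UNIV"
  for T :: "'a edge_rooted_graph" and x :: 'a
  by (rule Ionescu_Tulcea_walk_kernel)

text \<open>The law \<open>\<P>\<^sub>x\<close> of the stopped walk on path space.\<close>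

definition walk_law :: "'a edge_rooted_graph \<Rightarrow> 'a \<Rightarrow> (nat \<Rightarrow> 'a) measure" where
  "walk_law T x = walk.PF.lim T x"

lemma emeasure_walk_law_cylinder:
  "emeasure (walk_law T x) {z. \<forall>i\<le>n. z i = y i} =
     ennreal ((if y 0 = x then 1 else 0) * (\<Prod>i<n. pmf (walk_step T (y i)) (y (Suc i))))"
proof -
  let ?M = "\<lambda>_::nat. count_space (UNIV :: 'a set)"
  let ?X = "\<lambda>n. PiE {0..<Suc n} (\<lambda>i. {y i})"
  have X: "?X m \<in> sets (PiM {0..<Suc m} ?M)" for m
    by (rule sets_PiM_I_finite) auto
  have C: "emeasure (walk.C T x 0 (Suc m) (\<lambda>_. undefined)) (?X m) =
     ennreal ((if y 0 = x then 1 else 0) * (\<Prod>i<m. pmf (walk_step T (y i)) (y (Suc i))))" for m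
  proof (induction m)
    case 0
    have sp: "(\<lambda>_. undefined) \<in> space (PiM {0..<0} ?M)" by (simp add: space_PiM)
    have "walk.C T x 0 (Suc 0) (\<lambda>_. undefined) = walk.eP T x 0 (\<lambda>_. undefined)"
      using sp walk.measurable_eP[of T x 0] by (simp add: bind_return[where N = "PiM {0..<Suc 0} ?M"])
    moreover have "emeasure (walk.eP T x 0 (\<lambda>_. undefined)) (?X 0) =
        emeasure (measure_pmf (return_pmf x)) {y 0}"
    proof -
      have vim: "(\<lambda>a. (\<lambda>_. undefined)(0 := a)) -` ?X 0 \<inter> space (?M 0) = {y 0}"
        by (rule set_eqI) (simp add: PiE_iff extensional_def)
      show ?thesis
        unfolding walk.emeasure_eP[OF sp X[of 0]] vim by (simp add: walk_kernel_def)
    qed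
    ultimately show ?case
      by (auto simp: emeasure_pmf_single)
  next
    case (Suc m)
    let ?D = "walk.C T x 0 (Suc m) (\<lambda>_. undefined)"
    have sp: "(\<lambda>_. undefined) \<in> space (PiM {0..<0} ?M)" by (simp add: space_PiM)
    have sets: "sets ?D = sets (PiM {0..<Suc m} ?M)"
      using walk.sets_C[OF sp, of T x "Suc m"] by simp
    have space: "space ?D = space (PiM {0..<Suc m} ?M)" by (rule sets_eq_imp_space_eq[OF sets])
    have ne: "space ?D \<noteq> {}" unfolding space by (auto simp: space_PiM PiE_eq_empty_iff)
    have "emeasure (walk.C T x 0 (Suc (Suc m)) (\<lambda>_. undefined)) (?X (Suc m)) =
       (\<integral>\<^sup>+ w. emeasure (walk.eP T x (Suc m) w) (?X (Suc m)) \<partial>?D)"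
    proof -
      have "walk.eP T x (0 + Suc m) \<in> measurable ?D (subprob_algebra (PiM {0..<Suc (Suc m)} ?M))"
        unfolding measurable_cong_sets[OF sets refl] add_0 by (rule walk.measurable_eP)
      from emeasure_bind[OF ne this X[of "Suc m"]] show ?thesis
        unfolding walk.C.simps(2)[of T x 0 "Suc m"] add_0 .
    qed
    also have "\<dots> = (\<integral>\<^sup>+ w. ennreal (pmf (walk_step T (y m)) (y (Suc m))) * indicator (?X m) w \<partial>?D)"
    proof (rule nn_integral_cong)
      fix w assume "w \<in> space ?D"
      then have w: "w \<in> space (PiM {0..<Suc m} ?M)" by (simp only: space)
      then have ext: "w \<in> extensional {0..<Suc m}" by (simp add: space_PiM PiE_def)
      have vim: "(\<lambda>a. w(Suc m := a)) -` ?X (Suc m) \<inter> space (?M (Suc m)) =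
          (if w \<in> ?X m then {y (Suc m)} else {})"
      proof (rule set_eqI)
        fix a
        have "w(Suc m := a) \<in> ?X (Suc m) \<longleftrightarrow> w \<in> ?X m \<and> a = y (Suc m)"
          using ext unfolding PiE_iff atLeast0_lessThan_Suc[of "Suc m"]
          by (simp add: extensional_def) blast
        then show "a \<in> (\<lambda>a. w(Suc m := a)) -` ?X (Suc m) \<inter> space (?M (Suc m)) \<longleftrightarrow>
            a \<in> (if w \<in> ?X m then {y (Suc m)} else {})"
          by simp
      qed
      show "emeasure (walk.eP T x (Suc m) w) (?X (Suc m)) =
          ennreal (pmf (walk_step T (y m)) (y (Suc m))) * indicator (?X m) w"
        unfolding walk.emeasure_eP[OF w X[of "Suc m"]] vim
        by (auto simp: walk_kernel_def emeasure_pmf_single PiE_iff split: split_indicator)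
    qed
    also have "\<dots> = ennreal (pmf (walk_step T (y m)) (y (Suc m))) * emeasure ?D (?X m)"
      using X[of m] by (subst nn_integral_cmult_indicator) (simp_all only: sets)
    finally show ?case
      unfolding Suc.IH by (simp add: ennreal_mult[symmetric] prod_nonneg mult_ac)
  qed
  have "emeasure (walk_law T x) (prod_emb UNIV ?M {0..<Suc n} (?X n)) =
      emeasure (walk.C T x 0 (Suc n) (\<lambda>_. undefined)) (prod_emb {0..<Suc n} ?M {0..<Suc n} (?X n))"
    unfolding walk_law_def
    by (simp only: walk.lim[OF finite_atLeastLessThan X] walk.emeasure_CI[OF subset_refl X])
  also have "prod_emb {0..<Suc n} ?M {0..<Suc n} (?X n) = ?X n"
    by (rule prod_emb_id) auto
  also have "prod_emb UNIV ?M {0..<Suc n} (?X n) = {z. \<forall>i\<le>n. z i = y i}"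
    by (auto simp: prod_emb_def PiE_iff less_Suc_eq_le)
  finally show ?thesis unfolding C .
qed

text \<open>
  \<open>Z\<^sub>\<infinity>\<close> as a function of the trajectory \<open>z\<close>. Limits exist almost surely; on the exceptional null
  set the value \<open>o\<close> is an arbitrary choice.
\<close>

definition walk_limit :: "'a edge_rooted_graph \<Rightarrow> (nat \<Rightarrow> 'a) \<Rightarrow> 'a compact_point" where
  "walk_limit T z =
     (if \<exists>l\<in>exit_points T. limitin (compactification T) (\<lambda>n. Vertex (z n)) l sequentially
      then (THE l. l \<in> exit_points T \<and> limitin (compactification T) (\<lambda>n. Vertex (z n)) l sequentially)
      else Vertex (base T))"

definition harmonic_measure :: "'a edge_rooted_graph \<Rightarrow> 'a \<Rightarrow> 'a compact_point measure" where
  "harmonic_measure T x = distr (walk_law T x) (exit_borel T) (walk_limit T)"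

definition poisson_integral :: "'a edge_rooted_graph \<Rightarrow> ((nat \<Rightarrow> 'a) \<Rightarrow> real) \<Rightarrow> 'a \<Rightarrow> real" where
  "poisson_integral T \<phi> x = (LINT p : End ` boundary T | harmonic_measure T x. \<phi> (geodesic p))"

section \<open>Capacity and regular points\<close>

definition potential :: "('a set \<Rightarrow> real) \<Rightarrow> (nat \<Rightarrow> 'a) \<Rightarrow> ennreal" where
  "potential f \<zeta> = (\<Sum>\<^sub>\<infinity>\<alpha>\<in>geodesic_edges \<zeta>. ennreal (f \<alpha>))"

definition energy :: "'a edge_rooted_graph \<Rightarrow> ('a set \<Rightarrow> real) \<Rightarrow> ennreal" where
  "energy T f = (\<Sum>\<^sub>\<infinity>\<alpha>\<in>edges T. ennreal ((f \<alpha>)\<^sup>2))"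

definition capacity :: "'a edge_rooted_graph \<Rightarrow> (nat \<Rightarrow> 'a) set \<Rightarrow> ennreal" where
  "capacity T A = Inf {energy T f | f. (\<forall>\<alpha>\<in>edges T. 0 \<le> f \<alpha>) \<and> (\<forall>\<zeta>\<in>A. 1 \<le> potential f \<zeta>)}"

text \<open>
  Functions on \<open>E(T)\<close> are extended by zero to all sets, so that the equilibrium function is unique.
\<close>

definition is_equilibrium :: "'a edge_rooted_graph \<Rightarrow> ('a set \<Rightarrow> real) \<Rightarrow> bool" where
  "is_equilibrium T f \<longleftrightarrow>
     (\<forall>\<alpha>\<in>edges T. 0 \<le> f \<alpha>) \<and> (\<forall>\<alpha>. \<alpha> \<notin> edges T \<longrightarrow> f \<alpha> = 0) \<and>
     capacity T {\<zeta> \<in> boundary T. potential f \<zeta> \<noteq> 1} = 0 \<and>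
     energy T f = capacity T (boundary T)"

definition equilibrium_function :: "'a edge_rooted_graph \<Rightarrow> 'a set \<Rightarrow> real" where
  "equilibrium_function T = (THE f. is_equilibrium T f)"

definition regular_point :: "'a edge_rooted_graph \<Rightarrow> (nat \<Rightarrow> 'a) \<Rightarrow> bool" where
  "regular_point T \<zeta> \<longleftrightarrow> \<zeta> \<in> boundary T \<and> potential (equilibrium_function T) \<zeta> = 1"

end

(*
The equilibrium function f of the boundary is the gradient of a function h on the vertices which is
harmonic off o, vanishes at o and is less than 1 everywhere. Explicitly, 1 - h is a product of factors
1 - c(v) along the geodesic from o, where c(v) is the conductance of the subtree that starts with the
edge above v, the decreasing limit of the conductances of its finite truncations.
Summation by parts against the flow f shows that the equilibrium functions of the truncations
converge to f in energy, which gives existence; uniqueness follows by pairing a competitor with f.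
Hence a point zeta is regular if and only if 1 - h tends to 0 along zeta.

Harmonicity of the Poisson integral is the Markov property, as the limit of the walk does not depend
on its first step. Every vertex other than o is visited finitely often (bound on the Green function), so a walk
that enters a subtree infinitely often converges to an end of it. Given an edge (p, v) of zeta, the
function min(1, (1 - h) / (1 - h(p))) below v, extended by 1, is therefore a superharmonic bound for
the probability of exiting outside the arc of v, and it tends to 0 along zeta if zeta is regular.
*)
theory Submission
  imports Defs
begin

section \<open>Trees with parents and levels\<close>

context rooted_tree
begin

text \<open>The number \<open>1 - c(v)\<close> is the probability that the walk from
  \<open>v\<close> ever reaches the parent of \<open>v\<close>: conditioning on the first step gives
  \<open>1 - c = 1 / (1 + S)\<close>, \<open>S\<close> being the sum of \<open>c\<close> over the
  children, which is also the series-parallel law. So \<open>1 - h\<close> is the probability of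
  hitting \<open>o\<close>. This reading is motivation only; the proof uses that
  \<open>1 - h\<close> is positive, harmonic off \<open>o\<close>, and decreases along an end to the
  deficit of the potential there. Two obstacles shape the argument. The potential identity defining
  the equilibrium function may fail on a set of capacity zero, so that function cannot simply be
  tested as an admissible one; neither its energy nor its uniqueness comes for free. And decay of
  \<open>1 - h\<close> controls only absorption at \<open>o\<close>, while exit through ends far
  from \<zeta> must become unlikely too. Dividing by the value at \<open>p\<close> moves the
  argument from \<open>o\<close> to \<open>p\<close>, because a walk can leave the subtree of
  \<open>v\<close> only through \<open>p\<close>. No stopping times are needed: superharmonicity and
  Fatou's lemma give the bound.\<close>

abbreviation rt :: 'a where "rt \<equiv> base T"

lemma adj_sym: "adj T x y \<longleftrightarrow> adj T y x"
  by (simp add: adj_def insert_commute)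

lemma adj_verts: "adj T x y \<Longrightarrow> x \<in> verts T \<and> y \<in> verts T \<and> x \<noteq> y"
  using edges_wf[of "{x, y}"] by (auto simp: adj_def doubleton_eq_iff)

lemma rt_verts: "rt \<in> verts T"
proof -
  have "root_edge T \<in> edges T" "rt \<in> root_edge T" using base_edges by auto
  then show ?thesis using edges_wf[of "root_edge T"] by auto
qed

text \<open>Induction from the common endpoint backwards. If the two predecessors of the endpoint
  differ, the final stretches of the paths after their last meeting point close up to a cycle
  through the endpoint.\<close>

lemma simple_path_unique:
  "simple_path T x xs y \<Longrightarrow> simple_path T x ys y \<Longrightarrow> xs = ys"
proof (induction xs arbitrary: y ys rule: rev_induct)
  case Nil
  then show ?case by (simp add: simple_path_def)
next
  case (snoc a xs)
  have a: "y = a" using snoc.prems(1) by (simp add: simple_path_def)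
  obtain ys' where ys: "ys = ys' @ [a]"
    using snoc.prems(2) a unfolding simple_path_def by (metis append_butlast_last_id)
  show ?case
  proof (cases "xs = [] \<or> ys' = []")
    case True
    then show ?thesis using snoc.prems ys
      by (auto simp: simple_path_def hd_append split: if_splits)
  next
    case False
    then have ne: "xs \<noteq> []" "ys' \<noteq> []" by auto
    let ?p = "last xs" and ?q = "last ys'"
    have p: "simple_path T x xs ?p" "adj T ?p a" and q: "simple_path T x ys' ?q" "adj T ?q a"
      using snoc.prems ne unfolding ys by (auto simp: simple_path_def successively_append_iff)
    have "?p = ?q"
    proof (rule ccontr)
      assume neq: "?p \<noteq> ?q"
      have "hd xs = x" "hd ys' = x" using p(1) q(1) by (simp_all add: simple_path_def)
      then have "x \<in> set xs" "x \<in> set ys'" using hd_in_set[OF ne(1)] hd_in_set[OF ne(2)] by simp_all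
      then have "\<exists>v\<in>set xs. v \<in> set ys'" by auto
      \<comment> \<open>Taking the last vertex of \<open>xs\<close> that lies on \<open>ys'\<close>
        makes \<open>b\<close> disjoint from \<open>ys'\<close>, which is what makes the cycle
        \<open>?C\<close> free of repetitions.\<close>
      then obtain a' v b where xs: "xs = a' @ v # b" and v: "v \<in> set ys'"
        and b: "\<forall>z\<in>set b. z \<notin> set ys'"
        using split_list_last_prop[of xs "\<lambda>v. v \<in> set ys'"] by auto
      obtain c d where ys': "ys' = c @ v # d" using split_list[OF v] by auto
      let ?C = "rev b @ v # d @ [a]"
      have "b \<noteq> [] \<or> d \<noteq> []" using neq xs ys' by auto
      then have "length ?C \<ge> 3" by (cases b; cases d) auto
      moreover have "set ?C \<subseteq> verts T" "distinct ?C"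
        using snoc.prems b unfolding ys xs ys' simple_path_def by auto
      moreover have "successively (adj T) ?C"
      proof -
        have 1: "successively (adj T) (v # b)" "successively (adj T) (v # d @ [a])"
          using p(1) snoc.prems(2) unfolding ys xs ys' simple_path_def
          by (auto simp: successively_append_iff)
        have "successively (adj T) (rev (v # b))"
          unfolding successively_rev using 1(1) by (subst adj_sym) 
        then show ?thesis using 1(2)
          by (auto simp: successively_append_iff simp del: successively_rev)
      qed
      moreover have "adj T (last ?C) (hd ?C)"
      proof -
        have "hd ?C = ?p" unfolding xs by (cases b rule: rev_cases) auto
        then show ?thesis using p(2) by (simp add: adj_sym)
      qed
      ultimately show False using acyclic unfolding is_cycle_def by blast
    qed
    then show ?thesis using snoc.IH[OF p(1)] q(1) ys by simp
  qed
qed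

section \<open>Parents, children, levels and branches, read off from the geodesics starting at
  \<open>o\<close>\<close>

definition rpath :: "'a \<Rightarrow> 'a list" where
  "rpath x = (THE xs. simple_path T rt xs x)"

definition par :: "'a \<Rightarrow> 'a" where
  "par x = last (butlast (rpath x))"

definition ch :: "'a \<Rightarrow> 'a set" where
  "ch x = {y \<in> verts T - {rt}. par y = x}"

definition lev :: "'a \<Rightarrow> nat" where
  "lev x = length (rpath x) - 1"

definition sub :: "'a \<Rightarrow> 'a set" where
  "sub v = {x \<in> verts T. v \<in> set (rpath x)}"

lemma rpath_eqI: "simple_path T rt xs x \<Longrightarrow> rpath x = xs"
  unfolding rpath_def by (rule the_equality) (auto dest: simple_path_unique)

lemma rpath_path: "x \<in> verts T \<Longrightarrow> simple_path T rt (rpath x) x"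
  using connected[OF rt_verts] rpath_eqI by metis

lemma rpath_rt: "rpath rt = [rt]"
  by (rule rpath_eqI) (simp add: simple_path_def rt_verts)

lemma rpath_facts:
  assumes "x \<in> verts T"
  shows "rpath x \<noteq> []" "hd (rpath x) = rt" "last (rpath x) = x" "set (rpath x) \<subseteq> verts T"
    "distinct (rpath x)"
  using rpath_path[OF assms] by (auto simp: simple_path_def)

lemma rpath_snoc:
  assumes "x \<in> verts T" "adj T x y" "y \<notin> set (rpath x)"
  shows "rpath y = rpath x @ [y]"
  using assms rpath_path[OF assms(1)] adj_verts[OF assms(2)]
  by (intro rpath_eqI) (auto simp: simple_path_def successively_append_iff)

lemma rpath_prefix:
  assumes "x \<in> verts T" "rpath x = a @ y # b"
  shows "rpath y = a @ [y]"
  using assms rpath_path[OF assms(1)]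
  by (intro rpath_eqI) (auto simp: simple_path_def successively_append_iff hd_append split: if_splits)

lemma rpath_par_facts:
  assumes "x \<in> verts T" "x \<noteq> rt"
  shows "rpath x = rpath (par x) @ [x]" "par x \<in> verts T" "adj T (par x) x"
proof -
  note f = rpath_facts[OF assms(1)]
  obtain ys where ys: "rpath x = ys @ [x]" using f by (metis append_butlast_last_id)
  have ne: "ys \<noteq> []" using f(2) ys assms(2) by auto
  then obtain a y where y: "ys = a @ [y]" by (metis append_butlast_last_id)
  then have p: "par x = y" using ys by (simp add: par_def butlast_append)
  have "rpath y = a @ [y]" using rpath_prefix[OF assms(1), of a y "[x]"] ys y by simp
  then show "rpath x = rpath (par x) @ [x]" using ys y p by simp
  show "par x \<in> verts T" using f(4) ys y p by auto
  show "adj T (par x) x" using rpath_path[OF assms(1)] ys y p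
    by (auto simp: simple_path_def successively_append_iff)
qed

text \<open>If \<open>y\<close> already lies on the geodesic to \<open>x\<close>, the stretch from
  \<open>y\<close> to \<open>x\<close> together with the edge is a cycle unless it has just two
  vertices; otherwise \<open>y\<close> extends the geodesic.\<close>

lemma adj_cases:
  assumes "adj T x y"
  shows "x \<noteq> rt \<and> y = par x \<or> y \<in> ch x"
proof (cases "y \<in> set (rpath x)")
  case False
  have x: "x \<in> verts T" "y \<in> verts T" using adj_verts[OF assms] by auto
  have "rpath y = rpath x @ [y]" by (rule rpath_snoc[OF x(1) assms False])
  then have "par y = x" "y \<noteq> rt" using rpath_facts[OF x(1)] rpath_rt
    by (auto simp: par_def butlast_append)
  then show ?thesis using x by (simp add: ch_def)
next
  case True
  have x: "x \<in> verts T" "y \<in> verts T" "x \<noteq> y" using adj_verts[OF assms] by auto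
  obtain a b where ab: "rpath x = a @ y # b" using split_list[OF True] by auto
  have b: "b \<noteq> []" using rpath_facts[OF x(1)] ab x(3) by auto
  have "\<not> length b \<ge> 2"
  proof
    assume "length b \<ge> 2"
    then have "is_cycle T (y # b)"
      using rpath_path[OF x(1)] ab b assms
      by (auto simp: is_cycle_def simple_path_def successively_append_iff)
    then show False using acyclic by blast
  qed
  then obtain c where "b = [c]" using b by (cases b; cases "tl b") auto
  then have "b = [x]" using rpath_facts[OF x(1)] ab by auto
  then have "par x = y" "x \<noteq> rt" using ab rpath_rt by (auto simp: par_def butlast_append)
  then show ?thesis by simp
qed

lemma chD: "y \<in> ch x \<Longrightarrow> y \<in> verts T \<and> y \<noteq> rt \<and> par y = x \<and> x \<in> verts T \<and> adj T x y"
  using rpath_par_facts by (auto simp: ch_def)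

lemma ch_rpath: "y \<in> ch x \<Longrightarrow> rpath y = rpath x @ [y]"
  using chD rpath_par_facts(1) by metis

lemma rpath_set_par: "x \<in> verts T \<Longrightarrow> x \<noteq> rt \<Longrightarrow> set (rpath x) = insert x (set (rpath (par x))) \<and> x \<notin> set (rpath (par x))"
proof -
  assume x: "x \<in> verts T" "x \<noteq> rt"
  have "set (rpath x) = set (rpath (par x) @ [x])" "distinct (rpath (par x) @ [x])"
    using rpath_par_facts(1)[OF x] rpath_facts(5)[OF x(1)] by metis+
  then show ?thesis by auto
qed

lemma rt_in_rpath: "x \<in> verts T \<Longrightarrow> rt \<in> set (rpath x)"
  using rpath_facts(1,2)[of x] hd_in_set[of "rpath x"] by auto

lemma self_in_rpath: "x \<in> verts T \<Longrightarrow> x \<in> set (rpath x)"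
  using rpath_facts(1,3)[of x] last_in_set[of "rpath x"] by auto

lemma lev_rt: "lev rt = 0" by (simp add: lev_def rpath_rt)

lemma lev_par: "x \<in> verts T \<Longrightarrow> x \<noteq> rt \<Longrightarrow> lev x = Suc (lev (par x))"
  using rpath_par_facts(1,2)[of x] rpath_facts(1)[of "par x"] by (cases "rpath (par x)") (auto simp: lev_def)

lemma lev_ch: "y \<in> ch x \<Longrightarrow> lev y = Suc (lev x)"
  using chD lev_par by metis

lemma lev_0_iff: "x \<in> verts T \<Longrightarrow> lev x = 0 \<longleftrightarrow> x = rt"
  using lev_par[of x] lev_rt by (cases "x = rt") auto

lemma tree_induct [consumes 1, case_names rt par]:
  assumes "x \<in> verts T" and "P rt"
    and "\<And>x. x \<in> verts T \<Longrightarrow> x \<noteq> rt \<Longrightarrow> P (par x) \<Longrightarrow> P x"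
  shows "P x"
  using assms(1)
proof (induction "lev x" arbitrary: x)
  case 0
  then show ?case using lev_0_iff assms(2) by metis
next
  case (Suc n)
  then have "x \<noteq> rt" using lev_rt by auto
  then show ?case using Suc lev_par rpath_par_facts(2) assms(3) by (metis Suc_inject)
qed

lemma nbrs_eq: "x \<in> verts T \<Longrightarrow> x \<noteq> rt \<Longrightarrow> nbrs T x = insert (par x) (ch x)"
  using adj_cases[of x] rpath_par_facts[of x] chD[of _ x] adj_sym[of x "par x"] by (auto simp: nbrs_def)

lemma ch_subset: "ch x \<subseteq> nbrs T x"
  using chD by (auto simp: nbrs_def)

lemma par_notin_ch: "x \<in> verts T \<Longrightarrow> x \<noteq> rt \<Longrightarrow> par x \<notin> ch x"
  using lev_ch[of "par x" x] lev_par[of x] by auto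

lemma finite_ch: "x \<in> verts T \<Longrightarrow> finite (ch x)"
  using ch_subset locally_finite finite_subset by metis

lemma root_edge_ch: "\<exists>r. ch rt = {r} \<and> root_edge T = {rt, r}"
proof -
  have e: "root_edge T \<in> edges T" "rt \<in> root_edge T" using base_edges by auto
  then obtain r where r: "root_edge T = {rt, r}" "r \<noteq> rt"
    using edges_wf[OF e(1)] e(2) by (elim bexE conjE) (auto simp: insert_commute intro: that)
  then have adj: "adj T rt r" using e by (simp add: adj_def)
  have "r \<in> ch rt" using adj_cases[OF adj] by simp
  moreover have "y = r" if "y \<in> ch rt" for y
  proof -
    have "{rt, y} \<in> {e \<in> edges T. rt \<in> e}" using chD[OF that] by (simp add: adj_def)
    then have "{rt, y} = root_edge T" unfolding base_edges by simp
    then show ?thesis using r chD[OF that] by (auto simp: doubleton_eq_iff)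
  qed
  ultimately show ?thesis using r by blast
qed

definition rt_child :: 'a where "rt_child = (THE r. ch rt = {r})"

lemma ch_rt: "ch rt = {rt_child}" and root_edge_eq: "root_edge T = {rt, rt_child}"
  using root_edge_ch by (auto simp: rt_child_def)

lemma ch_nonempty:
  assumes "x \<in> verts T"
  shows "ch x \<noteq> {}"
proof (cases "x = rt")
  case True then show ?thesis by (simp add: ch_rt)
next
  case False
  show ?thesis
  proof
    assume "ch x = {}"
    have "{e \<in> edges T. x \<in> e} \<subseteq> {{x, par x}}"
    proof
      fix e assume "e \<in> {e \<in> edges T. x \<in> e}"
      then obtain y where "e = {x, y}" "e \<in> edges T"
        using edges_wf[of e] by blast
      then have "e = {x, y}" "adj T x y" by (auto simp: adj_def)
      then show "e \<in> {{x, par x}}" using adj_cases \<open>ch x = {}\<close> by blast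
    qed
    then have "card {e \<in> edges T. x \<in> e} \<le> 1"
      using card_mono[of "{{x, par x}}"] by simp
    then show False using no_leaves[OF assms False] by simp
  qed
qed

definition level :: "nat \<Rightarrow> 'a set" where
  "level n = {x \<in> verts T. lev x = n}"

lemma level_0: "level 0 = {rt}"
  using lev_0_iff rt_verts lev_rt by (auto simp: level_def)

lemma level_Suc: "level (Suc n) = (\<Union>x\<in>level n. ch x)"
proof (intro equalityI subsetI)
  fix y assume "y \<in> level (Suc n)"
  then have y: "y \<in> verts T" "lev y = Suc n" by (auto simp: level_def)
  then have "y \<noteq> rt" using lev_rt by auto
  then have "par y \<in> level n" "y \<in> ch (par y)"
    using lev_par[OF y(1)] y rpath_par_facts[OF y(1)] by (auto simp: level_def ch_def)
  then show "y \<in> (\<Union>x\<in>level n. ch x)" by auto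
next
  fix y assume "y \<in> (\<Union>x\<in>level n. ch x)"
  then show "y \<in> level (Suc n)" using chD[of y] lev_ch[of y] by (auto simp: level_def)
qed

lemma finite_level: "finite (level n)"
proof (induction n)
  case (Suc n)
  have "level n \<subseteq> verts T" by (auto simp: level_def)
  then show ?case using Suc finite_ch by (auto simp: level_Suc)
qed (simp add: level_0)

lemma sum_level_Suc:
  fixes g :: "'a \<Rightarrow> real"
  shows "(\<Sum>y\<in>level (Suc n). g y) = (\<Sum>x\<in>level n. \<Sum>y\<in>ch x. g y)"
  unfolding level_Suc
proof (rule sum.UNION_disjoint[OF finite_level])
  show "\<forall>x\<in>level n. finite (ch x)" using finite_ch by (simp add: level_def)
qed (auto simp: ch_def)

lemma verts_level: "verts T = (\<Union>n. level n)"
  by (auto simp: level_def)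

lemma countable_verts: "countable (verts T)"
  unfolding verts_level by (simp add: countable_finite finite_level)

text \<open>A branch is entered and left only across the edge above its top vertex \<open>v\<close>.
  Both the convergence of transient trajectories and the superharmonicity of the barrier rest on
  this.\<close>

lemma sub_par: "x \<in> verts T \<Longrightarrow> x \<noteq> rt \<Longrightarrow> x \<noteq> v \<Longrightarrow> x \<in> sub v \<longleftrightarrow> par x \<in> sub v"
  using rpath_set_par[of x] rpath_par_facts(2)[of x] by (auto simp: sub_def)

lemma sub_ch: "y \<in> ch x \<Longrightarrow> x \<in> sub v \<Longrightarrow> y \<in> sub v"
  using chD[of y x] ch_rpath[of y x] by (auto simp: sub_def)

lemma sub_self: "x \<in> verts T \<Longrightarrow> x \<in> sub x"
  by (simp add: sub_def self_in_rpath)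

lemma sub_rt: "sub rt = verts T"
  by (auto simp: sub_def rt_in_rpath)

lemma rt_notin_sub: "v \<noteq> rt \<Longrightarrow> rt \<notin> sub v"
  by (simp add: sub_def rpath_rt)

lemma sub_verts: "sub v \<subseteq> verts T" by (auto simp: sub_def)

lemma rpath_nth_lev:
  assumes "x \<in> sub v"
  shows "lev v < length (rpath x) \<and> rpath x ! lev v = v"
proof -
  have x: "x \<in> verts T" "v \<in> set (rpath x)" using assms by (auto simp: sub_def)
  obtain a b where ab: "rpath x = a @ v # b" using split_list[OF x(2)] by auto
  have "rpath v = a @ [v]" by (rule rpath_prefix[OF x(1) ab])
  then have "lev v = length a" by (simp add: lev_def)
  then show ?thesis using ab by simp
qed

text \<open>The geodesic to \<open>x\<close> has exactly one entry at each level, so branches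
  hanging at the same level are disjoint.\<close>

lemma sub_lev_unique: "x \<in> sub v \<Longrightarrow> x \<in> sub w \<Longrightarrow> lev v = lev w \<Longrightarrow> v = w"
  using rpath_nth_lev by metis

lemma sub_lev_le: "x \<in> sub v \<Longrightarrow> lev v \<le> lev x"
  using rpath_nth_lev[of x v] by (auto simp: lev_def)

lemma sub_split:
  assumes "x \<in> sub v" "x \<noteq> v"
  shows "\<exists>w\<in>ch v. x \<in> sub w"
proof -
  have "x \<in> verts T" using assms sub_verts by auto
  then show ?thesis using assms
  proof (induction rule: tree_induct)
    case rt
    then show ?case using rt_notin_sub by auto
  next
    case (par x)
    then have p: "par x \<in> sub v" using sub_par by simp
    show ?case
    proof (cases "par x = v")
      case True
      then show ?thesis using par sub_self by (auto simp: ch_def)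
    next
      case False
      then obtain w where "w \<in> ch v" "par x \<in> sub w" using par.IH p by auto
      moreover have "x \<in> ch (par x)" using par by (simp add: ch_def)
      ultimately show ?thesis using sub_ch by blast
    qed
  qed
qed

section \<open>Edges and ends described by children; every edge is indexed by its lower
  endpoint\<close>

lemma edges_eq: "edges T = (\<lambda>v. {par v, v}) ` (verts T - {rt})"
proof (intro equalityI subsetI)
  fix e assume "e \<in> edges T"
  then obtain x y where e: "e = {x, y}" "adj T x y"
    using edges_wf[of e] by (auto simp: adj_def)
  have xy: "x \<in> verts T" "y \<in> verts T" using adj_verts[OF e(2)] by auto
  show "e \<in> (\<lambda>v. {par v, v}) ` (verts T - {rt})"
    using adj_cases[OF e(2)]
  proof
    assume "x \<noteq> rt \<and> y = par x"
    then show ?thesis using e xy by (auto intro!: image_eqI[of _ _ x])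
  next
    assume "y \<in> ch x"
    then show ?thesis using e xy chD by (auto intro!: image_eqI[of _ _ y])
  qed
next
  fix e assume "e \<in> (\<lambda>v. {par v, v}) ` (verts T - {rt})"
  then show "e \<in> edges T" using rpath_par_facts(3) by (auto simp: adj_def)
qed

lemma inj_edge: "inj_on (\<lambda>v. {par v, v}) (verts T - {rt})"
proof (rule inj_onI)
  fix v w assume v: "v \<in> verts T - {rt}" and w: "w \<in> verts T - {rt}" and eq: "{par v, v} = {par w, w}"
  show "v = w"
  proof (rule ccontr)
    assume "v \<noteq> w"
    then have "par v = w" "par w = v" using eq by (auto simp: doubleton_eq_iff)
    then show False using lev_par[of v] lev_par[of w] v w by simp
  qed
qed

lemma verts_at_edge:
  assumes "v \<in> verts T - {rt}"
  shows "verts_at T {par v, v} = sub v"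
proof (intro equalityI subsetI)
  fix x assume "x \<in> verts_at T {par v, v}"
  then obtain xs i where xs: "simple_path T rt xs x" and i: "{par v, v} = {xs ! i, xs ! Suc i}" "Suc i < length xs"
    by (auto simp: verts_at_def path_edges_def)
  have "v \<in> {xs ! i, xs ! Suc i}" using i by blast
  then have "v \<in> set xs" using i(2) nth_mem[of i xs] nth_mem[of "Suc i" xs] by auto
  moreover have "x \<in> verts T" using xs by (auto simp: simple_path_def)
  ultimately show "x \<in> sub v" using rpath_eqI[OF xs] by (simp add: sub_def)
next
  fix x assume "x \<in> sub v"
  then have x: "x \<in> verts T" "v \<in> set (rpath x)" by (auto simp: sub_def)
  obtain a b where ab: "rpath x = a @ v # b" using split_list[OF x(2)] by auto
  have "rpath v = a @ [v]" by (rule rpath_prefix[OF x(1) ab])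
  then have "a = rpath (par v)" using rpath_par_facts(1)[of v] assms by auto
  then obtain c where c: "a = c @ [par v]"
    using rpath_facts[of "par v"] rpath_par_facts(2)[of v] assms by (metis DiffE append_butlast_last_id singletonI)
  have "{par v, v} \<in> path_edges (rpath x)"
    unfolding path_edges_def ab c by (auto intro!: exI[of _ "length c"] simp: nth_append)
  then show "x \<in> verts_at T {par v, v}" using rpath_path[OF x(1)] by (auto simp: verts_at_def)
qed

text \<open>The first step from \<open>o\<close> must go to a child. After a step to a child, the
  parent is the vertex just left, so not backtracking forces another step to a child.\<close>

lemma boundary_eq: "boundary T = {\<zeta>. \<zeta> 0 = rt \<and> (\<forall>n. \<zeta> (Suc n) \<in> ch (\<zeta> n))}"
proof (intro equalityI subsetI)
  fix \<zeta> assume "\<zeta> \<in> boundary T"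
  then have z: "\<zeta> 0 = rt" "\<And>n. adj T (\<zeta> n) (\<zeta> (Suc n))" "\<And>n. \<zeta> (Suc (Suc n)) \<noteq> \<zeta> n"
    by (auto simp: boundary_def)
  have "\<zeta> (Suc n) \<in> ch (\<zeta> n)" for n
  proof (induction n)
    case 0
    then show ?case using adj_cases[OF z(2)[of 0]] z(1) by auto
  next
    case (Suc n)
    then show ?case using adj_cases[OF z(2)[of "Suc n"]] z(3)[of n] chD[OF Suc] by auto
  qed
  then show "\<zeta> \<in> {\<zeta>. \<zeta> 0 = rt \<and> (\<forall>n. \<zeta> (Suc n) \<in> ch (\<zeta> n))}" using z by simp
next
  fix \<zeta> assume "\<zeta> \<in> {\<zeta>. \<zeta> 0 = rt \<and> (\<forall>n. \<zeta> (Suc n) \<in> ch (\<zeta> n))}"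
  then have z: "\<zeta> 0 = rt" "\<And>n. \<zeta> (Suc n) \<in> ch (\<zeta> n)" by auto
  have v: "\<zeta> n \<in> verts T" for n using chD[OF z(2)[of n]] by simp
  have "\<zeta> (Suc (Suc n)) \<noteq> \<zeta> n" for n
    using lev_ch[OF z(2)[of n]] lev_ch[OF z(2)[of "Suc n"]] by auto
  moreover have "{\<zeta> 0, \<zeta> 1} = root_edge T" using z(1) z(2)[of 0] ch_rt root_edge_eq by simp
  ultimately show "\<zeta> \<in> boundary T" using v z chD[OF z(2)] by (auto simp: boundary_def)
qed

lemma boundaryD:
  assumes "\<zeta> \<in> boundary T"
  shows "\<zeta> 0 = rt" "\<zeta> (Suc n) \<in> ch (\<zeta> n)" "\<zeta> n \<in> verts T" "lev (\<zeta> n) = n" "par (\<zeta> (Suc n)) = \<zeta> n"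
    "\<zeta> (Suc n) \<noteq> rt"
proof -
  have z: "\<zeta> 0 = rt" "\<And>n. \<zeta> (Suc n) \<in> ch (\<zeta> n)" using assms unfolding boundary_eq by auto
  show "\<zeta> 0 = rt" "\<zeta> (Suc n) \<in> ch (\<zeta> n)" "\<zeta> n \<in> verts T" "par (\<zeta> (Suc n)) = \<zeta> n" "\<zeta> (Suc n) \<noteq> rt"
    using z chD[OF z(2)[of n]] by auto
  show "lev (\<zeta> n) = n"
    by (induction n) (auto simp: z(1) lev_rt lev_ch[OF z(2)])
qed

lemma boundary_inj: "\<zeta> \<in> boundary T \<Longrightarrow> inj \<zeta>"
  by (rule injI) (metis boundaryD(4))

lemma geodesic_edges_eq:
  assumes "\<zeta> \<in> boundary T"
  shows "geodesic_edges \<zeta> = (\<lambda>v. {par v, v}) ` range (\<lambda>n. \<zeta> (Suc n))"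
  by (simp add: geodesic_edges_def image_image boundaryD(5)[OF assms])

lemma boundary_at_edge:
  assumes v: "v \<in> verts T - {rt}"
  shows "boundary_at T {par v, v} = {\<zeta> \<in> boundary T. \<zeta> (lev v) = v}"
proof -
  have "{par v, v} \<in> geodesic_edges \<zeta> \<longleftrightarrow> \<zeta> (lev v) = v" if z: "\<zeta> \<in> boundary T" for \<zeta>
  proof -
    have sub: "range (\<lambda>n. \<zeta> (Suc n)) \<subseteq> verts T - {rt}" using boundaryD[OF z] by auto
    have "{par v, v} \<in> geodesic_edges \<zeta> \<longleftrightarrow> v \<in> range (\<lambda>n. \<zeta> (Suc n))"
      unfolding geodesic_edges_eq[OF z] by (rule inj_on_image_mem_iff[OF inj_edge v sub])
    also have "\<dots> \<longleftrightarrow> \<zeta> (lev v) = v"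
    proof
      assume "v \<in> range (\<lambda>n. \<zeta> (Suc n))"
      then show "\<zeta> (lev v) = v" using boundaryD(4)[OF z] by auto
    next
      assume "\<zeta> (lev v) = v"
      moreover obtain m where "lev v = Suc m" using v lev_par[of v] by auto
      ultimately show "v \<in> range (\<lambda>n. \<zeta> (Suc n))" by (metis rangeI)
    qed
    finally show ?thesis .
  qed
  then show ?thesis by (auto simp: boundary_at_def)
qed

lemma boundary_sub: "\<zeta> \<in> boundary T \<Longrightarrow> n \<le> m \<Longrightarrow> \<zeta> m \<in> sub (\<zeta> n)"
proof (induction m)
  case 0
  then show ?case using sub_self boundaryD by simp
next
  case (Suc m)
  then show ?case using sub_self boundaryD sub_ch by (metis le_SucE)
qed

text \<open>Koenig's lemma, the only form in which compactness of the boundary is used: a property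
  that always passes to some child holds along a whole end.\<close>

lemma koenig:
  assumes "Q rt" and "\<And>v. v \<in> verts T \<Longrightarrow> Q v \<Longrightarrow> \<exists>w\<in>ch v. Q w"
  shows "\<exists>\<zeta>\<in>boundary T. \<forall>n. Q (\<zeta> n)"
proof -
  define nx where "nx v = (SOME w. w \<in> ch v \<and> Q w)" for v
  have nx: "nx v \<in> ch v \<and> Q (nx v)" if "v \<in> verts T" "Q v" for v
    unfolding nx_def using assms(2)[OF that] by (intro someI_ex[of "\<lambda>w. w \<in> ch v \<and> Q w"]) blast
  define \<zeta> where "\<zeta> n = (nx ^^ n) rt" for n
  have z: "\<zeta> n \<in> verts T \<and> Q (\<zeta> n)" for n
  proof (induction n)
    case (Suc n)
    then show ?case using nx[of "\<zeta> n"] chD[of "nx (\<zeta> n)" "\<zeta> n"] by (simp add: \<zeta>_def)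
  qed (simp add: \<zeta>_def assms(1) rt_verts)
  have "\<zeta> (Suc n) \<in> ch (\<zeta> n)" for n
    using nx z[of n] by (simp add: \<zeta>_def)
  then have "\<zeta> \<in> boundary T" by (auto simp: boundary_eq \<zeta>_def)
  then show ?thesis using z by auto
qed

end

section \<open>Flows and conductances\<close>

context rooted_tree
begin

section \<open>Finite balls, the node law and summation by parts\<close>

definition tree_ball :: "nat \<Rightarrow> 'a set" where
  "tree_ball m = {v \<in> verts T - {rt}. lev v \<le> m}"

lemma ball_0: "tree_ball 0 = {}"
  using lev_0_iff by (auto simp: tree_ball_def)

lemma ball_Suc: "tree_ball (Suc m) = tree_ball m \<union> level (Suc m)" "tree_ball m \<inter> level (Suc m) = {}"
  using lev_rt by (auto simp: tree_ball_def level_def)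

lemma finite_ball: "finite (tree_ball m)"
  by (induction m) (auto simp: ball_0 ball_Suc finite_level)

lemma sum_ball_Suc:
  fixes g :: "'a \<Rightarrow> real"
  shows "(\<Sum>v\<in>tree_ball (Suc m). g v) = (\<Sum>v\<in>tree_ball m. g v) + (\<Sum>v\<in>level (Suc m). g v)"
  unfolding ball_Suc(1) by (rule sum.union_disjoint) (auto simp: finite_ball finite_level ball_Suc(2))

lemma ball_mono: "m \<le> n \<Longrightarrow> tree_ball m \<subseteq> tree_ball n"
  by (auto simp: tree_ball_def)

lemma finite_subset_ball:
  assumes "finite X" "X \<subseteq> verts T - {rt}"
  shows "\<exists>m. X \<subseteq> tree_ball m"
proof -
  have "\<forall>v\<in>X. lev v \<le> Max (lev ` X)" using assms(1) by auto
  then show ?thesis using assms(2) by (auto simp: tree_ball_def)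
qed

text \<open>Kirchhoff's node law between the source \<open>o\<close> and level \<open>m\<close>. The
  bound \<open>m\<close> is there because the gradient of a tree truncated at level \<open>m\<close>
  obeys the law only at smaller levels; at level \<open>m\<close> the current leaves the
  network.\<close>

definition is_flow :: "nat \<Rightarrow> ('a \<Rightarrow> real) \<Rightarrow> bool" where
  "is_flow m G \<longleftrightarrow> (\<forall>v\<in>verts T - {rt}. lev v < m \<longrightarrow> G v = (\<Sum>w\<in>ch v. G w))"

text \<open>Passing from level \<open>m\<close> to the next, the node law collects the terms
  \<open>G v * u (par v)\<close> into exactly the boundary sum of the previous level, which
  therefore cancels.\<close>

lemma sum_by_parts:
  assumes "u rt = 0" "is_flow m G"
  shows "(\<Sum>v\<in>tree_ball m. G v * (u v - u (par v))) = (\<Sum>v\<in>level m. G v * u v)"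
  using assms(2)
proof (induction m)
  case 0
  then show ?case by (simp add: ball_0 level_0 assms(1))
next
  case (Suc m)
  have fl: "is_flow m G" using Suc.prems by (auto simp: is_flow_def)
  have "(\<Sum>v\<in>level (Suc m). G v * u (par v)) = (\<Sum>x\<in>level m. \<Sum>y\<in>ch x. G y * u (par y))"
    by (rule sum_level_Suc)
  also have "\<dots> = (\<Sum>x\<in>level m. G x * u x)"
  proof (rule sum.cong[OF refl])
    fix x assume x: "x \<in> level m"
    have "(\<Sum>y\<in>ch x. G y * u (par y)) = (\<Sum>y\<in>ch x. G y) * u x"
      unfolding sum_distrib_right by (rule sum.cong) (auto simp: ch_def)
    also have "\<dots> = G x * u x"
    \<comment> \<open>The node law is not assumed at \<open>o\<close>; there \<open>u rt = 0\<close>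
      makes both sides vanish.\<close>
    proof (cases "x = rt")
      case False
      then have "G x = (\<Sum>y\<in>ch x. G y)" using Suc.prems x by (auto simp: is_flow_def level_def)
      then show ?thesis by simp
    qed (simp add: assms(1))
    finally show "(\<Sum>y\<in>ch x. G y * u (par y)) = G x * u x" .
  qed
  finally have "(\<Sum>v\<in>level (Suc m). G v * u (par v)) = (\<Sum>x\<in>level m. G x * u x)" .
  then show ?case using Suc.IH[OF fl]
    by (simp add: sum_ball_Suc right_diff_distrib sum_subtractf)
qed

lemma flow_total:
  assumes "1 \<le> m" "is_flow m G"
  shows "(\<Sum>v\<in>level m. G v) = G rt_child"
  using assms
proof (induction m rule: nat_induct_at_least)
  case base
  have "level 1 = {rt_child}" using level_Suc[of 0] by (simp add: level_0 ch_rt)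
  then show ?case by simp
next
  case (Suc m)
  then have fl: "is_flow m G" by (auto simp: is_flow_def)
  have "(\<Sum>v\<in>level (Suc m). G v) = (\<Sum>x\<in>level m. \<Sum>y\<in>ch x. G y)" by (rule sum_level_Suc)
  also have "\<dots> = (\<Sum>x\<in>level m. G x)"
  proof (rule sum.cong[OF refl])
    fix x assume x: "x \<in> level m"
    then have "x \<noteq> rt" using Suc.hyps lev_rt by (auto simp: level_def)
    then show "(\<Sum>y\<in>ch x. G y) = G x" using Suc.prems x by (auto simp: is_flow_def level_def)
  qed
  finally show ?case using Suc.IH[OF fl] by simp
qed

text \<open>If \<open>k v\<close> is the probability that the walk started at \<open>v\<close> never visits the parent of \<open>v\<close>, then
  \<open>surv k v\<close> is the probability of hitting \<open>o\<close> from \<open>v\<close>.\<close>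

definition surv :: "('a \<Rightarrow> real) \<Rightarrow> 'a \<Rightarrow> real" where
  "surv k v = (\<Prod>u\<in>set (rpath v) - {rt}. 1 - k u)"

text \<open>The drop of \<open>surv k\<close> across the edge above \<open>v\<close>, see
  \<open>grad_diff\<close>, so sums along an end telescope. The product form makes sign and node law
  easy to read off.\<close>

definition grad :: "('a \<Rightarrow> real) \<Rightarrow> 'a \<Rightarrow> real" where
  "grad k v = surv k (par v) * k v"

lemma surv_rt: "surv k rt = 1"
  by (simp add: surv_def rpath_rt)

lemma surv_par:
  assumes "v \<in> verts T" "v \<noteq> rt"
  shows "surv k v = surv k (par v) * (1 - k v)"
proof -
  have "set (rpath v) - {rt} = insert v (set (rpath (par v)) - {rt})" "v \<notin> set (rpath (par v))"
    using rpath_set_par[OF assms] assms by auto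
  then show ?thesis by (simp add: surv_def)
qed

lemma grad_diff: "v \<in> verts T \<Longrightarrow> v \<noteq> rt \<Longrightarrow> grad k v = surv k (par v) - surv k v"
  by (simp add: grad_def surv_par algebra_simps)

text \<open>The hypothesis on \<open>k\<close> is the series-parallel law
  \<open>k = S / (1 + S)\<close> cleared of its denominator. Multiplied by
  \<open>surv k (par v)\<close> it becomes the node law.\<close>

lemma grad_flow:
  assumes "v \<in> verts T" "v \<noteq> rt" "k v = (1 - k v) * (\<Sum>w\<in>ch v. k w)"
  shows "grad k v = (\<Sum>w\<in>ch v. grad k w)"
proof -
  have "(\<Sum>w\<in>ch v. grad k w) = surv k v * (\<Sum>w\<in>ch v. k w)"
    unfolding sum_distrib_left by (rule sum.cong) (auto simp: grad_def ch_def)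
  also have "\<dots> = surv k (par v) * ((1 - k v) * (\<Sum>w\<in>ch v. k w))"
    by (simp add: surv_par[OF assms(1,2)])
  finally show ?thesis using assms(3) by (simp add: grad_def)
qed

lemma grad_path_sum:
  assumes "\<zeta> \<in> boundary T"
  shows "(\<Sum>n<N. grad k (\<zeta> (Suc n))) = 1 - surv k (\<zeta> N)"
  using boundaryD[OF assms]
  by (induction N) (simp_all add: surv_rt grad_diff)

lemma surv_bounds:
  assumes "\<And>u. u \<in> verts T \<Longrightarrow> 0 \<le> k u \<and> k u \<le> 1" "v \<in> verts T"
  shows "0 \<le> surv k v \<and> surv k v \<le> 1"
proof -
  have "set (rpath v) \<subseteq> verts T" using rpath_facts assms(2) by simp
  then show ?thesis unfolding surv_def using assms(1)
    by (intro conjI prod_nonneg prod_le_1) (auto simp: subset_iff)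
qed

lemma grad_nonneg:
  assumes "\<And>u. u \<in> verts T \<Longrightarrow> 0 \<le> k u \<and> k u \<le> 1" "v \<in> verts T" "v \<noteq> rt"
  shows "0 \<le> grad k v"
  using surv_bounds[of k "par v"] assms rpath_par_facts(2)[of v] by (simp add: grad_def)

text \<open>\<open>cond n v\<close> is the effective conductance, for unit resistances, between the parent of \<open>v\<close> and the
  descendants of \<open>v\<close> at distance \<open>n\<close> from \<open>v\<close>, by the series and parallel laws. Its limit \<open>cap v\<close> is
  the capacity of the boundary of the subtree hanging from the edge above \<open>v\<close>.\<close>

primrec cond :: "nat \<Rightarrow> 'a \<Rightarrow> real" where
  "cond 0 v = 1"
| "cond (Suc n) v = (\<Sum>w\<in>ch v. cond n w) / (1 + (\<Sum>w\<in>ch v. cond n w))"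

lemma cond_bounds: "0 \<le> cond n v \<and> cond n v \<le> 1"
proof (induction n arbitrary: v)
  case (Suc n)
  have "0 \<le> (\<Sum>w\<in>ch v. cond n w)" by (intro sum_nonneg) (use Suc in auto)
  then show ?case by (simp add: field_simps)
qed simp

lemma cond_sum_nonneg: "0 \<le> (\<Sum>w\<in>ch v. cond n w)"
  by (intro sum_nonneg) (use cond_bounds in auto)

lemma cond_Suc_le: "cond (Suc n) v \<le> cond n v"
proof (induction n arbitrary: v)
  case 0
  then show ?case using cond_bounds[of 1 v] by simp
next
  case (Suc n)
  let ?a = "\<Sum>w\<in>ch v. cond (Suc n) w" and ?b = "\<Sum>w\<in>ch v. cond n w"
  have "?a \<le> ?b" by (intro sum_mono Suc)
  then have "?a / (1 + ?a) \<le> ?b / (1 + ?b)"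
    using cond_sum_nonneg[of "Suc n" v] cond_sum_nonneg[of n v] by (simp add: frac_le_eq field_simps)
  then show ?case by simp
qed

definition cap :: "'a \<Rightarrow> real" where
  "cap v = lim (\<lambda>n. cond n v)"

lemma decseq_cond: "decseq (\<lambda>n. cond n v)"
  using cond_Suc_le by (intro decseq_SucI)

lemma cond_tendsto: "(\<lambda>n. cond n v) \<longlonglongrightarrow> cap v"
proof -
  have "convergent (\<lambda>n. cond n v)"
    by (rule decseq_convergent[OF decseq_cond, of 0]) (auto simp: cond_bounds convergent_def)
  then show ?thesis by (simp add: cap_def convergent_LIMSEQ_iff)
qed

lemma cap_bounds: "0 \<le> cap v \<and> cap v \<le> 1"
  using LIMSEQ_le_const[OF cond_tendsto] LIMSEQ_le_const2[OF cond_tendsto] cond_bounds by blast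

lemma cap_sum_nonneg: "0 \<le> (\<Sum>w\<in>ch v. cap w)"
  by (intro sum_nonneg) (use cap_bounds in auto)

lemma cap_eq: "cap v = (\<Sum>w\<in>ch v. cap w) / (1 + (\<Sum>w\<in>ch v. cap w))"
proof (rule LIMSEQ_unique)
  show "(\<lambda>n. cond (Suc n) v) \<longlonglongrightarrow> cap v" using cond_tendsto by (rule LIMSEQ_Suc)
  show "(\<lambda>n. cond (Suc n) v) \<longlonglongrightarrow> (\<Sum>w\<in>ch v. cap w) / (1 + (\<Sum>w\<in>ch v. cap w))"
    unfolding cond.simps using cap_sum_nonneg[of v]
    by (intro tendsto_divide tendsto_add tendsto_const tendsto_sum cond_tendsto) auto
qed

lemma one_minus_cap: "(1 - cap v) * (1 + (\<Sum>w\<in>ch v. cap w)) = 1"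
  using cap_eq[of v] cap_sum_nonneg[of v] by (simp add: field_simps)

lemma cap_flow_eq: "cap v = (1 - cap v) * (\<Sum>w\<in>ch v. cap w)"
  using one_minus_cap[of v] by (simp add: algebra_simps)

text \<open>Strictness keeps every factor of \<open>surv cap\<close> positive, so the barrier may
  later divide by it.\<close>

lemma cap_less_1: "cap v < 1"
proof -
  have "1 - cap v \<noteq> 0" using one_minus_cap[of v] by auto
  then show ?thesis using cap_bounds[of v] by simp
qed

lemma surv_cap_pos: "0 < surv cap v"
  unfolding surv_def by (intro prod_pos) (auto simp: cap_less_1)

text \<open>With \<open>S\<close> the sum of \<open>cap\<close> over the \<open>d\<close> children,
  \<open>one_minus_cap\<close> turns the parent's value into \<open>surv cap x * (1 + S)\<close>,
  while the children contribute \<open>surv cap x * (d - S)\<close>; \<open>S\<close> cancels. This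
  links the capacity recursion to the random walk.\<close>

lemma surv_cap_harmonic:
  assumes "x \<in> verts T" "x \<noteq> rt"
  shows "(\<Sum>y\<in>nbrs T x. surv cap y) = real (card (nbrs T x)) * surv cap x"
proof -
  have "(\<Sum>y\<in>nbrs T x. surv cap y) = surv cap (par x) + (\<Sum>y\<in>ch x. surv cap y)"
    unfolding nbrs_eq[OF assms] using par_notin_ch[OF assms] finite_ch[OF assms(1)] by simp
  also have "(\<Sum>y\<in>ch x. surv cap y) = (\<Sum>y\<in>ch x. surv cap x * (1 - cap y))"
    by (rule sum.cong) (auto simp: ch_def surv_par)
  also have "\<dots> = surv cap x * (real (card (ch x)) - (\<Sum>y\<in>ch x. cap y))"
    by (simp add: sum_distrib_left[symmetric] sum_subtractf)
  also have "surv cap (par x) = surv cap (par x) * ((1 - cap x) * (1 + (\<Sum>w\<in>ch x. cap w)))"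
    by (simp add: one_minus_cap)
  also have "\<dots> = surv cap x * (1 + (\<Sum>w\<in>ch x. cap w))"
    by (simp add: surv_par[OF assms])
  also have "surv cap x * (1 + (\<Sum>w\<in>ch x. cap w)) + surv cap x * (real (card (ch x)) - (\<Sum>y\<in>ch x. cap y))
     = (1 + real (card (ch x))) * surv cap x" by (simp add: algebra_simps)
  also have "1 + real (card (ch x)) = real (card (nbrs T x))"
    unfolding nbrs_eq[OF assms] using par_notin_ch[OF assms] finite_ch[OF assms(1)] by simp
  finally show ?thesis .
qed

text \<open>Conductances of the tree truncated at level \<open>n\<close>; their gradient is admissible for \<open>\<partial>T\<close> and
  minimises the energy among the admissible functions supported up to level \<open>n\<close>.\<close>

definition tcond :: "nat \<Rightarrow> 'a \<Rightarrow> real" where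
  "tcond n v = cond (n - lev v) v"

lemma tcond_bounds: "0 \<le> tcond n v \<and> tcond n v \<le> 1"
  by (simp add: tcond_def cond_bounds)

lemma tcond_flow_eq:
  assumes "lev v < n"
  shows "tcond n v = (1 - tcond n v) * (\<Sum>w\<in>ch v. tcond n w)"
proof -
  obtain m where m: "n - lev v = Suc m" using assms by (metis Suc_diff_Suc)
  have "(\<Sum>w\<in>ch v. tcond n w) = (\<Sum>w\<in>ch v. cond m w)"
  proof (rule sum.cong[OF refl])
    fix w assume "w \<in> ch v"
    then have "n - lev w = m" using m lev_ch by simp
    then show "tcond n w = cond m w" by (simp add: tcond_def)
  qed
  moreover have "tcond n v = (\<Sum>w\<in>ch v. cond m w) / (1 + (\<Sum>w\<in>ch v. cond m w))"
    by (simp add: tcond_def m)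
  ultimately show ?thesis using cond_sum_nonneg[of m v] by (simp add: field_simps)
qed

text \<open>The factor at level \<open>n\<close> is \<open>1 - cond 0 v = 0\<close> and annihilates
  all deeper products. At \<open>o\<close> the product is empty, whence
  \<open>1 \<le> n\<close>.\<close>

lemma surv_tcond_0:
  assumes "1 \<le> n" "v \<in> verts T" "n \<le> lev v"
  shows "surv (tcond n) v = 0"
  using assms(2,3)
proof (induction rule: tree_induct)
  case rt
  then show ?case using assms(1) by (simp add: lev_rt)
next
  case (par x)
  show ?case
  proof (cases "n = lev x")
    case True
    then show ?thesis using par by (simp add: surv_par tcond_def)
  next
    case False
    then have "n \<le> lev (par x)" using par lev_par[of x] by simp
    then show ?thesis using par by (simp add: surv_par)
  qed
qed

lemma flow_cap: "is_flow m (grad cap)"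
  unfolding is_flow_def using grad_flow cap_flow_eq by auto

lemma flow_tcond: "is_flow n (grad (tcond n))"
  unfolding is_flow_def using grad_flow tcond_flow_eq by auto

lemma grad_rt_child: "grad k rt_child = k rt_child"
proof -
  have "par rt_child = rt" using ch_rt chD by blast
  then show ?thesis by (simp add: grad_def surv_rt)
qed

abbreviation total_cap :: real where "total_cap \<equiv> cap rt_child"

lemma rt_child_facts: "rt_child \<in> verts T" "rt_child \<noteq> rt" "par rt_child = rt" "lev rt_child = 1"
  using ch_rt chD[of rt_child rt] lev_ch[of rt_child rt] lev_rt by auto

lemma grad_sum_ball:
  assumes "is_flow m G"
  shows "(\<Sum>v\<in>tree_ball m. G v * grad k v) = (\<Sum>v\<in>level m. G v * (1 - surv k v))"
proof -
  have "(\<Sum>v\<in>tree_ball m. G v * grad k v) = (\<Sum>v\<in>tree_ball m. G v * ((1 - surv k v) - (1 - surv k (par v))))"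
    by (rule sum.cong) (auto simp: tree_ball_def grad_diff)
  also have "\<dots> = (\<Sum>v\<in>level m. G v * (1 - surv k v))"
    by (rule sum_by_parts) (use assms in \<open>auto simp: surv_rt\<close>)
  finally show ?thesis .
qed

text \<open>The truncated potential equals 1 on level \<open>n\<close>, so pairing a flow with its
  gradient returns the strength of the flow. Applied to the gradient itself this gives its energy,
  applied to \<open>grad cap\<close> the mixed term.\<close>

lemma grad_tcond_sum:
  assumes "1 \<le> n" "n \<le> m" "is_flow n G"
  shows "(\<Sum>v\<in>tree_ball m. G v * grad (tcond n) v) = G rt_child"
proof -
  have "(\<Sum>v\<in>tree_ball m. G v * grad (tcond n) v) = (\<Sum>v\<in>tree_ball n. G v * grad (tcond n) v)"
  proof (rule sum.mono_neutral_right[OF finite_ball ball_mono[OF assms(2)]], rule ballI)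
    fix v assume "v \<in> tree_ball m - tree_ball n"
    then have "v \<in> verts T" "v \<noteq> rt" "lev v > n" by (auto simp: tree_ball_def)
    then have "surv (tcond n) (par v) = 0"
      using lev_par[of v] rpath_par_facts(2)[of v] by (intro surv_tcond_0[OF assms(1)]) auto
    then show "G v * grad (tcond n) v = 0" by (simp add: grad_def)
  qed
  also have "\<dots> = (\<Sum>v\<in>level n. G v * (1 - surv (tcond n) v))" by (rule grad_sum_ball[OF assms(3)])
  also have "\<dots> = (\<Sum>v\<in>level n. G v)"
    by (rule sum.cong) (auto simp: level_def surv_tcond_0[OF assms(1)])
  also have "\<dots> = G rt_child" by (rule flow_total[OF assms(1,3)])
  finally show ?thesis .
qed

text \<open>The index \<open>n - 1\<close> is \<open>n - lev rt_child\<close>: the conductance is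
  counted from the lower end of the root edge.\<close>

lemma tcond_energy:
  assumes "1 \<le> n" "n \<le> m"
  shows "(\<Sum>v\<in>tree_ball m. (grad (tcond n) v)\<^sup>2) = cond (n - 1) rt_child"
  using grad_tcond_sum[OF assms flow_tcond]
  by (simp add: power2_eq_square grad_rt_child tcond_def rt_child_facts)

text \<open>Only an inequality on each ball, since the potential \<open>1 - surv cap\<close> stays
  below 1; equality of the full energy is obtained later from the truncations.\<close>

lemma cap_energy_le: "(\<Sum>v\<in>tree_ball m. (grad cap v)\<^sup>2) \<le> total_cap"
proof (cases "m = 0")
  case True
  then show ?thesis by (simp add: ball_0 cap_bounds)
next
  case False
  have "(\<Sum>v\<in>tree_ball m. (grad cap v)\<^sup>2) = (\<Sum>v\<in>level m. grad cap v * (1 - surv cap v))"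
    using grad_sum_ball[OF flow_cap[of m], of cap] by (simp add: power2_eq_square)
  also have "\<dots> \<le> (\<Sum>v\<in>level m. grad cap v)"
  proof (rule sum_mono)
    fix v assume "v \<in> level m"
    then have v: "v \<in> verts T" "v \<noteq> rt" using False lev_rt by (auto simp: level_def)
    then have "0 \<le> grad cap v" by (intro grad_nonneg cap_bounds)
    then show "grad cap v * (1 - surv cap v) \<le> grad cap v"
      using surv_cap_pos[of v] by (simp add: mult_left_le)
  qed
  also have "\<dots> = total_cap" using flow_total[OF _ flow_cap[of m]] False by (simp add: grad_rt_child)
  finally show ?thesis .
qed

text \<open>Expanding the square, the mixed term is exactly \<open>total_cap\<close>, the strength
  of the flow \<open>grad cap\<close>. This is convergence of the truncated equilibrium functions in
  energy, with an explicit rate.\<close>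

lemma tcond_cap_energy:
  assumes "1 \<le> n"
  shows "(\<Sum>v\<in>tree_ball m. (grad (tcond n) v - grad cap v)\<^sup>2) \<le> cond (n - 1) rt_child - total_cap"
proof -
  \<comment> \<open>The ball must contain level \<open>n\<close>, otherwise the mixed term would be
    cut off.\<close>
  let ?m = "max m n"
  have "(\<Sum>v\<in>tree_ball m. (grad (tcond n) v - grad cap v)\<^sup>2) \<le> (\<Sum>v\<in>tree_ball ?m. (grad (tcond n) v - grad cap v)\<^sup>2)"
    by (intro sum_mono2 finite_ball ball_mono) auto
  also have "\<dots> = (\<Sum>v\<in>tree_ball ?m. (grad (tcond n) v)\<^sup>2) + (\<Sum>v\<in>tree_ball ?m. (grad cap v)\<^sup>2)
       - 2 * (\<Sum>v\<in>tree_ball ?m. grad cap v * grad (tcond n) v)"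
    by (simp add: power2_diff sum.distrib sum_subtractf sum_distrib_left mult_ac)
  also have "\<dots> \<le> cond (n - 1) rt_child + total_cap - 2 * total_cap"
    using tcond_energy[OF assms, of ?m] cap_energy_le[of ?m] grad_tcond_sum[OF assms _ flow_cap[of n], of ?m]
    by (simp add: grad_rt_child)
  finally show ?thesis by simp
qed

section \<open>Path sums and the pairing of admissible functions with the flow\<close>

definition path_sum :: "('a \<Rightarrow> real) \<Rightarrow> 'a \<Rightarrow> real" where
  "path_sum g v = (\<Sum>u\<in>set (rpath v) - {rt}. g u)"

lemma path_sum_rt: "path_sum g rt = 0"
  by (simp add: path_sum_def rpath_rt)

lemma path_sum_par:
  assumes "v \<in> verts T" "v \<noteq> rt"
  shows "path_sum g v = path_sum g (par v) + g v"
proof -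
  have "set (rpath v) - {rt} = insert v (set (rpath (par v)) - {rt})" "v \<notin> set (rpath (par v))"
    using rpath_set_par[OF assms] assms by auto
  then show ?thesis by (simp add: path_sum_def)
qed

lemma path_sum_boundary: "\<zeta> \<in> boundary T \<Longrightarrow> (\<Sum>n<N. g (\<zeta> (Suc n))) = path_sum g (\<zeta> N)"
  by (induction N) (simp_all add: path_sum_rt path_sum_par boundaryD)

lemma rpath_sub_subset:
  assumes "w \<in> sub v" shows "set (rpath v) \<subseteq> set (rpath w)"
proof -
  have w: "w \<in> verts T" "v \<in> set (rpath w)" using assms by (auto simp: sub_def)
  obtain a b where ab: "rpath w = a @ v # b" using split_list[OF w(2)] by auto
  then show ?thesis using rpath_prefix[OF w(1) ab] by auto
qed

lemma path_sum_mono: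
  assumes "\<And>v. v \<in> verts T - {rt} \<Longrightarrow> 0 \<le> g v" "w \<in> sub v"
  shows "path_sum g v \<le> path_sum g w"
  unfolding path_sum_def
proof (rule sum_mono2)
  show "set (rpath v) - {rt} \<subseteq> set (rpath w) - {rt}" using rpath_sub_subset[OF assms(2)] by auto
  have "set (rpath w) \<subseteq> verts T" using assms(2) rpath_facts by (auto simp: sub_def)
  then show "0 \<le> g b" if "b \<in> set (rpath w) - {rt} - (set (rpath v) - {rt})" for b
    using assms(1) that by auto
qed auto

text \<open>This is where compactness of \<open>\<partial>T\<close> enters; it replaces integrating potentials against the
  boundary measure of the flow.\<close>

lemma uniform_level:
  assumes g: "\<And>v. v \<in> verts T - {rt} \<Longrightarrow> 0 \<le> g v"
    and adm: "\<And>\<zeta>. \<zeta> \<in> boundary T \<Longrightarrow> 1 \<le> (\<Sum>n. ennreal (g (\<zeta> (Suc n))))"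
    and "0 < \<delta>"
  shows "\<exists>m\<ge>1. \<forall>v\<in>level m. 1 - \<delta> \<le> path_sum g v"
proof (rule ccontr)
  assume neg: "\<not> ?thesis"
  \<comment> \<open>Infinitely many deficient vertices below \<open>v\<close>: as \<open>v\<close>
    has finitely many children, one of their branches inherits infinitely many.\<close>
  define Q where "Q v \<longleftrightarrow> infinite {w \<in> sub v. path_sum g w < 1 - \<delta>}" for v
  have "Q rt"
    unfolding Q_def
  proof
    let ?B = "{w \<in> sub rt. path_sum g w < 1 - \<delta>}"
    assume fin: "finite ?B"
    define m where "m = Suc (Max (lev ` insert rt ?B))"
    have "\<forall>v\<in>level m. 1 - \<delta> \<le> path_sum g v"
    proof (rule ballI, rule ccontr)
      fix v assume v: "v \<in> level m" "\<not> 1 - \<delta> \<le> path_sum g v"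
      then have "v \<in> ?B" by (auto simp: sub_rt level_def)
      then have "lev v \<le> Max (lev ` insert rt ?B)" using fin by (intro Max_ge) auto
      then show False using v by (simp add: level_def m_def)
    qed
    then show False using neg by (auto simp: m_def)
  qed
  moreover have "\<exists>w\<in>ch v. Q w" if v: "v \<in> verts T" "Q v" for v
  proof (rule ccontr)
    assume "\<not> ?thesis"
    then have "finite (insert v (\<Union>w\<in>ch v. {x \<in> sub w. path_sum g x < 1 - \<delta>}))"
      using finite_ch[OF v(1)] by (auto simp: Q_def)
    moreover have "{w \<in> sub v. path_sum g w < 1 - \<delta>} \<subseteq> insert v (\<Union>w\<in>ch v. {x \<in> sub w. path_sum g x < 1 - \<delta>})"
      using sub_split by blast
    ultimately show False using v(2) finite_subset unfolding Q_def by blast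
  qed
  ultimately obtain \<zeta> where z: "\<zeta> \<in> boundary T" "\<And>n. Q (\<zeta> n)" using koenig[of Q] by auto
  \<comment> \<open>Each \<open>\<zeta> n\<close> has a deficient vertex below it, and path sums
    increase downwards, so the whole end has potential at most \<open>1 - \<delta>\<close>.\<close>
  have le: "path_sum g (\<zeta> n) \<le> 1 - \<delta>" for n
  proof -
    obtain w where "w \<in> sub (\<zeta> n)" "path_sum g w < 1 - \<delta>"
      using z(2)[of n] unfolding Q_def by (metis (mono_tags, lifting) Collect_empty_eq finite.emptyI)
    then show ?thesis using path_sum_mono[where g = g, OF g, where w = w and v = "\<zeta> n"] by force
  qed
  have "(\<Sum>n. ennreal (g (\<zeta> (Suc n)))) \<le> ennreal (1 - \<delta>)"
  proof (rule suminf_le_const)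
    fix N
    have "(\<Sum>n<N. ennreal (g (\<zeta> (Suc n)))) = ennreal (path_sum g (\<zeta> N))"
      unfolding path_sum_boundary[OF z(1), symmetric]
      by (rule sum_ennreal) (use g boundaryD[OF z(1)] in auto)
    then show "(\<Sum>n<N. ennreal (g (\<zeta> (Suc n)))) \<le> ennreal (1 - \<delta>)" using le ennreal_leI by simp
  qed simp
  then have "1 \<le> ennreal (1 - \<delta>)" using adm[OF z(1)] by (rule order_trans[rotated])
  then have "1 \<le> 1 - \<delta>" by (simp add: ennreal_ge_1)
  then show False using \<open>0 < \<delta>\<close> by simp
qed

text \<open>At a suitable level all path sums are at least \<open>1 - \<delta>\<close>; weighting
  them by the flow, of strength \<open>total_cap\<close>, and summing by parts gives the bound
  there. Larger balls only add nonnegative terms. It serves both for the capacity and for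
  uniqueness.\<close>

lemma admissible_inner:
  assumes g: "\<And>v. v \<in> verts T - {rt} \<Longrightarrow> 0 \<le> g v"
    and adm: "\<And>\<zeta>. \<zeta> \<in> boundary T \<Longrightarrow> 1 \<le> (\<Sum>n. ennreal (g (\<zeta> (Suc n))))"
    and "0 < \<delta>"
  shows "\<exists>m0. \<forall>m\<ge>m0. (1 - \<delta>) * total_cap \<le> (\<Sum>v\<in>tree_ball m. g v * grad cap v)"
proof -
  obtain m0 where m0: "1 \<le> m0" "\<forall>v\<in>level m0. 1 - \<delta> \<le> path_sum g v"
    using uniform_level[where g = g, OF g adm assms(3)] by blast
  have nn: "0 \<le> grad cap v" if "v \<in> verts T - {rt}" for v
    using that by (intro grad_nonneg cap_bounds) auto
  have "(1 - \<delta>) * total_cap \<le> (\<Sum>v\<in>tree_ball m. g v * grad cap v)" if "m0 \<le> m" for m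
  proof -
    have "(1 - \<delta>) * total_cap = (\<Sum>v\<in>level m0. grad cap v * (1 - \<delta>))"
      using flow_total[OF m0(1) flow_cap] by (subst sum_distrib_right[symmetric]) (simp add: grad_rt_child mult.commute)
    also have "\<dots> \<le> (\<Sum>v\<in>level m0. grad cap v * path_sum g v)"
    proof (intro sum_mono mult_left_mono)
      fix v assume v: "v \<in> level m0"
      show "1 - \<delta> \<le> path_sum g v" using m0 v by simp
      show "0 \<le> grad cap v" using v m0(1) lev_rt by (intro nn) (auto simp: level_def)
    qed
    also have "\<dots> = (\<Sum>v\<in>tree_ball m0. grad cap v * (path_sum g v - path_sum g (par v)))"
      by (rule sum_by_parts[symmetric]) (auto simp: path_sum_rt flow_cap)
    also have "\<dots> = (\<Sum>v\<in>tree_ball m0. g v * grad cap v)"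
      by (rule sum.cong) (auto simp: tree_ball_def path_sum_par)
    also have "\<dots> \<le> (\<Sum>v\<in>tree_ball m. g v * grad cap v)"
      by (intro sum_mono2 finite_ball ball_mono[OF that]) (use g nn in \<open>auto simp: tree_ball_def\<close>)
    finally show ?thesis .
  qed
  then show ?thesis by auto
qed

end

section \<open>The equilibrium function\<close>

context rooted_tree
begin

text \<open>Transfers functions of the lower endpoint to edges. The value 0 elsewhere is the
  normalisation demanded by \<open>is_equilibrium\<close>.\<close>

definition edge_fun :: "('a \<Rightarrow> real) \<Rightarrow> 'a set \<Rightarrow> real" where
  "edge_fun g \<alpha> = (if \<alpha> \<in> edges T then g (the_inv_into (verts T - {rt}) (\<lambda>v. {par v, v}) \<alpha>) else 0)"

lemma edge_fun_edge: "v \<in> verts T \<Longrightarrow> v \<noteq> rt \<Longrightarrow> edge_fun g {par v, v} = g v"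
  using the_inv_into_f_f[OF inj_edge, of v] edges_eq by (auto simp: edge_fun_def)

lemma edge_fun_boundary:
  "\<zeta> \<in> boundary T \<Longrightarrow> edge_fun g {\<zeta> n, \<zeta> (Suc n)} = g (\<zeta> (Suc n))"
  using edge_fun_edge[of "\<zeta> (Suc n)" g] boundaryD[of \<zeta>] by simp

lemma edge_fun_nonneg:
  assumes "\<And>v. v \<in> verts T - {rt} \<Longrightarrow> 0 \<le> g v" "\<alpha> \<in> edges T"
  shows "0 \<le> edge_fun g \<alpha>"
proof -
  obtain v where "v \<in> verts T - {rt}" "\<alpha> = {par v, v}" using assms(2) unfolding edges_eq by auto
  then show ?thesis using assms(1)[of v] edge_fun_edge[of v g] by simp
qed

lemma potential_eq:
  assumes "\<zeta> \<in> boundary T"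
  shows "potential f \<zeta> = (\<Sum>n. ennreal (f {\<zeta> n, \<zeta> (Suc n)}))"
proof -
  have inj: "inj (\<lambda>n. {\<zeta> n, \<zeta> (Suc n)})"
  proof (rule injI)
    fix m n assume "{\<zeta> m, \<zeta> (Suc m)} = {\<zeta> n, \<zeta> (Suc n)}"
    then have "{m, Suc m} = {n, Suc n}" using boundary_inj[OF assms]
      by (auto simp: doubleton_eq_iff inj_eq)
    then show "m = n" by (auto simp: doubleton_eq_iff)
  qed
  have "potential f \<zeta> = (\<Sum>\<^sub>\<infinity>n. ennreal (f {\<zeta> n, \<zeta> (Suc n)}))"
    unfolding potential_def geodesic_edges_def infsum_reindex[OF inj] by (simp add: o_def)
  also have "\<dots> = (\<Sum>n. ennreal (f {\<zeta> n, \<zeta> (Suc n)}))"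
    by (intro sums_unique has_sum_imp_sums has_sum_infsum nonneg_summable_on_complete) simp
  finally show ?thesis .
qed

lemma potential_edge_fun:
  assumes "\<zeta> \<in> boundary T" "\<And>v. v \<in> verts T - {rt} \<Longrightarrow> 0 \<le> g v"
    "(\<lambda>N. \<Sum>n<N. g (\<zeta> (Suc n))) \<longlonglongrightarrow> L"
  shows "potential (edge_fun g) \<zeta> = ennreal L"
  unfolding potential_eq[OF assms(1)] edge_fun_boundary[OF assms(1)]
  by (rule suminf_ennreal_eq) (use assms boundaryD[OF assms(1)] in \<open>auto simp: sums_def\<close>)

lemma energy_eq:
  "energy T f = (SUP X\<in>{X. finite X \<and> X \<subseteq> verts T - {rt}}. ennreal (\<Sum>v\<in>X. (f {par v, v})\<^sup>2))"
proof -
  have "energy T f = (\<Sum>\<^sub>\<infinity>v\<in>verts T - {rt}. ennreal ((f {par v, v})\<^sup>2))"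
    unfolding energy_def edges_eq infsum_reindex[OF inj_edge] by (simp add: o_def)
  also have "\<dots> = (SUP X\<in>{X. finite X \<and> X \<subseteq> verts T - {rt}}. \<Sum>v\<in>X. ennreal ((f {par v, v})\<^sup>2))"
    by (rule nonneg_infsum_complete) simp
  finally show ?thesis by (simp add: sum_ennreal)
qed

lemma energy_leI:
  assumes "\<And>m. (\<Sum>v\<in>tree_ball m. (f {par v, v})\<^sup>2) \<le> B"
  shows "energy T f \<le> ennreal B"
  unfolding energy_eq
proof (rule SUP_least)
  fix X assume X: "X \<in> {X. finite X \<and> X \<subseteq> verts T - {rt}}"
  then obtain m where m: "X \<subseteq> tree_ball m" using finite_subset_ball by blast
  have "(\<Sum>v\<in>X. (f {par v, v})\<^sup>2) \<le> (\<Sum>v\<in>tree_ball m. (f {par v, v})\<^sup>2)"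
    by (rule sum_mono2[OF finite_ball m]) simp
  also have "\<dots> \<le> B" by (rule assms)
  finally show "ennreal (\<Sum>v\<in>X. (f {par v, v})\<^sup>2) \<le> ennreal B" by (rule ennreal_leI)
qed

lemma energy_ge: "ennreal (\<Sum>v\<in>tree_ball m. (f {par v, v})\<^sup>2) \<le> energy T f"
proof -
  have "tree_ball m \<subseteq> verts T - {rt}" by (auto simp: tree_ball_def)
  then show ?thesis unfolding energy_eq by (intro SUP_upper) (simp add: finite_ball)
qed

lemma ball_energy_le:
  assumes "energy T f \<le> ennreal B" "0 \<le> B"
  shows "(\<Sum>v\<in>tree_ball m. (f {par v, v})\<^sup>2) \<le> B"
  using order_trans[OF energy_ge assms(1)] assms(2) by (simp add: ennreal_le_iff)

lemma edge_fun_ball: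
  fixes h :: "real \<Rightarrow> real \<Rightarrow> real"
  shows "(\<Sum>v\<in>tree_ball m. h (edge_fun g {par v, v}) (c v)) = (\<Sum>v\<in>tree_ball m. h (g v) (c v))"
  by (rule sum.cong) (auto simp: tree_ball_def edge_fun_edge)

lemma grad_cap_nonneg: "v \<in> verts T - {rt} \<Longrightarrow> 0 \<le> grad cap v"
  by (rule grad_nonneg) (auto simp: cap_bounds)

lemma grad_tcond_nonneg: "v \<in> verts T - {rt} \<Longrightarrow> 0 \<le> grad (tcond n) v"
  by (rule grad_nonneg) (auto simp: tcond_bounds)

section \<open>The capacity of the boundary\<close>

lemma edge_nonneg:
  assumes "\<forall>\<alpha>\<in>edges T. 0 \<le> f \<alpha>" "v \<in> verts T - {rt}"
  shows "0 \<le> f {par v, v}"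
  using assms edges_eq by auto

text \<open>Nonnegativity of the energy of \<open>f - grad cap\<close> bounds the energy of
  \<open>f\<close> below by twice the pairing minus \<open>total_cap\<close>, hence by
  \<open>2 * (1 - \<delta>) * total_cap - total_cap\<close>; then \<delta> tends to 0.\<close>

lemma admissible_energy_ge:
  assumes f: "\<forall>\<alpha>\<in>edges T. 0 \<le> f \<alpha>" and adm: "\<forall>\<zeta>\<in>boundary T. 1 \<le> potential f \<zeta>"
  shows "ennreal total_cap \<le> energy T f"
proof -
  let ?g = "\<lambda>v. f {par v, v}"
  have adm': "1 \<le> (\<Sum>n. ennreal (?g (\<zeta> (Suc n))))" if "\<zeta> \<in> boundary T" for \<zeta>
    using bspec[OF adm that] unfolding potential_eq[OF that] boundaryD(5)[OF that] .
  have le: "ennreal (total_cap * (1 - 2 * \<delta>)) \<le> energy T f" if d: "0 < \<delta>" for \<delta>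
  proof -
    obtain m where m: "(1 - \<delta>) * total_cap \<le> (\<Sum>v\<in>tree_ball m. ?g v * grad cap v)"
      using admissible_inner[where g = ?g, OF edge_nonneg[OF f] adm' d] by auto
    have "0 \<le> (\<Sum>v\<in>tree_ball m. (?g v - grad cap v)\<^sup>2)" by (intro sum_nonneg) simp
    also have "\<dots> = (\<Sum>v\<in>tree_ball m. (?g v)\<^sup>2) + (\<Sum>v\<in>tree_ball m. (grad cap v)\<^sup>2) - 2 * (\<Sum>v\<in>tree_ball m. ?g v * grad cap v)"
      by (simp add: power2_diff sum.distrib sum_subtractf sum_distrib_left mult_ac)
    finally have "total_cap * (1 - 2 * \<delta>) \<le> (\<Sum>v\<in>tree_ball m. (?g v)\<^sup>2)"
      using m cap_energy_le[of m] by (simp add: algebra_simps)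
    then show ?thesis using energy_ge[of f m] ennreal_leI order_trans by blast
  qed
  have "((\<lambda>\<delta>. ennreal (total_cap * (1 - 2 * \<delta>))) \<longlongrightarrow> ennreal (total_cap * (1 - 2 * 0))) (at_right 0)"
    by (intro tendsto_intros tendsto_ennrealI)
  moreover have "\<forall>\<^sub>F \<delta> in at_right 0. ennreal (total_cap * (1 - 2 * \<delta>)) \<le> energy T f"
    using le by (auto simp: eventually_at_right_field intro!: exI[of _ 1])
  ultimately have "ennreal (total_cap * (1 - 2 * 0)) \<le> energy T f"
    by (rule tendsto_upperbound) simp
  then show ?thesis by simp
qed

lemma potential_tcond:
  assumes "1 \<le> n" "\<zeta> \<in> boundary T"
  shows "potential (edge_fun (grad (tcond n))) \<zeta> = 1"
proof -
  have "\<forall>\<^sub>F N in sequentially. 1 = 1 - surv (tcond n) (\<zeta> N)"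
    using eventually_ge_at_top[of n]
    by eventually_elim (simp add: surv_tcond_0[OF assms(1)] boundaryD[OF assms(2)])
  then have "(\<lambda>N. 1 - surv (tcond n) (\<zeta> N)) \<longlonglongrightarrow> 1"
    by (rule Lim_transform_eventually[OF tendsto_const])
  then have "potential (edge_fun (grad (tcond n))) \<zeta> = ennreal 1"
    unfolding grad_path_sum[OF assms(2), symmetric]
    by (intro potential_edge_fun[where g = "grad (tcond n)"] assms(2) grad_tcond_nonneg)
  then show ?thesis by simp
qed

text \<open>Truncations are admissible on every end and their energies decrease to
  \<open>total_cap\<close>; the matching lower bound is \<open>admissible_energy_ge\<close>.\<close>

lemma capacity_boundary: "capacity T (boundary T) = ennreal total_cap"
proof (rule antisym)
  have le: "capacity T (boundary T) \<le> ennreal (cond n rt_child)" for n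
  proof -
    let ?f = "edge_fun (grad (tcond (Suc n)))"
    have "energy T ?f \<le> ennreal (cond n rt_child)"
    proof (rule energy_leI)
      fix m
      have "(\<Sum>v\<in>tree_ball m. (?f {par v, v})\<^sup>2) = (\<Sum>v\<in>tree_ball m. (grad (tcond (Suc n)) v)\<^sup>2)"
        using edge_fun_ball[where h = "\<lambda>a b. a\<^sup>2"] by simp
      also have "\<dots> \<le> (\<Sum>v\<in>tree_ball (max m (Suc n)). (grad (tcond (Suc n)) v)\<^sup>2)"
        by (intro sum_mono2 finite_ball ball_mono) auto
      also have "\<dots> = cond n rt_child" using tcond_energy[of "Suc n" "max m (Suc n)"] by simp
      finally show "(\<Sum>v\<in>tree_ball m. (?f {par v, v})\<^sup>2) \<le> cond n rt_child" .
    qed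
    moreover have "capacity T (boundary T) \<le> energy T ?f"
      unfolding capacity_def
    proof (rule Inf_lower, rule CollectI, intro exI conjI)
      show "\<forall>\<alpha>\<in>edges T. 0 \<le> ?f \<alpha>" using edge_fun_nonneg[OF grad_tcond_nonneg] by auto
      show "\<forall>\<zeta>\<in>boundary T. 1 \<le> potential ?f \<zeta>" using potential_tcond[of "Suc n"] by simp
    qed simp
    ultimately show ?thesis by (rule order_trans[rotated])
  qed
  have "(\<lambda>n. ennreal (cond n rt_child)) \<longlonglongrightarrow> ennreal total_cap"
    by (intro tendsto_ennrealI cond_tendsto)
  then show "capacity T (boundary T) \<le> ennreal total_cap"
    using le by (intro LIMSEQ_le_const) auto
  show "ennreal total_cap \<le> capacity T (boundary T)"
    unfolding capacity_def using admissible_energy_ge by (intro Inf_greatest) auto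
qed

section \<open>Existence and uniqueness of the equilibrium function\<close>

lemma surv_cap_decseq:
  assumes "\<zeta> \<in> boundary T"
  shows "decseq (\<lambda>N. surv cap (\<zeta> N))"
proof (rule decseq_SucI)
  fix n
  show "surv cap (\<zeta> (Suc n)) \<le> surv cap (\<zeta> n)"
    using surv_par[of "\<zeta> (Suc n)" cap] boundaryD[OF assms] surv_cap_pos[of "\<zeta> n"] cap_bounds[of "\<zeta> (Suc n)"]
    by (simp add: mult_left_le)
qed

text \<open>The potential telescopes, so its deficit at \<zeta> is the limit \<rho> of
  \<open>surv cap\<close>. Regularity thus becomes decay of a positive harmonic function.\<close>

lemma surv_cap_lim:
  assumes "\<zeta> \<in> boundary T"
  shows "\<exists>\<rho>. 0 \<le> \<rho> \<and> \<rho> \<le> 1 \<and> (\<lambda>N. surv cap (\<zeta> N)) \<longlonglongrightarrow> \<rho> \<and> (\<forall>N. \<rho> \<le> surv cap (\<zeta> N)) \<and>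
     potential (edge_fun (grad cap)) \<zeta> = ennreal (1 - \<rho>)"
proof -
  have "surv cap (\<zeta> N) \<ge> 0" for N using surv_cap_pos[of "\<zeta> N"] by simp
  then obtain \<rho> where \<rho>: "(\<lambda>N. surv cap (\<zeta> N)) \<longlonglongrightarrow> \<rho>" "\<forall>N. \<rho> \<le> surv cap (\<zeta> N)"
    using decseq_convergent[OF surv_cap_decseq[OF assms], of 0] by auto
  have "0 \<le> \<rho>" using LIMSEQ_le_const[OF \<rho>(1)] surv_cap_pos less_imp_le by blast
  moreover have "\<rho> \<le> 1" using \<rho>(2)[rule_format, of 0] boundaryD(1)[OF assms] by (simp add: surv_rt)
  moreover have "potential (edge_fun (grad cap)) \<zeta> = ennreal (1 - \<rho>)"
    by (rule potential_edge_fun[OF assms grad_cap_nonneg])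
      (auto simp: grad_path_sum[OF assms] intro!: tendsto_diff \<rho>)
  ultimately show ?thesis using \<rho> by blast
qed

text \<open>The witness \<open>g\<close> dominates \<open>(k + 1) (f\<^sub>k - f)\<close> for every \<open>k\<close>, where the \<open>f\<^sub>k\<close> are equilibrium
  functions of rapidly growing truncations. Since \<open>f\<^sub>k\<close> has potential 1 on \<open>\<partial>T\<close>, the potential of
  \<open>g\<close> is infinite wherever that of \<open>f\<close> is less than 1.\<close>

lemma exceptional_set_small:
  assumes "0 < \<epsilon>"
  shows "\<exists>g. (\<forall>v\<in>verts T - {rt}. 0 \<le> g v) \<and> energy T (edge_fun g) \<le> ennreal \<epsilon> \<and>
     (\<forall>\<zeta>\<in>boundary T. potential (edge_fun (grad cap)) \<zeta> \<noteq> 1 \<longrightarrow> 1 \<le> potential (edge_fun g) \<zeta>)"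
proof -
  \<comment> \<open>The factor \<open>(real (Suc k))\<^sup>2\<close> pays for scaling the
    \<open>k\<close>-th difference by \<open>k + 1\<close>, and the bounds sum to
    \<epsilon>.\<close>
  have "\<exists>n\<ge>1. (real (Suc k))\<^sup>2 * (cond (n - 1) rt_child - total_cap) \<le> \<epsilon> * (1/2)^(Suc k)" for k
  proof -
    have "(\<lambda>n. (real (Suc k))\<^sup>2 * (cond n rt_child - total_cap)) \<longlonglongrightarrow> (real (Suc k))\<^sup>2 * (total_cap - total_cap)"
      by (intro tendsto_intros cond_tendsto)
    then have "\<forall>\<^sub>F n in sequentially. (real (Suc k))\<^sup>2 * (cond n rt_child - total_cap) < \<epsilon> * (1/2)^(Suc k)"
      by (rule order_tendstoD(2)) (use assms in simp)
    then obtain n where "(real (Suc k))\<^sup>2 * (cond n rt_child - total_cap) < \<epsilon> * (1/2)^(Suc k)"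
      by (auto simp: eventually_sequentially)
    then show ?thesis by (intro exI[of _ "Suc n"]) auto
  qed
  then obtain n where n: "\<And>k. 1 \<le> n k"
      "\<And>k. (real (Suc k))\<^sup>2 * (cond (n k - 1) rt_child - total_cap) \<le> \<epsilon> * (1/2)^(Suc k)"
    by metis
  define a where "a k v = (real (Suc k))\<^sup>2 * (grad (tcond (n k)) v - grad cap v)\<^sup>2" for k v
  have a0: "0 \<le> a k v" for k v by (simp add: a_def)
  have sum_a: "(\<Sum>v\<in>tree_ball m. a k v) \<le> \<epsilon> * (1/2)^(Suc k)" for k m
  proof -
    have "(\<Sum>v\<in>tree_ball m. a k v) = (real (Suc k))\<^sup>2 * (\<Sum>v\<in>tree_ball m. (grad (tcond (n k)) v - grad cap v)\<^sup>2)"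
      by (simp add: a_def sum_distrib_left)
    also have "\<dots> \<le> (real (Suc k))\<^sup>2 * (cond (n k - 1) rt_child - total_cap)"
      by (intro mult_left_mono tcond_cap_energy n) simp
    also have "\<dots> \<le> \<epsilon> * (1/2)^(Suc k)" by (rule n)
    finally show ?thesis .
  qed
  have geo: "(\<lambda>k. \<epsilon> * (1/2)^(Suc k)) sums \<epsilon>"
    using sums_mult[OF power_half_series, of \<epsilon>] by simp
  have summ: "summable (\<lambda>k. a k v)" if "v \<in> verts T - {rt}" for v
  proof (rule summable_comparison_test')
    show "summable (\<lambda>k. \<epsilon> * (1/2)^(Suc k))" using geo by (rule sums_summable)
    fix k
    have "a k v \<le> (\<Sum>w\<in>tree_ball (lev v). a k w)"
      using that by (intro member_le_sum a0 finite_ball) (auto simp: tree_ball_def)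
    then show "norm (a k v) \<le> \<epsilon> * (1/2)^(Suc k)" using sum_a[of k "lev v"] a0[of k v] by simp
  qed
  \<comment> \<open>A square root of a sum of squares dominates each scaled difference, while its
    energy is just the sum of their energies.\<close>
  define g where "g v = sqrt (\<Sum>k. a k v)" for v
  have sa0: "0 \<le> (\<Sum>k. a k v)" if "v \<in> verts T - {rt}" for v
    by (rule suminf_nonneg[OF summ[OF that] a0])
  have g0: "0 \<le> g v" if "v \<in> verts T - {rt}" for v using sa0[OF that] by (simp add: g_def)
  have g_ge: "real (Suc k) * (grad (tcond (n k)) v - grad cap v) \<le> g v" if v: "v \<in> verts T - {rt}" for k v
  proof -
    have "(\<Sum>j\<in>{k}. a j v) \<le> (\<Sum>j. a j v)" by (rule sum_le_suminf[OF summ[OF v]]) (auto simp: a0)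
    then have "sqrt (a k v) \<le> g v" by (simp add: g_def)
    moreover have "sqrt (a k v) = real (Suc k) * \<bar>grad (tcond (n k)) v - grad cap v\<bar>"
      by (simp add: a_def real_sqrt_mult)
    moreover have "real (Suc k) * (grad (tcond (n k)) v - grad cap v) \<le> real (Suc k) * \<bar>grad (tcond (n k)) v - grad cap v\<bar>"
      by (intro mult_left_mono) auto
    ultimately show ?thesis by linarith
  qed
  have "energy T (edge_fun g) \<le> ennreal \<epsilon>"
  proof (rule energy_leI)
    fix m
    have "(\<Sum>v\<in>tree_ball m. (edge_fun g {par v, v})\<^sup>2) = (\<Sum>v\<in>tree_ball m. (g v)\<^sup>2)"
      using edge_fun_ball[where h = "\<lambda>a b. a\<^sup>2"] by simp
    also have "\<dots> = (\<Sum>v\<in>tree_ball m. \<Sum>k. a k v)"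
      by (rule sum.cong) (auto simp: g_def tree_ball_def sa0)
    also have "\<dots> = (\<Sum>k. \<Sum>v\<in>tree_ball m. a k v)"
      by (rule suminf_sum[symmetric]) (auto simp: tree_ball_def summ)
    also have "\<dots> \<le> (\<Sum>k. \<epsilon> * (1/2)^(Suc k))"
    proof (rule suminf_le[OF sum_a])
      show "summable (\<lambda>k. \<Sum>v\<in>tree_ball m. a k v)" by (intro summable_sum summ) (auto simp: tree_ball_def)
      show "summable (\<lambda>k. \<epsilon> * (1/2)^(Suc k))" using geo by (rule sums_summable)
    qed
    also have "\<dots> = \<epsilon>" using geo by (rule sums_unique[symmetric])
    finally show "(\<Sum>v\<in>tree_ball m. (edge_fun g {par v, v})\<^sup>2) \<le> \<epsilon>" .
  qed
  moreover have "1 \<le> potential (edge_fun g) \<zeta>" if z: "\<zeta> \<in> boundary T" "potential (edge_fun (grad cap)) \<zeta> \<noteq> 1" for \<zeta>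
  proof -
    obtain \<rho> where \<rho>: "0 \<le> \<rho>" "\<forall>N. \<rho> \<le> surv cap (\<zeta> N)" "potential (edge_fun (grad cap)) \<zeta> = ennreal (1 - \<rho>)"
      using surv_cap_lim[OF z(1)] by blast
    have "\<rho> \<noteq> 0" using \<rho>(3) z(2) by auto
    then have "0 < \<rho>" using \<rho>(1) by simp
    \<comment> \<open>At level \<open>n k\<close> the truncated potential has reached 1 while that
      of \<open>grad cap\<close> is at most \<open>1 - \<rho>\<close>; scaling the gap by
      \<open>k + 1\<close> makes it at least 1.\<close>
    then obtain k where k: "1 < real k * \<rho>" using reals_Archimedean3 by blast
    let ?N = "n k"
    have "1 \<le> real (Suc k) * \<rho>" using k \<open>0 < \<rho>\<close> by (simp add: algebra_simps)
    also have "\<dots> \<le> real (Suc k) * (surv cap (\<zeta> ?N) - surv (tcond (n k)) (\<zeta> ?N))"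
      using \<rho>(2) by (intro mult_left_mono) (auto simp: surv_tcond_0[OF n(1)] boundaryD[OF z(1)])
    also have "\<dots> = (\<Sum>j<?N. real (Suc k) * (grad (tcond (n k)) (\<zeta> (Suc j)) - grad cap (\<zeta> (Suc j))))"
      by (simp only: sum_distrib_left[symmetric] sum_subtractf grad_path_sum[OF z(1)]) simp
    also have "\<dots> \<le> (\<Sum>j<?N. g (\<zeta> (Suc j)))"
      by (intro sum_mono g_ge) (use boundaryD[OF z(1)] in auto)
    finally have "1 \<le> ennreal (\<Sum>j<?N. g (\<zeta> (Suc j)))" by (simp add: ennreal_ge_1)
    also have "\<dots> = (\<Sum>j<?N. ennreal (edge_fun g {\<zeta> j, \<zeta> (Suc j)}))"
      unfolding edge_fun_boundary[OF z(1)]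
      by (rule sum_ennreal[symmetric]) (use g0 boundaryD[OF z(1)] in auto)
    also have "\<dots> \<le> potential (edge_fun g) \<zeta>"
      unfolding potential_eq[OF z(1)] by (rule sum_le_suminf) auto
    finally show ?thesis .
  qed
  ultimately show ?thesis using g0 by blast
qed

lemma capacity_zero_small:
  assumes "capacity T A = 0" "0 < \<epsilon>"
  shows "\<exists>f. (\<forall>\<alpha>\<in>edges T. 0 \<le> f \<alpha>) \<and> (\<forall>\<zeta>\<in>A. 1 \<le> potential f \<zeta>) \<and> energy T f \<le> ennreal \<epsilon>"
proof -
  have "capacity T A < ennreal \<epsilon>" using assms by simp
  then show ?thesis unfolding capacity_def Inf_less_iff by (auto intro: less_imp_le)
qed

lemma equilibrium_exists: "is_equilibrium T (edge_fun (grad cap))"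
  unfolding is_equilibrium_def
proof (intro conjI)
  let ?f = "edge_fun (grad cap)"
  show nn: "\<forall>\<alpha>\<in>edges T. 0 \<le> ?f \<alpha>" using edge_fun_nonneg[OF grad_cap_nonneg] by auto
  show "\<forall>\<alpha>. \<alpha> \<notin> edges T \<longrightarrow> ?f \<alpha> = 0" by (simp add: edge_fun_def)
  have small: "capacity T {\<zeta> \<in> boundary T. potential ?f \<zeta> \<noteq> 1} \<le> ennreal \<epsilon>" if "0 < \<epsilon>" for \<epsilon>
  proof -
    obtain g where g: "\<forall>v\<in>verts T - {rt}. 0 \<le> g v" "energy T (edge_fun g) \<le> ennreal \<epsilon>"
      "\<forall>\<zeta>\<in>boundary T. potential ?f \<zeta> \<noteq> 1 \<longrightarrow> 1 \<le> potential (edge_fun g) \<zeta>"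
      using exceptional_set_small[OF \<open>0 < \<epsilon>\<close>] by blast
    have "capacity T {\<zeta> \<in> boundary T. potential ?f \<zeta> \<noteq> 1} \<le> energy T (edge_fun g)"
      unfolding capacity_def
    proof (rule Inf_lower, rule CollectI, intro exI conjI)
      show "\<forall>\<alpha>\<in>edges T. 0 \<le> edge_fun g \<alpha>" using edge_fun_nonneg[of g] g(1) by auto
    qed (use g in auto)
    then show ?thesis using g(2) by (rule order_trans)
  qed
  then show "capacity T {\<zeta> \<in> boundary T. potential ?f \<zeta> \<noteq> 1} = 0"
    using ennreal_le_epsilon[of 0 "capacity T {\<zeta> \<in> boundary T. potential ?f \<zeta> \<noteq> 1}"] by simp
  have "energy T ?f \<le> ennreal total_cap"
    by (rule energy_leI) (use cap_energy_le edge_fun_ball[where h = "\<lambda>a b. a\<^sup>2"] in simp)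
  moreover have "ennreal total_cap \<le> energy T ?f"
  proof -
    have le: "ennreal (2 * total_cap - cond n rt_child) \<le> energy T ?f" for n
    proof -
      let ?B = "tree_ball (Suc n)" and ?F = "grad (tcond (Suc n))"
      have "0 \<le> (\<Sum>v\<in>?B. (grad cap v - ?F v)\<^sup>2)" by (intro sum_nonneg) simp
      also have "\<dots> = (\<Sum>v\<in>?B. (grad cap v)\<^sup>2) + (\<Sum>v\<in>?B. (?F v)\<^sup>2) - 2 * (\<Sum>v\<in>?B. grad cap v * ?F v)"
        by (simp add: power2_diff sum.distrib sum_subtractf sum_distrib_left mult_ac)
      finally have "2 * total_cap - cond n rt_child \<le> (\<Sum>v\<in>?B. (grad cap v)\<^sup>2)"
        using tcond_energy[of "Suc n" "Suc n"] grad_tcond_sum[OF _ _ flow_cap, of "Suc n" "Suc n"]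
        by (simp add: grad_rt_child)
      also have "\<dots> = (\<Sum>v\<in>?B. (?f {par v, v})\<^sup>2)"
        using edge_fun_ball[where h = "\<lambda>a b. a\<^sup>2"] by simp
      finally show ?thesis using energy_ge[of ?f "Suc n"] ennreal_leI order_trans by blast
    qed
    have "(\<lambda>n. ennreal (2 * total_cap - cond n rt_child)) \<longlonglongrightarrow> ennreal (2 * total_cap - total_cap)"
      by (intro tendsto_ennrealI tendsto_diff tendsto_const cond_tendsto)
    then have "ennreal (2 * total_cap - total_cap) \<le> energy T ?f"
      using le by (intro LIMSEQ_le_const2) auto
    then show ?thesis by simp
  qed
  ultimately show "energy T ?f = capacity T (boundary T)" using capacity_boundary by simp
qed


text \<open>Adding to \<open>f\<close> a function \<open>e\<close> of tiny energy that covers its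
  exceptional set gives an admissible function, so the pairing of \<open>f\<close> with
  \<open>grad cap\<close> is almost \<open>total_cap\<close>. Both energies are at most
  \<open>total_cap\<close>, which forces the energy of the difference to vanish.\<close>

lemma equilibrium_unique:
  assumes f: "is_equilibrium T f"
  shows "f = edge_fun (grad cap)"
proof
  fix \<alpha>
  have nn: "\<forall>\<alpha>\<in>edges T. 0 \<le> f \<alpha>" and cap0: "capacity T {\<zeta> \<in> boundary T. potential f \<zeta> \<noteq> 1} = 0"
    and en: "energy T f \<le> ennreal total_cap"
    using f by (auto simp: is_equilibrium_def capacity_boundary)
  show "f \<alpha> = edge_fun (grad cap) \<alpha>"
  proof (cases "\<alpha> \<in> edges T")
    case False
    then show ?thesis using f by (simp add: is_equilibrium_def edge_fun_def)
  next
    case True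
    then obtain v where v: "v \<in> verts T - {rt}" "\<alpha> = {par v, v}" unfolding edges_eq by auto
    let ?F = "grad cap" and ?f = "\<lambda>w. f {par w, w}"
    have small: "(?f v - ?F v)\<^sup>2 \<le> 4 * \<epsilon>" if e: "0 < \<epsilon>" for \<epsilon>
    proof -
      \<comment> \<open>Energy \<open>\<epsilon>\<^sup>2\<close> is chosen so that the pairing of
        \<open>e\<close> with \<open>grad cap\<close>, whose energy is at most 1, is of order
        \<epsilon>.\<close>
      obtain e where e: "\<forall>\<alpha>\<in>edges T. 0 \<le> e \<alpha>"
        "\<forall>\<zeta>\<in>{\<zeta> \<in> boundary T. potential f \<zeta> \<noteq> 1}. 1 \<le> potential e \<zeta>" "energy T e \<le> ennreal (\<epsilon>\<^sup>2)"
        using capacity_zero_small[OF cap0, of "\<epsilon>\<^sup>2"] e by auto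
      let ?e = "\<lambda>w. e {par w, w}"
      have adm: "1 \<le> (\<Sum>n. ennreal (?f (\<zeta> (Suc n)) + ?e (\<zeta> (Suc n))))" if z: "\<zeta> \<in> boundary T" for \<zeta>
      proof -
        have pe: "potential h \<zeta> = (\<Sum>n. ennreal (h {par (\<zeta> (Suc n)), \<zeta> (Suc n)}))" for h
          unfolding potential_eq[OF z] boundaryD(5)[OF z] ..
        have nz: "0 \<le> ?f (\<zeta> (Suc n))" "0 \<le> ?e (\<zeta> (Suc n))" for n
          using edge_nonneg[OF nn, of "\<zeta> (Suc n)"] edge_nonneg[OF e(1), of "\<zeta> (Suc n)"] boundaryD(3,6)[OF z] by auto
        have "potential f \<zeta> \<le> (\<Sum>n. ennreal (?f (\<zeta> (Suc n)) + ?e (\<zeta> (Suc n))))"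
          "potential e \<zeta> \<le> (\<Sum>n. ennreal (?f (\<zeta> (Suc n)) + ?e (\<zeta> (Suc n))))"
          unfolding pe by (intro suminf_le summableI ennreal_leI; use nz in simp)+
        moreover have "1 \<le> potential f \<zeta> \<or> 1 \<le> potential e \<zeta>" using e(2) z by (cases "potential f \<zeta> = 1") auto
        ultimately show ?thesis by (meson order_trans)
      qed
      have gn: "0 \<le> ?f w + ?e w" if "w \<in> verts T - {rt}" for w
        using edge_nonneg[OF nn that] edge_nonneg[OF e(1) that] by simp
      obtain m0 where m0: "\<forall>m\<ge>m0. (1 - \<epsilon>) * total_cap \<le> (\<Sum>w\<in>tree_ball m. (?f w + ?e w) * ?F w)"
        using admissible_inner[where g = "\<lambda>w. ?f w + ?e w", OF gn adm \<open>0 < \<epsilon>\<close>] by blast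
      define m where "m = max m0 (lev v)"
      have 1: "(1 - \<epsilon>) * total_cap \<le> (\<Sum>w\<in>tree_ball m. ?f w * ?F w) + (\<Sum>w\<in>tree_ball m. ?e w * ?F w)"
        using m0[rule_format, of m] by (simp add: m_def sum.distrib distrib_right)
      \<comment> \<open>Weighted arithmetic-geometric mean in place of Cauchy-Schwarz; the weight
        \<epsilon> balances the two energies.\<close>
      have "(\<Sum>w\<in>tree_ball m. ?e w * ?F w) \<le> (\<Sum>w\<in>tree_ball m. ((?e w)\<^sup>2 / \<epsilon> + \<epsilon> * (?F w)\<^sup>2) / 2)"
      proof (rule sum_mono)
        fix w
        have "0 \<le> (?e w - \<epsilon> * ?F w)\<^sup>2 / \<epsilon>" using \<open>0 < \<epsilon>\<close> by simp
        also have "\<dots> = (?e w)\<^sup>2 / \<epsilon> + \<epsilon> * (?F w)\<^sup>2 - 2 * (?e w * ?F w)"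
          using \<open>0 < \<epsilon>\<close> by (simp add: power2_eq_square field_simps)
        finally show "?e w * ?F w \<le> ((?e w)\<^sup>2 / \<epsilon> + \<epsilon> * (?F w)\<^sup>2) / 2" by simp
      qed
      also have "\<dots> = ((\<Sum>w\<in>tree_ball m. (?e w)\<^sup>2) / \<epsilon> + \<epsilon> * (\<Sum>w\<in>tree_ball m. (?F w)\<^sup>2)) / 2"
        by (simp add: sum_divide_distrib[symmetric] sum.distrib sum_distrib_left)
      also have "\<dots> \<le> (\<epsilon>\<^sup>2 / \<epsilon> + \<epsilon> * total_cap) / 2"
        using ball_energy_le[OF e(3), of m] cap_energy_le[of m] \<open>0 < \<epsilon>\<close>
        by (intro divide_right_mono add_mono mult_left_mono) auto
      also have "\<dots> \<le> \<epsilon>" using \<open>0 < \<epsilon>\<close> cap_bounds[of rt_child] by (simp add: power2_eq_square)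
      finally have 2: "(\<Sum>w\<in>tree_ball m. ?e w * ?F w) \<le> \<epsilon>" .
      have 3: "(\<Sum>w\<in>tree_ball m. (?f w)\<^sup>2) \<le> total_cap" by (rule ball_energy_le[OF en]) (simp add: cap_bounds)
      have "(?f v - ?F v)\<^sup>2 \<le> (\<Sum>w\<in>tree_ball m. (?f w - ?F w)\<^sup>2)"
        using v by (intro member_le_sum finite_ball) (auto simp: tree_ball_def m_def)
      also have "\<dots> = (\<Sum>w\<in>tree_ball m. (?f w)\<^sup>2) + (\<Sum>w\<in>tree_ball m. (?F w)\<^sup>2) - 2 * (\<Sum>w\<in>tree_ball m. ?f w * ?F w)"
        by (simp add: power2_diff sum.distrib sum_subtractf sum_distrib_left mult_ac)
      also have "\<dots> \<le> total_cap + total_cap - 2 * ((1 - \<epsilon>) * total_cap - \<epsilon>)"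
      proof -
        have "a + b - 2 * p \<le> t + t - 2 * (l - d)" if "l \<le> p + q" "q \<le> d" "a \<le> t" "b \<le> t" for a b p t l d q :: real
          using that by argo
        from this[OF 1 2 3 cap_energy_le] show ?thesis by simp
      qed
      also have "\<dots> = 2 * \<epsilon> * total_cap + 2 * \<epsilon>" by (simp add: algebra_simps)
      also have "\<dots> \<le> 4 * \<epsilon>" using \<open>0 < \<epsilon>\<close> cap_bounds[of rt_child] by simp
      finally show ?thesis .
    qed
    have "(?f v - ?F v)\<^sup>2 \<le> 0"
    proof (rule field_le_epsilon)
      fix \<epsilon> :: real assume "0 < \<epsilon>"
      then show "(?f v - ?F v)\<^sup>2 \<le> 0 + \<epsilon>" using small[of "\<epsilon> / 4"] by simp
    qed
    then show ?thesis using v edge_fun_edge[of v ?F] by simp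
  qed
qed

lemma equilibrium_function_eq: "equilibrium_function T = edge_fun (grad cap)"
  unfolding equilibrium_function_def using equilibrium_exists equilibrium_unique by (rule the_equality)

lemma regular_surv_tendsto:
  assumes "regular_point T \<zeta>"
  shows "\<zeta> \<in> boundary T" "(\<lambda>N. surv cap (\<zeta> N)) \<longlonglongrightarrow> 0"
proof -
  show z: "\<zeta> \<in> boundary T" using assms by (simp add: regular_point_def)
  obtain \<rho> where \<rho>: "0 \<le> \<rho>" "\<rho> \<le> 1" "(\<lambda>N. surv cap (\<zeta> N)) \<longlonglongrightarrow> \<rho>"
    "potential (edge_fun (grad cap)) \<zeta> = ennreal (1 - \<rho>)"
    using surv_cap_lim[OF z] by blast
  have "ennreal (1 - \<rho>) = 1"
    using assms \<rho>(4) by (simp add: regular_point_def equilibrium_function_eq)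
  then have "\<rho> = 0" using \<rho>(2) by (simp add: ennreal_eq_1)
  then show "(\<lambda>N. surv cap (\<zeta> N)) \<longlonglongrightarrow> 0" using \<rho>(3) by simp
qed

end

section \<open>The law of the walk\<close>

abbreviation path_space :: "(nat \<Rightarrow> 'a) measure" where
  "path_space \<equiv> PiM UNIV (\<lambda>_. count_space UNIV)"

lemma sets_walk_law [measurable_cong]: "sets (walk_law T x) = sets path_space"
  by (simp add: walk_law_def)

lemma space_walk_law [simp]: "space (walk_law T x) = UNIV"
  by (simp add: walk_law_def space_PiM)

lemma measurable_walk_law: "f \<in> measurable path_space N \<Longrightarrow> f \<in> measurable (walk_law T x) N"
  by (simp cong: measurable_cong_sets add: sets_walk_law)

lemma measurable_coord [measurable]: "(\<lambda>z. z n) \<in> measurable path_space (count_space UNIV)"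
  by (rule measurable_component_singleton) simp

lemma sets_coord: "{z. z n \<in> A} \<in> sets path_space"
proof -
  have "(\<lambda>z. z n) -` A \<inter> space path_space \<in> sets path_space"
    by (rule measurable_sets[OF measurable_coord]) simp
  then show ?thesis by (simp add: vimage_def space_PiM)
qed

lemma sets_cylinder: "{z. \<forall>i\<le>n. z i \<in> A i} \<in> sets path_space"
proof -
  have "{z. \<forall>i\<le>n. z i \<in> A i} = (\<Inter>i\<in>{..n}. {z. z i \<in> A i})" by auto
  also have "\<dots> \<in> sets path_space" by (intro sets.finite_INT sets_coord) auto
  finally show ?thesis .
qed

text \<open>The total mass is read off from the marginal on the empty index set, whose embedding is
  the whole path space.\<close>

lemma prob_space_walk_law: "prob_space (walk_law T x)"
proof
  let ?M = "\<lambda>_::nat. count_space (UNIV :: 'a set)"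
  have "emeasure (walk_law T x) (prod_emb UNIV ?M {} {\<lambda>_. undefined}) =
     emeasure (walk.CI T x {}) {\<lambda>_. undefined}"
    unfolding walk_law_def by (rule walk.lim) (simp_all add: sets_PiM_I_finite PiM_empty)
  moreover have "emeasure (walk.CI T x {}) {\<lambda>_. undefined} = 1"
  proof -
    have "space (walk.CI T x {}) = {\<lambda>_. undefined}" by (simp add: walk.CI_def space_PiM)
    then show ?thesis using prob_space.emeasure_space_1[OF walk.PF.prob_space_P[of "{}" T x]] by simp
  qed
  moreover have "prod_emb UNIV ?M {} {\<lambda>_. undefined} = UNIV"
    by (auto simp: prod_emb_def space_PiM)
  ultimately show "emeasure (walk_law T x) (space (walk_law T x)) = 1" by simp
qed

text \<open>Reduces expectations over finitely many coordinates to the iterated kernels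
  \<open>walk.C\<close>, whose recursion splits off the last step.\<close>

lemma nn_integral_walk_C:
  assumes "g \<in> borel_measurable (PiM {0..<n} (\<lambda>_. count_space UNIV))"
  shows "(\<integral>\<^sup>+z. g (restrict z {0..<n}) \<partial>walk_law T x) = (\<integral>\<^sup>+w. g w \<partial>walk.C T x 0 n (\<lambda>_. undefined))"
proof -
  let ?M = "\<lambda>_::nat. count_space (UNIV :: 'a set)"
  let ?D = "walk.C T x 0 n (\<lambda>_. undefined)"
  have up: "walk.up_to {0..<n} = n"
    using walk.up_to[of "{0..<n}"] walk.up_to_iff_Ico[of "{0..<n}" n] by (intro antisym) auto
  have sp: "(\<lambda>_. undefined) \<in> space (PiM {0..<0} ?M)" by (simp add: space_PiM)
  have sets: "sets ?D = sets (PiM {0..<n} ?M)"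
    using walk.sets_C[OF sp, of T x n] by simp
  have "(\<integral>\<^sup>+z. g (restrict z {0..<n}) \<partial>walk_law T x)
     = (\<integral>\<^sup>+w. g w \<partial>distr (walk_law T x) (PiM {0..<n} ?M) (\<lambda>z. restrict z {0..<n}))"
  proof (rule nn_integral_distr[symmetric])
    show "(\<lambda>z. restrict z {0..<n}) \<in> walk_law T x \<rightarrow>\<^sub>M PiM {0..<n} ?M"
      by (rule measurable_walk_law[OF measurable_restrict_subset]) simp
  qed (use assms in simp)
  also have "\<dots> = (\<integral>\<^sup>+w. g w \<partial>walk.CI T x {0..<n})"
    unfolding walk_law_def by (simp only: walk.distr_lim[OF finite_atLeastLessThan])
  also have "\<dots> = (\<integral>\<^sup>+w. g (restrict w {0..<n}) \<partial>?D)"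
    unfolding walk.CI_def up
  proof (rule nn_integral_distr)
    show "(\<lambda>f. restrict f {0..<n}) \<in> ?D \<rightarrow>\<^sub>M Pi\<^sub>M {0..<n} ?M"
      unfolding measurable_cong_sets[OF sets refl] by (rule measurable_restrict_subset) simp
  qed (use assms in simp)
  also have "\<dots> = (\<integral>\<^sup>+w. g w \<partial>?D)"
  proof (rule nn_integral_cong)
    fix w assume "w \<in> space ?D"
    then have "w \<in> space (PiM {0..<n} ?M)" using sets_eq_imp_space_eq[OF sets] by simp
    then show "g (restrict w {0..<n}) = g w" by (simp add: space_PiM PiE_iff extensional_restrict)
  qed
  finally show ?thesis .
qed

text \<open>Splitting the last kernel off \<open>walk.C\<close> leaves the transition law from
  \<open>z n\<close>. The one-dimensional marginals and the admissibility of almost every step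
  follow from it.\<close>

lemma emeasure_walk_step:
  "emeasure (walk_law T x) {z. z n \<in> A \<and> z (Suc n) \<in> B} =
    (\<integral>\<^sup>+z. indicator A (z n) * emeasure (walk_step T (z n)) B \<partial>walk_law T x)"
proof -
  let ?M = "\<lambda>_::nat. count_space (UNIV :: 'a set)"
  let ?C = "\<lambda>n. walk.C T x 0 n (\<lambda>_. undefined)"
  let ?X = "{w \<in> space (PiM {0..<Suc (Suc n)} ?M). w n \<in> A \<and> w (Suc n) \<in> B}"
  have mc: "(\<lambda>w. w i) \<in> measurable (PiM {0..<m} ?M) (count_space UNIV)" if "i < m" for i m
    using that by (intro measurable_component_singleton) auto
  have X: "?X \<in> sets (PiM {0..<Suc (Suc n)} ?M)"
  proof -
    have "(\<lambda>w. w n) -` A \<inter> space (PiM {0..<Suc (Suc n)} ?M) \<in> sets (PiM {0..<Suc (Suc n)} ?M)"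
      "(\<lambda>w. w (Suc n)) -` B \<inter> space (PiM {0..<Suc (Suc n)} ?M) \<in> sets (PiM {0..<Suc (Suc n)} ?M)"
      by (rule measurable_sets[OF mc]; simp)+
    then have "((\<lambda>w. w n) -` A \<inter> space (PiM {0..<Suc (Suc n)} ?M)) \<inter> ((\<lambda>w. w (Suc n)) -` B \<inter> space (PiM {0..<Suc (Suc n)} ?M))
       \<in> sets (PiM {0..<Suc (Suc n)} ?M)" by (rule sets.Int)
    also have "((\<lambda>w. w n) -` A \<inter> space (PiM {0..<Suc (Suc n)} ?M)) \<inter> ((\<lambda>w. w (Suc n)) -` B \<inter> space (PiM {0..<Suc (Suc n)} ?M)) = ?X"
      by auto
    finally show ?thesis .
  qed
  have sp: "(\<lambda>_. undefined) \<in> space (PiM {0..<0} ?M)" by (simp add: space_PiM)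
  have sets: "sets (?C m) = sets (PiM {0..<m} ?M)" for m
    using walk.sets_C[OF sp, of T x m] by simp
  have space: "space (?C m) = space (PiM {0..<m} ?M)" for m by (rule sets_eq_imp_space_eq[OF sets])
  have ne: "space (?C (Suc n)) \<noteq> {}" unfolding space by (auto simp: space_PiM PiE_eq_empty_iff)
  have m: "walk.eP T x (0 + Suc n) \<in> measurable (?C (Suc n)) (subprob_algebra (PiM {0..<Suc (Suc n)} ?M))"
    unfolding measurable_cong_sets[OF sets refl] add_0 by (rule walk.measurable_eP)
  have "emeasure (walk_law T x) {z. z n \<in> A \<and> z (Suc n) \<in> B} =
     (\<integral>\<^sup>+z. indicator {z. z n \<in> A \<and> z (Suc n) \<in> B} z \<partial>walk_law T x)"
  proof (rule nn_integral_indicator[symmetric])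
    have "{z. z n \<in> A} \<inter> {z. z (Suc n) \<in> B} \<in> sets path_space" by (intro sets.Int sets_coord)
    then show "{z. z n \<in> A \<and> z (Suc n) \<in> B} \<in> sets (walk_law T x)" by (simp add: sets_walk_law Collect_conj_eq)
  qed
  also have "\<dots> = (\<integral>\<^sup>+z. indicator ?X (restrict z {0..<Suc (Suc n)}) \<partial>walk_law T x)"
    by (rule nn_integral_cong) (auto simp: space_PiM split: split_indicator)
  also have "\<dots> = (\<integral>\<^sup>+w. indicator ?X w \<partial>?C (Suc (Suc n)))"
    by (rule nn_integral_walk_C) (use X in simp)
  also have "\<dots> = emeasure (?C (Suc (Suc n))) ?X" using X by (simp add: sets del: walk.C.simps)
  also have "\<dots> = (\<integral>\<^sup>+w. emeasure (walk.eP T x (Suc n) w) ?X \<partial>?C (Suc n))"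
    using emeasure_bind[OF ne m X] unfolding walk.C.simps(2)[of T x 0 "Suc n"] add_0 .
  also have "\<dots> = (\<integral>\<^sup>+w. indicator A (w n) * emeasure (walk_step T (w n)) B \<partial>?C (Suc n))"
  proof (rule nn_integral_cong)
    fix w assume "w \<in> space (?C (Suc n))"
    then have w: "w \<in> space (PiM {0..<Suc n} ?M)" by (simp only: space)
    have vim: "(\<lambda>a. w(Suc n := a)) -` ?X \<inter> space (?M (Suc n)) = (if w n \<in> A then B else {})"
      using w by (auto simp: space_PiM PiE_iff extensional_def)
    show "emeasure (walk.eP T x (Suc n) w) ?X = indicator A (w n) * emeasure (walk_step T (w n)) B"
      unfolding walk.emeasure_eP[OF w X] vim by (simp add: walk_kernel_def)
  qed
  also have "\<dots> = (\<integral>\<^sup>+z. indicator A (restrict z {0..<Suc n} n) * emeasure (walk_step T (restrict z {0..<Suc n} n)) B \<partial>walk_law T x)"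
    by (rule nn_integral_walk_C[symmetric]) (rule measurable_compose[OF mc], auto)
  finally show ?thesis by simp
qed

primrec walk_pmf :: "'a edge_rooted_graph \<Rightarrow> 'a \<Rightarrow> nat \<Rightarrow> 'a pmf" where
  "walk_pmf T x 0 = return_pmf x"
| "walk_pmf T x (Suc n) = bind_pmf (walk_pmf T x n) (walk_step T)"

lemma AE_walk_start: "AE z in walk_law T x. z 0 = x"
proof (rule prob_space.AE_prob_1[OF prob_space_walk_law, of _ _ "{z. z 0 = x}", simplified])
  show "measure (walk_law T x) {z. z 0 = x} = 1"
    using emeasure_walk_law_cylinder[of T x 0 "\<lambda>_. x"] by (simp add: measure_def)
qed

lemma distr_walk_law: "distr (walk_law T x) (count_space UNIV) (\<lambda>z. z n) = measure_pmf (walk_pmf T x n)"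
proof (induction n)
  case 0
  show ?case
  proof (rule measure_eqI)
    fix A assume "A \<in> sets (distr (walk_law T x) (count_space UNIV) (\<lambda>z. z 0))"
    have "emeasure (distr (walk_law T x) (count_space UNIV) (\<lambda>z. z 0)) A = emeasure (walk_law T x) {z. z 0 \<in> A}"
      by (subst emeasure_distr) (auto intro!: measurable_walk_law simp: vimage_def)
    also have "\<dots> = emeasure (walk_law T x) {z. x \<in> A}"
    proof (rule emeasure_eq_AE)
      show "AE z in walk_law T x. z \<in> {z. z 0 \<in> A} \<longleftrightarrow> z \<in> {z. x \<in> A}" using AE_walk_start by eventually_elim auto
    qed (use sets.top[of "walk_law T x"] in \<open>auto simp: sets_coord sets_walk_law\<close>)
    also have "\<dots> = indicator A x"
      using prob_space.emeasure_space_1[OF prob_space_walk_law, of T x] by (auto split: split_indicator)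
    finally show "emeasure (distr (walk_law T x) (count_space UNIV) (\<lambda>z. z 0)) A = emeasure (measure_pmf (walk_pmf T x 0)) A"
      by simp
  qed simp
next
  case (Suc n)
  show ?case
  proof (rule measure_eqI)
    fix A assume "A \<in> sets (distr (walk_law T x) (count_space UNIV) (\<lambda>z. z (Suc n)))"
    have "emeasure (distr (walk_law T x) (count_space UNIV) (\<lambda>z. z (Suc n))) A = emeasure (walk_law T x) {z. z n \<in> UNIV \<and> z (Suc n) \<in> A}"
      by (subst emeasure_distr) (auto intro!: measurable_walk_law simp: vimage_def)
    also have "\<dots> = (\<integral>\<^sup>+z. emeasure (walk_step T (z n)) A \<partial>walk_law T x)"
      unfolding emeasure_walk_step by simp
    also have "\<dots> = (\<integral>\<^sup>+y. emeasure (walk_step T y) A \<partial>distr (walk_law T x) (count_space UNIV) (\<lambda>z. z n))"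
      by (rule nn_integral_distr[symmetric]) (auto intro!: measurable_walk_law)
    finally show "emeasure (distr (walk_law T x) (count_space UNIV) (\<lambda>z. z (Suc n))) A = emeasure (measure_pmf (walk_pmf T x (Suc n))) A"
      unfolding Suc.IH by simp
  qed simp
qed

lemma nn_integral_walk_law: "(\<integral>\<^sup>+z. g (z n) \<partial>walk_law T x) = (\<integral>\<^sup>+y. g y \<partial>walk_pmf T x n)"
  unfolding distr_walk_law[symmetric] by (rule nn_integral_distr[symmetric]) (auto intro!: measurable_walk_law)

lemma emeasure_walk_law: "emeasure (walk_law T x) {z. z n \<in> A} = emeasure (walk_pmf T x n) A"
  unfolding distr_walk_law[symmetric] by (subst emeasure_distr) (auto intro!: measurable_walk_law simp: vimage_def)


text \<open>The vertex type may be uncountable, so singleton cylinders generate the \<open>\<sigma>\<close>-algebra only on a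
  countable set of vertices.\<close>

lemma path_measure_eqI:
  fixes M N :: "(nat \<Rightarrow> 'a) measure"
  assumes sets: "sets M = sets path_space" "sets N = sets path_space"
    and fin: "finite_measure M" and V: "countable V"
    and MV: "AE z in M. \<forall>n. z n \<in> V" and NV: "AE z in N. \<forall>n. z n \<in> V"
    and eq: "\<And>n y. emeasure M {z. \<forall>i\<le>n. z i = y i} = emeasure N {z. \<forall>i\<le>n. z i = y i}"
  shows "M = N"
proof (rule measure_eqI_PiM_infinite[OF sets _ fin])
  fix A :: "nat \<Rightarrow> 'a set" and J :: "nat set"
  assume J: "finite J"
  define n where "n = Max (insert 0 J)"
  have Jn: "J \<subseteq> {..n}" using J by (auto simp: n_def)
  let ?E = "prod_emb UNIV (\<lambda>_. count_space UNIV) J (Pi\<^sub>E J A)"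
  \<comment> \<open>The words of length \<open>n + 1\<close> over \<open>V\<close> that meet the
    constraints: countably many, so the cylinder is almost surely a countable disjoint union of
    singleton cylinders.\<close>
  define Y where "Y = (\<Pi>\<^sub>E i\<in>{..n}. V \<inter> (if i \<in> J then A i else UNIV))"
  have E: "?E = {z. \<forall>i\<in>J. z i \<in> A i}"
    by (auto simp: prod_emb_def space_PiM PiE_iff)
  have E': "?E = {z. \<forall>i\<le>n. z i \<in> (if i \<in> J then A i else UNIV)}"
    unfolding E using Jn by auto
  have cY: "countable Y" unfolding Y_def using V by (intro countable_PiE) auto
  have cyl: "{z. \<forall>i\<le>n. z i = y i} \<in> sets path_space" for y :: "nat \<Rightarrow> 'a"
    using sets_cylinder[of n "\<lambda>i. {y i}"] by simp
  have disj: "disjoint_family_on (\<lambda>y. {z. \<forall>i\<le>n. z i = y i}) Y"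
    unfolding disjoint_family_on_def
  proof (intro ballI impI)
    fix y y' assume y: "y \<in> Y" "y' \<in> Y" "y \<noteq> y'"
    have "\<exists>i\<le>n. y i \<noteq> y' i"
    proof (rule ccontr)
      assume "\<not> ?thesis"
      then have "y = y'" using y(1,2) unfolding Y_def by (intro PiE_ext) auto
      then show False using y(3) by simp
    qed
    then show "{z. \<forall>i\<le>n. z i = y i} \<inter> {z. \<forall>i\<le>n. z i = y' i} = {}" by auto
  qed
  have main: "emeasure L ?E = (\<integral>\<^sup>+y. emeasure L {z. \<forall>i\<le>n. z i = y i} \<partial>count_space Y)"
    if L: "sets L = sets path_space" "AE z in L. \<forall>n. z n \<in> V" for L :: "(nat \<Rightarrow> 'a) measure"
  proof -
    have "emeasure L ?E = emeasure L (\<Union>y\<in>Y. {z. \<forall>i\<le>n. z i = y i})"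
    proof (rule emeasure_eq_AE)
      show "AE z in L. z \<in> ?E \<longleftrightarrow> z \<in> (\<Union>y\<in>Y. {z. \<forall>i\<le>n. z i = y i})"
        using L(2)
      proof eventually_elim
        case (elim z)
        show ?case
        proof
          assume "z \<in> ?E"
          then have "restrict z {..n} \<in> Y" using elim Jn unfolding E Y_def by (auto simp: PiE_iff)
          moreover have "\<forall>i\<le>n. z i = restrict z {..n} i" by simp
          ultimately show "z \<in> (\<Union>y\<in>Y. {z. \<forall>i\<le>n. z i = y i})" by blast
        next
          assume "z \<in> (\<Union>y\<in>Y. {z. \<forall>i\<le>n. z i = y i})"
          then obtain y where y: "y \<in> Y" "\<And>i. i \<le> n \<Longrightarrow> z i = y i" by auto
          have "z i \<in> A i" if "i \<in> J" for i
          proof -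
            have i: "i \<le> n" using Jn that by auto
            then show ?thesis using PiE_mem[OF y(1)[unfolded Y_def], of i] y(2)[OF i] that by simp
          qed
          then show "z \<in> ?E" unfolding E by simp
        qed
      qed
      show "?E \<in> sets L" unfolding E' L(1) by (rule sets_cylinder)
      show "(\<Union>y\<in>Y. {z. \<forall>i\<le>n. z i = y i}) \<in> sets L"
        unfolding L(1) by (intro sets.countable_UN' cY) (auto simp: cyl)
    qed
    also have "\<dots> = (\<integral>\<^sup>+y. emeasure L {z. \<forall>i\<le>n. z i = y i} \<partial>count_space Y)"
      by (rule emeasure_UN_countable[OF _ cY disj]) (simp add: L(1) cyl)
    finally show ?thesis .
  qed
  show "emeasure M ?E = emeasure N ?E" unfolding main[OF sets(1) MV] main[OF sets(2) NV] eq ..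
qed

section \<open>The Markov property at the first step, on the tree\<close>

context rooted_tree
begin

lemma nbrs_verts: "nbrs T x \<subseteq> verts T" by (auto simp: nbrs_def)

lemma nbrs_nonempty: "x \<in> verts T \<Longrightarrow> nbrs T x \<noteq> {}"
  using ch_nonempty ch_subset by blast

lemma set_walk_step:
  "x \<in> verts T \<Longrightarrow> set_pmf (walk_step T x) = (if x = rt then {rt} else nbrs T x)"
  by (simp add: walk_step_def nbrs_nonempty locally_finite)

lemma set_walk_step_verts: "x \<in> verts T \<Longrightarrow> set_pmf (walk_step T x) \<subseteq> verts T"
  using set_walk_step nbrs_verts rt_verts by auto

lemma set_walk_pmf: "x \<in> verts T \<Longrightarrow> set_pmf (walk_pmf T x n) \<subseteq> verts T"
proof (induction n)
  case (Suc n)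
  then show ?case using set_walk_step_verts by (auto simp: subset_iff)
qed simp

lemma AE_walk_verts:
  assumes "x \<in> verts T"
  shows "AE z in walk_law T x. \<forall>n. z n \<in> verts T"
  unfolding AE_all_countable
proof
  fix n
  have "emeasure (walk_law T x) {z. z n \<in> - verts T} = 0"
    unfolding emeasure_walk_law
    using set_walk_pmf[OF assms, of n] by (auto simp: emeasure_pmf_single_eq_zero_iff measure_pmf.emeasure_eq_measure measure_pmf_zero_iff)
  then have "{z. z n \<in> - verts T} \<in> null_sets (walk_law T x)" using sets_coord[of n "- verts T"] by (simp add: null_sets_def sets_walk_law)
  then show "AE z in walk_law T x. z n \<in> verts T" by (rule AE_I') auto
qed

lemma AE_walk_step:
  assumes "x \<in> verts T"
  shows "AE z in walk_law T x. \<forall>n. z (Suc n) \<in> set_pmf (walk_step T (z n))"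
  unfolding AE_all_countable
proof
  fix n
  \<comment> \<open>Running over fixed values \<open>u\<close> of \<open>z n\<close> in the
    countable vertex set reduces the claim to countably many null events.\<close>
  have "AE z in walk_law T x. \<forall>u\<in>verts T. \<not> (z n = u \<and> z (Suc n) \<notin> set_pmf (walk_step T u))"
    unfolding AE_ball_countable[OF countable_verts]
  proof
    fix u assume "u \<in> verts T"
    let ?N = "{z. z n \<in> {u} \<and> z (Suc n) \<in> - set_pmf (walk_step T u)}"
    have "emeasure (walk_law T x) ?N = 0"
    proof -
      have "(\<integral>\<^sup>+z. indicator {u} (z n) * emeasure (walk_step T (z n)) (- set_pmf (walk_step T u)) \<partial>walk_law T x)
        = (\<integral>\<^sup>+z. 0 \<partial>walk_law T x)"
        by (rule nn_integral_cong) (auto simp: measure_pmf.emeasure_eq_measure measure_pmf_zero_iff split: split_indicator)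
      then show ?thesis unfolding emeasure_walk_step by simp
    qed
    moreover have "?N \<in> sets (walk_law T x)"
    proof -
      have "{z. z n \<in> {u}} \<inter> {z. z (Suc n) \<in> - set_pmf (walk_step T u)} \<in> sets path_space" by (intro sets.Int sets_coord)
      then show ?thesis by (simp add: sets_walk_law Collect_conj_eq)
    qed
    ultimately have "?N \<in> null_sets (walk_law T x)" by (simp add: null_sets_def)
    then show "AE z in walk_law T x. \<not> (z n = u \<and> z (Suc n) \<notin> set_pmf (walk_step T u))" by (rule AE_I') auto
  qed
  then show "AE z in walk_law T x. z (Suc n) \<in> set_pmf (walk_step T (z n))"
    using AE_walk_verts[OF assms] by eventually_elim blast
qed

lemma shift_measurable: "(\<lambda>z n. z (Suc n)) \<in> measurable path_space path_space"
  by (rule measurable_PiM_single') (auto simp: space_PiM)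

lemma kernel_walk_law: "walk_law T \<in> measurable (measure_pmf p) (subprob_algebra path_space)"
proof -
  have "walk_law T y \<in> space (subprob_algebra path_space)" for y
    using prob_space_imp_subprob_space[OF prob_space_walk_law, of T y] by (simp add: space_subprob_algebra sets_walk_law)
  then show ?thesis by simp
qed

text \<open>On singleton cylinders the product formula has a first factor
  \<open>pmf (walk_step T x) (y 0)\<close>, and the remaining product is the law started at
  \<open>y 0\<close>.\<close>

lemma walk_markov:
  assumes x: "x \<in> verts T"
  shows "distr (walk_law T x) path_space (\<lambda>z n. z (Suc n)) = measure_pmf (walk_step T x) \<bind> walk_law T"
proof (rule path_measure_eqI[OF _ _ _ countable_verts])
  let ?S = "\<lambda>z n. z (Suc n)"
  let ?B = "measure_pmf (walk_step T x) \<bind> walk_law T"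
  have mS: "?S \<in> measurable (walk_law T x) path_space"
    by (rule measurable_walk_law[OF shift_measurable])
  show "sets (distr (walk_law T x) path_space ?S) = sets path_space" by simp
  show sB: "sets ?B = sets path_space" by (rule sets_bind_measurable[OF kernel_walk_law]) simp
  show "finite_measure (distr (walk_law T x) path_space ?S)"
    using prob_space.prob_space_distr[OF prob_space_walk_law mS] by (rule prob_space.finite_measure)
  show "AE z in distr (walk_law T x) path_space ?S. \<forall>n. z n \<in> verts T"
  proof (subst AE_distr_iff[OF mS])
    have "{z. \<forall>n. z n \<in> verts T} = (\<Inter>n. {z. z n \<in> verts T})" by auto
    also have "\<dots> \<in> sets path_space" using sets_coord by (intro sets.countable_INT) auto
    finally show "{z \<in> space path_space. \<forall>n. z n \<in> verts T} \<in> sets path_space" by (simp add: space_PiM)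
    show "AE z in walk_law T x. \<forall>n. z (Suc n) \<in> verts T" using AE_walk_verts[OF x] by auto
  qed
  show "AE z in ?B. \<forall>n. z n \<in> verts T"
  proof (subst AE_bind[OF kernel_walk_law])
    have "{z. \<forall>n. z n \<in> verts T} = (\<Inter>n. {z. z n \<in> verts T})" by auto
    also have "\<dots> \<in> sets path_space" using sets_coord by (intro sets.countable_INT) auto
    finally show "Measurable.pred path_space (\<lambda>z. \<forall>n. z n \<in> verts T)" by (simp add: pred_def space_PiM)
    show "AE y in measure_pmf (walk_step T x). AE z in walk_law T y. \<forall>n. z n \<in> verts T"
      using AE_walk_verts set_walk_step_verts[OF x] by (intro AE_pmfI) auto
  qed
  fix n and y :: "nat \<Rightarrow> 'a"
  let ?P = "\<Prod>i<n. pmf (walk_step T (y i)) (y (Suc i))"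
  have P0: "0 \<le> ?P" by (intro prod_nonneg) simp
  have cyl: "{z. \<forall>i\<le>n. z i = y i} \<in> sets path_space" using sets_cylinder[of n "\<lambda>i. {y i}"] by simp
  have "emeasure (distr (walk_law T x) path_space ?S) {z. \<forall>i\<le>n. z i = y i} = emeasure (walk_law T x) {z. \<forall>i\<le>n. z (Suc i) = y i}"
    by (subst emeasure_distr[OF mS cyl]) (simp add: vimage_def)
  \<comment> \<open>The almost sure first letter \<open>x\<close> is put in front, so that the
    product formula applies.\<close>
  also have "\<dots> = emeasure (walk_law T x) {z. \<forall>i\<le>Suc n. z i = (case i of 0 \<Rightarrow> x | Suc j \<Rightarrow> y j)}"
  proof (rule emeasure_eq_AE)
    show "AE z in walk_law T x. z \<in> {z. \<forall>i\<le>n. z (Suc i) = y i} \<longleftrightarrow> z \<in> {z. \<forall>i\<le>Suc n. z i = (case i of 0 \<Rightarrow> x | Suc j \<Rightarrow> y j)}"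
      using AE_walk_start by eventually_elim (auto split: nat.split)
    show "{z. \<forall>i\<le>n. z (Suc i) = y i} \<in> sets (walk_law T x)"
      using measurable_sets[OF mS cyl] by (simp add: vimage_def)
    show "{z. \<forall>i\<le>Suc n. z i = (case i of 0 \<Rightarrow> x | Suc j \<Rightarrow> y j)} \<in> sets (walk_law T x)"
      using sets_cylinder[of "Suc n" "\<lambda>i. {case i of 0 \<Rightarrow> x | Suc j \<Rightarrow> y j}"] by (simp add: sets_walk_law)
  qed
  also have "\<dots> = ennreal (pmf (walk_step T x) (y 0) * ?P)"
    unfolding emeasure_walk_law_cylinder by (simp add: prod.lessThan_Suc_shift del: prod.lessThan_Suc)
  also have "\<dots> = (\<integral>\<^sup>+v. ennreal ?P * indicator {y 0} v \<partial>walk_step T x)"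
    by (subst nn_integral_cmult_indicator) (simp_all add: emeasure_pmf_single ennreal_mult P0 mult.commute)
  also have "\<dots> = (\<integral>\<^sup>+v. emeasure (walk_law T v) {z. \<forall>i\<le>n. z i = y i} \<partial>walk_step T x)"
    unfolding emeasure_walk_law_cylinder by (rule nn_integral_cong) (auto split: split_indicator)
  also have "\<dots> = emeasure ?B {z. \<forall>i\<le>n. z i = y i}"
    by (rule emeasure_bind[OF _ kernel_walk_law cyl, symmetric]) simp
  finally show "emeasure (distr (walk_law T x) path_space ?S) {z. \<forall>i\<le>n. z i = y i} = emeasure ?B {z. \<forall>i\<le>n. z i = y i}" .
qed

text \<open>Shift invariance puts the same \<open>G\<close> on both sides of the Markov property;
  clearing the degree matches the unnormalised Laplacian.\<close>

lemma integral_walk_step: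
  fixes G :: "(nat \<Rightarrow> 'a) \<Rightarrow> real"
  assumes x: "x \<in> verts T" "x \<noteq> rt" and G: "G \<in> borel_measurable path_space"
    and bnd: "\<And>z. \<bar>G z\<bar> \<le> B" and shift: "\<And>z. G (\<lambda>n. z (Suc n)) = G z"
  shows "real (card (nbrs T x)) * (\<integral>z. G z \<partial>walk_law T x) = (\<Sum>y\<in>nbrs T x. \<integral>z. G z \<partial>walk_law T y)"
proof -
  have "(\<integral>z. G z \<partial>walk_law T x) = (\<integral>z. G (\<lambda>n. z (Suc n)) \<partial>walk_law T x)" by (simp add: shift)
  also have "\<dots> = (\<integral>z. G z \<partial>distr (walk_law T x) path_space (\<lambda>z n. z (Suc n)))"
    by (rule integral_distr[symmetric, OF measurable_walk_law[OF shift_measurable] G])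
  also have "\<dots> = (\<integral>y. (\<integral>z. G z \<partial>walk_law T y) \<partial>walk_step T x)"
    unfolding walk_markov[OF x(1)]
    by (rule integral_bind[where K = path_space and B = B and B' = 1])
      (use G bnd kernel_walk_law prob_space.emeasure_space_1[OF prob_space_walk_law, of T] in
        \<open>auto intro: measure_pmf.finite_measure intro!: AE_I2\<close>)
  also have "\<dots> = (\<Sum>y\<in>nbrs T x. \<integral>z. G z \<partial>walk_law T y) / real (card (nbrs T x))"
    using x by (simp add: walk_step_def integral_pmf_of_set nbrs_nonempty locally_finite)
  finally show ?thesis using nbrs_nonempty[OF x(1)] locally_finite[OF x(1)] by (simp add: field_simps)
qed

end

section \<open>Limits of trajectories\<close>

context rooted_tree
begin

text \<open>For \<open>v \<noteq> rt\<close> this is the arc of the edge above \<open>v\<close>, see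
  \<open>boundary_at_edge\<close>; indexing by vertices also covers \<open>o\<close>, where it is
  the whole boundary.\<close>

definition shadow :: "'a \<Rightarrow> (nat \<Rightarrow> 'a) set" where
  "shadow v = {\<zeta> \<in> boundary T. \<zeta> (lev v) = v}"

lemma shadow_subset: "shadow v \<subseteq> boundary T" by (auto simp: shadow_def)

lemma in_shadow: "\<zeta> \<in> boundary T \<Longrightarrow> \<zeta> \<in> shadow (\<zeta> n)"
  by (simp add: shadow_def boundaryD)

lemma shadow_iff: "\<zeta> \<in> boundary T \<Longrightarrow> \<zeta>' \<in> shadow (\<zeta> n) \<longleftrightarrow> \<zeta>' \<in> boundary T \<and> \<zeta>' n = \<zeta> n"
  by (simp add: shadow_def boundaryD)

lemma boundary_agree:
  assumes "\<zeta> \<in> boundary T" "\<zeta>' \<in> boundary T" "\<zeta> n = \<zeta>' n" "m \<le> n"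
  shows "\<zeta> m = \<zeta>' m"
  using sub_lev_unique[of "\<zeta> n" "\<zeta> m" "\<zeta>' m"] boundary_sub[OF assms(1,4)] boundary_sub[OF assms(2,4)] assms
  by (simp add: boundaryD)

lemma sub_trans:
  assumes "x \<in> sub w" "w \<in> sub v" shows "x \<in> sub v"
  using rpath_sub_subset[OF assms(1)] assms by (auto simp: sub_def)

lemma shadow_mono: "\<zeta> \<in> boundary T \<Longrightarrow> m \<le> n \<Longrightarrow> shadow (\<zeta> n) \<subseteq> shadow (\<zeta> m)"
  using boundary_agree by (auto simp: shadow_iff)

lemma sub_mono: "\<zeta> \<in> boundary T \<Longrightarrow> m \<le> n \<Longrightarrow> sub (\<zeta> n) \<subseteq> sub (\<zeta> m)"
  using sub_trans boundary_sub by blast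

text \<open>Only a subbasis is given, but its members containing a fixed end are nested branches, so
  an intersection is handled by the deeper index. The successor appears because \<open>o\<close> has
  no edge above it.\<close>

lemma basic_nbhd:
  assumes "openin (compactification T) U" "\<zeta> \<in> boundary T" "End \<zeta> \<in> U"
  shows "\<exists>n. Vertex ` sub (\<zeta> (Suc n)) \<union> End ` shadow (\<zeta> (Suc n)) \<subseteq> U"
proof -
  have "generate_topology_on ((\<lambda>x. {Vertex x}) ` verts T \<union>
      (\<lambda>\<alpha>. Vertex ` verts_at T \<alpha> \<union> End ` boundary_at T \<alpha>) ` edges T) U"
    using assms(1) unfolding compactification_def by (simp add: openin_topology_generated_by_iff)
  then show ?thesis using assms(3)
  proof (induction rule: generate_topology_on.induct)
    case Empty
    then show ?case by simp
  next
    case (Int a b)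
    then obtain n m where n: "Vertex ` sub (\<zeta> (Suc n)) \<union> End ` shadow (\<zeta> (Suc n)) \<subseteq> a"
      and m: "Vertex ` sub (\<zeta> (Suc m)) \<union> End ` shadow (\<zeta> (Suc m)) \<subseteq> b" by auto
    have "sub (\<zeta> (Suc (max n m))) \<subseteq> sub (\<zeta> (Suc n)) \<inter> sub (\<zeta> (Suc m))"
      "shadow (\<zeta> (Suc (max n m))) \<subseteq> shadow (\<zeta> (Suc n)) \<inter> shadow (\<zeta> (Suc m))"
      using sub_mono[OF assms(2)] shadow_mono[OF assms(2)] by (simp_all add: max_def)
    then have "Vertex ` sub (\<zeta> (Suc (max n m))) \<union> End ` shadow (\<zeta> (Suc (max n m))) \<subseteq> a \<inter> b"
      using n m by blast
    then show ?case by blast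
  next
    case (UN K)
    then obtain k where k: "k \<in> K" "End \<zeta> \<in> k" by auto
    then obtain n where "Vertex ` sub (\<zeta> (Suc n)) \<union> End ` shadow (\<zeta> (Suc n)) \<subseteq> k" using UN.IH[OF k] by blast
    then show ?case using k by blast
  next
    case (Basis s)
    then obtain \<alpha> where a: "\<alpha> \<in> edges T" "s = Vertex ` verts_at T \<alpha> \<union> End ` boundary_at T \<alpha>" by auto
    then obtain v where v: "v \<in> verts T - {rt}" "\<alpha> = {par v, v}" unfolding edges_eq by auto
    have s: "s = Vertex ` sub v \<union> End ` shadow v"
      using a v by (simp add: verts_at_edge boundary_at_edge shadow_def)
    then have "\<zeta> (lev v) = v" using Basis.prems by (auto simp: shadow_def)
    moreover obtain m where "lev v = Suc m" using v lev_par[of v] by auto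
    ultimately show ?case using s by (intro exI[of _ m]) simp
  qed
qed

lemma basic_open:
  assumes "v \<in> verts T - {rt}"
  shows "openin (compactification T) (Vertex ` sub v \<union> End ` shadow v)"
proof -
  have "{par v, v} \<in> edges T" using assms edges_eq by auto
  then show ?thesis
    using assms unfolding compactification_def
    by (intro topology_generated_by_Basis) (auto simp: verts_at_edge boundary_at_edge shadow_def intro!: image_eqI[of _ _ "{par v, v}"])
qed

lemma vertex_open: "v \<in> verts T \<Longrightarrow> openin (compactification T) {Vertex v}"
  unfolding compactification_def by (intro topology_generated_by_Basis) auto

lemma boundary_nbhd:
  assumes "openin (boundary_topology T) U" "\<zeta> \<in> boundary T" "\<zeta> \<in> U"
  shows "\<exists>n. shadow (\<zeta> (Suc n)) \<subseteq> U"
proof -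
  have "generate_topology_on (boundary_at T ` edges T) U"
    using assms(1) unfolding boundary_topology_def by (simp add: openin_topology_generated_by_iff)
  then show ?thesis using assms(3)
  proof (induction rule: generate_topology_on.induct)
    case Empty
    then show ?case by simp
  next
    case (Int a b)
    then obtain n m where n: "shadow (\<zeta> (Suc n)) \<subseteq> a" and m: "shadow (\<zeta> (Suc m)) \<subseteq> b" by auto
    have "shadow (\<zeta> (Suc (max n m))) \<subseteq> shadow (\<zeta> (Suc n)) \<inter> shadow (\<zeta> (Suc m))"
      using shadow_mono[OF assms(2)] by (simp add: max_def)
    then show ?case using n m by blast
  next
    case (UN K)
    then obtain k where k: "k \<in> K" "\<zeta> \<in> k" by auto
    then obtain n where "shadow (\<zeta> (Suc n)) \<subseteq> k" using UN.IH[OF k] by blast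
    then show ?case using k by blast
  next
    case (Basis s)
    then obtain v where v: "v \<in> verts T - {rt}" "s = boundary_at T {par v, v}" unfolding edges_eq by auto
    then have s: "s = shadow v" by (simp add: boundary_at_edge shadow_def)
    then have "\<zeta> (lev v) = v" using Basis.prems by (auto simp: shadow_def)
    moreover obtain m where "lev v = Suc m" using v lev_par[of v] by auto
    ultimately show ?case using s by (intro exI[of _ m]) simp
  qed
qed

lemma topspace_boundary: "topspace (boundary_topology T) = boundary T"
proof -
  have "\<zeta> \<in> \<Union> (boundary_at T ` edges T)" if z: "\<zeta> \<in> boundary T" for \<zeta>
  proof -
    have v: "\<zeta> (Suc 0) \<in> verts T - {rt}" using boundaryD(3,6)[OF z] by simp
    have "\<zeta> \<in> boundary_at T {par (\<zeta> (Suc 0)), \<zeta> (Suc 0)}"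
      unfolding boundary_at_edge[OF v] using z boundaryD(4)[OF z] by simp
    then show ?thesis using v edges_eq by auto
  qed
  then show ?thesis unfolding boundary_topology_def topology_generated_by_topspace
    by (auto simp: boundary_at_def)
qed

text \<open>Convergence to an end stated through branches alone (\<open>limitin_End\<close>), which
  makes shift invariance and measurability elementary.\<close>

definition tends_to_end :: "(nat \<Rightarrow> 'a) \<Rightarrow> (nat \<Rightarrow> 'a) \<Rightarrow> bool" where
  "tends_to_end z \<zeta> \<longleftrightarrow> \<zeta> \<in> boundary T \<and> (\<forall>n. \<forall>\<^sub>F m in sequentially. z m \<in> sub (\<zeta> n))"

lemma limitin_End:
  assumes "\<zeta> \<in> boundary T"
  shows "limitin (compactification T) (\<lambda>n. Vertex (z n)) (End \<zeta>) sequentially \<longleftrightarrow>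
    (\<forall>n. \<forall>\<^sub>F m in sequentially. z m \<in> sub (\<zeta> (Suc n)))"
proof
  assume L: "limitin (compactification T) (\<lambda>n. Vertex (z n)) (End \<zeta>) sequentially"
  show "\<forall>n. \<forall>\<^sub>F m in sequentially. z m \<in> sub (\<zeta> (Suc n))"
  proof
    fix n
    let ?U = "Vertex ` sub (\<zeta> (Suc n)) \<union> End ` shadow (\<zeta> (Suc n))"
    have "openin (compactification T) ?U" "End \<zeta> \<in> ?U"
      using basic_open[of "\<zeta> (Suc n)"] boundaryD[OF assms] in_shadow[OF assms] by auto
    then have "\<forall>\<^sub>F m in sequentially. Vertex (z m) \<in> ?U" using L unfolding limitin_def by blast
    then show "\<forall>\<^sub>F m in sequentially. z m \<in> sub (\<zeta> (Suc n))" by eventually_elim auto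
  qed
next
  assume E: "\<forall>n. \<forall>\<^sub>F m in sequentially. z m \<in> sub (\<zeta> (Suc n))"
  show "limitin (compactification T) (\<lambda>n. Vertex (z n)) (End \<zeta>) sequentially"
    unfolding limitin_def
  proof (intro conjI allI impI)
    have "openin (compactification T) (Vertex ` sub (\<zeta> (Suc 0)) \<union> End ` shadow (\<zeta> (Suc 0)))"
      by (rule basic_open) (use boundaryD[OF assms] in auto)
    then show "End \<zeta> \<in> topspace (compactification T)"
      using openin_subset in_shadow[OF assms, of "Suc 0"] by blast
    fix U assume "openin (compactification T) U \<and> End \<zeta> \<in> U"
    then obtain n where n: "Vertex ` sub (\<zeta> (Suc n)) \<union> End ` shadow (\<zeta> (Suc n)) \<subseteq> U"
      using basic_nbhd[OF _ assms] by blast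
    show "\<forall>\<^sub>F m in sequentially. Vertex (z m) \<in> U"
      using E[rule_format, of n] by eventually_elim (use n in auto)
  qed
qed

lemma limitin_Vertex_rt:
  assumes "limitin (compactification T) (\<lambda>n. Vertex (z n)) (Vertex rt) sequentially"
  shows "\<forall>\<^sub>F n in sequentially. z n = rt"
proof -
  have "\<forall>\<^sub>F n in sequentially. Vertex (z n) \<in> {Vertex rt}"
    using conjunct2[OF assms[unfolded limitin_def], rule_format, of "{Vertex rt}"] vertex_open[OF rt_verts] by simp
  then show ?thesis by eventually_elim simp
qed

lemma tends_to_end_unique:
  assumes "tends_to_end z \<zeta>" "tends_to_end z \<zeta>'"
  shows "\<zeta> = \<zeta>'"
proof
  fix n
  have "\<forall>\<^sub>F m in sequentially. z m \<in> sub (\<zeta> n) \<and> z m \<in> sub (\<zeta>' n)"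
    using assms by (auto simp: tends_to_end_def eventually_conj_iff)
  then obtain m where "z m \<in> sub (\<zeta> n)" "z m \<in> sub (\<zeta>' n)"
    by (auto dest: eventually_happens)
  then show "\<zeta> n = \<zeta>' n" using assms sub_lev_unique by (simp add: tends_to_end_def boundaryD)
qed

lemma tends_to_end_limitin:
  "tends_to_end z \<zeta> \<Longrightarrow> limitin (compactification T) (\<lambda>n. Vertex (z n)) (End \<zeta>) sequentially"
  by (simp add: tends_to_end_def limitin_End)

lemma limitin_tends_to_end:
  assumes z: "\<zeta> \<in> boundary T" and L: "limitin (compactification T) (\<lambda>n. Vertex (z n)) (End \<zeta>) sequentially"
  shows "tends_to_end z \<zeta>"
  unfolding tends_to_end_def
proof (intro conjI allI z)
  fix n
  have "\<forall>\<^sub>F m in sequentially. z m \<in> sub (\<zeta> (Suc n))" using L limitin_End[OF z] by simp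
  then show "\<forall>\<^sub>F m in sequentially. z m \<in> sub (\<zeta> n)"
    by eventually_elim (use sub_mono[OF z, of n "Suc n"] in auto)
qed

lemma walk_limit_End:
  assumes "tends_to_end z \<zeta>"
  shows "walk_limit T z = End \<zeta>"
proof -
  have z: "\<zeta> \<in> boundary T" using assms by (simp add: tends_to_end_def)
  have l: "End \<zeta> \<in> exit_points T \<and> limitin (compactification T) (\<lambda>n. Vertex (z n)) (End \<zeta>) sequentially"
    using z tends_to_end_limitin[OF assms] by (simp add: exit_points_def)
  have u: "l = End \<zeta>" if lim: "l \<in> exit_points T \<and> limitin (compactification T) (\<lambda>n. Vertex (z n)) l sequentially" for l
  proof -
    consider "l = Vertex rt" | \<zeta>' where "\<zeta>' \<in> boundary T" "l = End \<zeta>'" using lim by (auto simp: exit_points_def)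
    then show ?thesis
    proof cases
      case 1
      then have "\<forall>\<^sub>F n in sequentially. z n = rt" using lim limitin_Vertex_rt by blast
      moreover have "\<forall>\<^sub>F n in sequentially. z n \<in> sub (\<zeta> 1)" using assms by (simp add: tends_to_end_def)
      ultimately have "\<forall>\<^sub>F n in sequentially. rt \<in> sub (\<zeta> 1)" by eventually_elim simp
      then show ?thesis using rt_notin_sub boundaryD(6)[OF z, of 0] by simp
    next
      case 2
      then show ?thesis using tends_to_end_unique[OF assms limitin_tends_to_end] lim by simp
    qed
  qed
  have "(THE l. l \<in> exit_points T \<and> limitin (compactification T) (\<lambda>n. Vertex (z n)) l sequentially) = End \<zeta>"
    by (rule the_equality, rule l, erule u)
  moreover have "\<exists>l\<in>exit_points T. limitin (compactification T) (\<lambda>n. Vertex (z n)) l sequentially"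
    using l by (intro bexI[of _ "End \<zeta>"]) simp_all
  ultimately show ?thesis unfolding walk_limit_def by simp
qed

text \<open>Without an end the limit is either \<open>o\<close> or missing, and in the second case
  the default value is \<open>o\<close> as well.\<close>

lemma walk_limit_rt:
  assumes "\<And>\<zeta>. \<not> tends_to_end z \<zeta>"
  shows "walk_limit T z = Vertex rt"
proof (cases "\<exists>l\<in>exit_points T. limitin (compactification T) (\<lambda>n. Vertex (z n)) l sequentially")
  case True
  then obtain l where l: "l \<in> exit_points T \<and> limitin (compactification T) (\<lambda>n. Vertex (z n)) l sequentially" by auto
  have u: "l = Vertex rt" if "l \<in> exit_points T \<and> limitin (compactification T) (\<lambda>n. Vertex (z n)) l sequentially" for l
    using that assms limitin_tends_to_end by (auto simp: exit_points_def)
  have "(THE l. l \<in> exit_points T \<and> limitin (compactification T) (\<lambda>n. Vertex (z n)) l sequentially) = Vertex rt"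
    by (rule the_equality) (use l u in auto)
  then show ?thesis using True unfolding walk_limit_def by simp
qed (simp add: walk_limit_def)

lemma tends_to_end_shift: "tends_to_end (\<lambda>n. z (Suc n)) \<zeta> \<longleftrightarrow> tends_to_end z \<zeta>"
  unfolding tends_to_end_def by (simp add: eventually_sequentially_Suc[of "\<lambda>m. z m \<in> _"])

lemma walk_limit_shift: "walk_limit T (\<lambda>n. z (Suc n)) = walk_limit T z"
proof (cases "\<exists>\<zeta>. tends_to_end z \<zeta>")
  case True
  then show ?thesis using walk_limit_End tends_to_end_shift by metis
next
  case False
  then show ?thesis using walk_limit_rt tends_to_end_shift by metis
qed

text \<open>Replaces a quantifier over possibly uncountably many ends by one over finite levels, as
  measurability requires.\<close>

lemma ex_end_iff:
  "(\<exists>\<zeta>. tends_to_end z \<zeta>) \<longleftrightarrow> (\<forall>n. \<exists>v\<in>level n. \<forall>\<^sub>F m in sequentially. z m \<in> sub v)"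
proof
  assume "\<exists>\<zeta>. tends_to_end z \<zeta>"
  then obtain \<zeta> where z: "tends_to_end z \<zeta>" by auto
  show "\<forall>n. \<exists>v\<in>level n. \<forall>\<^sub>F m in sequentially. z m \<in> sub v"
  proof
    fix n
    have "\<zeta> n \<in> level n" using z by (simp add: tends_to_end_def level_def boundaryD)
    then show "\<exists>v\<in>level n. \<forall>\<^sub>F m in sequentially. z m \<in> sub v" using z by (auto simp: tends_to_end_def)
  qed
next
  assume "\<forall>n. \<exists>v\<in>level n. \<forall>\<^sub>F m in sequentially. z m \<in> sub v"
  then obtain v where v: "\<And>n. v n \<in> level n" "\<And>n. \<forall>\<^sub>F m in sequentially. z m \<in> sub (v n)" by metis
  have V: "v n \<in> verts T" "lev (v n) = n" for n using v(1)[of n] by (auto simp: level_def)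
  \<comment> \<open>The trajectory is eventually in both branches, hence also in that of
    \<open>par (v (Suc n))\<close>; branches at equal level are disjoint.\<close>
  have "v (Suc n) \<in> ch (v n)" for n
  proof -
    have nr: "v (Suc n) \<noteq> rt" using V(2)[of "Suc n"] lev_rt by auto
    have "\<forall>\<^sub>F m in sequentially. z m \<in> sub (v n) \<and> z m \<in> sub (v (Suc n))"
      using v(2) by (auto simp: eventually_conj_iff)
    then obtain m where m: "z m \<in> sub (v n)" "z m \<in> sub (v (Suc n))" by (auto dest: eventually_happens)
    have "v (Suc n) \<in> sub (par (v (Suc n)))"
    proof (rule sub_ch[of _ "par (v (Suc n))"])
      show "v (Suc n) \<in> ch (par (v (Suc n)))" using V nr by (simp add: ch_def)
      show "par (v (Suc n)) \<in> sub (par (v (Suc n)))" using V nr rpath_par_facts sub_self by simp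
    qed
    then have "z m \<in> sub (par (v (Suc n)))" using m sub_trans by blast
    moreover have "lev (par (v (Suc n))) = lev (v n)" using lev_par[OF V(1) nr] V(2)[of "Suc n"] V(2)[of n] by simp
    ultimately have "par (v (Suc n)) = v n" using m sub_lev_unique by blast
    then show ?thesis using V nr by (simp add: ch_def)
  qed
  moreover have "v 0 = rt" using v(1)[of 0] by (simp add: level_0)
  ultimately have "v \<in> boundary T" by (simp add: boundary_eq)
  then show "\<exists>\<zeta>. tends_to_end z \<zeta>" using v(2) by (auto simp: tends_to_end_def)
qed

lemma eventually_sub_measurable: "{z. \<forall>\<^sub>F m in sequentially. z m \<in> A} \<in> sets path_space"
proof -
  have "{z. \<forall>\<^sub>F m in sequentially. z m \<in> A} = (\<Union>N. \<Inter>m\<in>{N..}. {z. z m \<in> A})"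
    by (auto simp: eventually_sequentially)
  also have "\<dots> \<in> sets path_space"
    by (intro sets.countable_UN' sets.countable_INT' sets_coord) (auto simp: sets_coord)
  finally show ?thesis .
qed

lemma ex_end_measurable: "{z. \<exists>\<zeta>. tends_to_end z \<zeta>} \<in> sets path_space"
proof -
  have "{z. \<exists>\<zeta>. tends_to_end z \<zeta>} = (\<Inter>n. \<Union>v\<in>level n. {z. \<forall>\<^sub>F m in sequentially. z m \<in> sub v})"
    unfolding ex_end_iff by auto
  also have "\<dots> \<in> sets path_space"
    by (intro sets.countable_INT') (auto intro!: sets.finite_UN simp: finite_level eventually_sub_measurable)
  finally show ?thesis .
qed

lemma walk_limit_shadow:
  assumes "v \<in> verts T"
  shows "walk_limit T z \<in> End ` shadow v \<longleftrightarrow> (\<exists>\<zeta>. tends_to_end z \<zeta>) \<and> (\<forall>\<^sub>F m in sequentially. z m \<in> sub v)"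
proof (cases "\<exists>\<zeta>. tends_to_end z \<zeta>")
  case False
  then have "walk_limit T z = Vertex rt" using walk_limit_rt by blast
  then show ?thesis using False by auto
next
  case True
  then obtain \<zeta> where z: "tends_to_end z \<zeta>" by auto
  have b: "\<zeta> \<in> boundary T" using z by (simp add: tends_to_end_def)
  have "\<zeta> \<in> shadow v \<longleftrightarrow> (\<forall>\<^sub>F m in sequentially. z m \<in> sub v)"
  proof
    assume "\<zeta> \<in> shadow v"
    then have v: "\<zeta> (lev v) = v" by (simp add: shadow_def)
    have "\<forall>\<^sub>F m in sequentially. z m \<in> sub (\<zeta> (lev v))" using z by (simp add: tends_to_end_def)
    then show "\<forall>\<^sub>F m in sequentially. z m \<in> sub v" by (simp only: v)
  next
    assume "\<forall>\<^sub>F m in sequentially. z m \<in> sub v"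
    moreover have "\<forall>\<^sub>F m in sequentially. z m \<in> sub (\<zeta> (lev v))" using z by (simp add: tends_to_end_def)
    ultimately have "\<forall>\<^sub>F m in sequentially. z m \<in> sub v \<and> z m \<in> sub (\<zeta> (lev v))" by (simp add: eventually_conj_iff)
    then obtain m where "z m \<in> sub v" "z m \<in> sub (\<zeta> (lev v))" by (auto dest: eventually_happens)
    then have "\<zeta> (lev v) = v" using sub_lev_unique boundaryD(4)[OF b] by metis
    then show "\<zeta> \<in> shadow v" using b by (simp add: shadow_def)
  qed
  then show ?thesis using walk_limit_End[OF z] z by auto
qed

lemma walk_limit_exit: "walk_limit T z \<in> exit_points T"
proof (cases "\<exists>\<zeta>. tends_to_end z \<zeta>")
  case True
  then show ?thesis using walk_limit_End by (auto simp: exit_points_def tends_to_end_def)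
next
  case False
  then show ?thesis using walk_limit_rt[of z] by (auto simp: exit_points_def)
qed

lemma space_exit_borel: "space (exit_borel T) = exit_points T"
  unfolding exit_borel_def by (simp add: space_measure_of_conv)

lemma exit_open_sets:
  assumes "openin (compactification T) W"
  shows "W \<inter> exit_points T \<in> sets (exit_borel T)"
proof -
  have "openin (subtopology (compactification T) (exit_points T)) (W \<inter> exit_points T)"
    using assms by (auto simp: openin_subtopology)
  then show ?thesis unfolding exit_borel_def
    by (subst sets_measure_of) (auto dest!: openin_subset intro: sigma_sets.Basic)
qed

text \<open>The ends of an open set are covered by the arcs it contains, and arcs are indexed by the
  countable vertex set; the point \<open>o\<close> is treated separately.\<close>

lemma walk_limit_measurable: "walk_limit T \<in> measurable path_space (exit_borel T)"
  unfolding exit_borel_def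
proof (rule measurable_measure_of)
  show "{U. openin (subtopology (compactification T) (exit_points T)) U} \<subseteq> Pow (exit_points T)"
    by (auto dest!: openin_subset)
  show "walk_limit T \<in> space path_space \<rightarrow> exit_points T" using walk_limit_exit by auto
  fix U assume "U \<in> {U. openin (subtopology (compactification T) (exit_points T)) U}"
  then obtain W where W: "openin (compactification T) W" "U = W \<inter> exit_points T" by (auto simp: openin_subtopology)
  define I where "I = {v \<in> verts T. End ` shadow v \<subseteq> U}"
  have "walk_limit T -` U \<inter> space path_space = (\<Union>v\<in>I. {z. walk_limit T z \<in> End ` shadow v}) \<union>
     (if Vertex rt \<in> U then - {z. \<exists>\<zeta>. tends_to_end z \<zeta>} else {})" (is "_ = ?R")
  proof (intro equalityI subsetI)
    fix z assume "z \<in> walk_limit T -` U \<inter> space path_space"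
    then have zU: "walk_limit T z \<in> U" by simp
    show "z \<in> ?R"
    proof (cases "\<exists>\<zeta>. tends_to_end z \<zeta>")
      case True
      then obtain \<zeta> where z: "tends_to_end z \<zeta>" by auto
      have b: "\<zeta> \<in> boundary T" using z by (simp add: tends_to_end_def)
      have "End \<zeta> \<in> W" using zU W walk_limit_End[OF z] by simp
      then obtain n where n: "End ` shadow (\<zeta> (Suc n)) \<subseteq> W" using basic_nbhd[OF W(1) b] by auto
      have "End ` shadow (\<zeta> (Suc n)) \<subseteq> U" using n W(2) shadow_subset by (auto simp: exit_points_def)
      then have "\<zeta> (Suc n) \<in> I" using boundaryD(3)[OF b] by (simp add: I_def)
      moreover have "walk_limit T z \<in> End ` shadow (\<zeta> (Suc n))" using walk_limit_End[OF z] in_shadow[OF b] by auto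
      ultimately show ?thesis by blast
    next
      case False
      then show ?thesis using zU walk_limit_rt[of z] by auto
    qed
  next
    fix z assume "z \<in> ?R"
    then show "z \<in> walk_limit T -` U \<inter> space path_space"
      using walk_limit_rt[of z] by (auto simp: I_def space_PiM split: if_splits)
  qed
  moreover have "?R \<in> sets path_space"
  proof (rule sets.Un)
    have "{z. walk_limit T z \<in> End ` shadow v} \<in> sets path_space" if "v \<in> verts T" for v
      unfolding walk_limit_shadow[OF that] Collect_conj_eq
      by (intro sets.Int ex_end_measurable eventually_sub_measurable)
    moreover have "countable I" by (rule countable_subset[OF _ countable_verts]) (auto simp: I_def)
    ultimately show "(\<Union>v\<in>I. {z. walk_limit T z \<in> End ` shadow v}) \<in> sets path_space"
      by (intro sets.countable_UN') (auto simp: I_def)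
    show "(if Vertex rt \<in> U then - {z. \<exists>\<zeta>. tends_to_end z \<zeta>} else {}) \<in> sets path_space"
      using sets.compl_sets[OF ex_end_measurable] by (simp add: space_PiM Compl_eq_Diff_UNIV)
  qed
  ultimately show "walk_limit T -` U \<inter> space path_space \<in> sets path_space" by simp
qed

section \<open>Continuous boundary data and harmonicity of the Poisson integral\<close>

context
  fixes \<phi> :: "(nat \<Rightarrow> 'a) \<Rightarrow> real"
  assumes cont: "continuous_map (boundary_topology T) euclideanreal \<phi>"
begin

lemma continuous_nbhd:
  assumes "open S" "\<zeta> \<in> boundary T" "\<phi> \<zeta> \<in> S"
  shows "\<exists>n. \<forall>\<zeta>'\<in>shadow (\<zeta> (Suc n)). \<phi> \<zeta>' \<in> S"
proof -
  have "openin (boundary_topology T) {\<zeta> \<in> topspace (boundary_topology T). \<phi> \<zeta> \<in> S}"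
    by (rule openin_continuous_map_preimage[OF cont]) (use assms in simp)
  then have "openin (boundary_topology T) {\<zeta> \<in> boundary T. \<phi> \<zeta> \<in> S}" by (simp only: topspace_boundary)
  from boundary_nbhd[OF this assms(2)] assms(2,3)
  obtain n where "shadow (\<zeta> (Suc n)) \<subseteq> {\<zeta> \<in> boundary T. \<phi> \<zeta> \<in> S}" by auto
  then show ?thesis by (intro exI[of _ n]) auto
qed

text \<open>Unboundedness on an arc passes to the arc of some child, hence down to a single end,
  where it contradicts continuity.\<close>

lemma continuous_bounded: "\<exists>B. \<forall>\<zeta>\<in>boundary T. \<bar>\<phi> \<zeta>\<bar> \<le> B"
proof (rule ccontr)
  assume neg: "\<not> ?thesis"
  define Q where "Q v \<longleftrightarrow> \<not> (\<exists>B. \<forall>\<zeta>\<in>shadow v. \<bar>\<phi> \<zeta>\<bar> \<le> B)" for v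
  have "shadow rt = boundary T" using boundaryD(1) lev_rt by (auto simp: shadow_def)
  then have "Q rt" using neg by (simp add: Q_def)
  moreover have "\<exists>w\<in>ch v. Q w" if v: "v \<in> verts T" "Q v" for v
  proof (rule ccontr)
    assume "\<not> ?thesis"
    then have "\<forall>w\<in>ch v. \<exists>B. \<forall>\<zeta>\<in>shadow w. \<bar>\<phi> \<zeta>\<bar> \<le> B" by (auto simp: Q_def)
    then obtain B where B: "\<And>w \<zeta>. w \<in> ch v \<Longrightarrow> \<zeta> \<in> shadow w \<Longrightarrow> \<bar>\<phi> \<zeta>\<bar> \<le> B w" by metis
    have "\<bar>\<phi> \<zeta>\<bar> \<le> Max (B ` ch v)" if z: "\<zeta> \<in> shadow v" for \<zeta>
    proof -
      have b: "\<zeta> \<in> boundary T" "\<zeta> (lev v) = v" using z by (auto simp: shadow_def)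
      have w: "\<zeta> (Suc (lev v)) \<in> ch v" using boundaryD(2)[OF b(1), of "lev v"] b(2) by simp
      have "\<bar>\<phi> \<zeta>\<bar> \<le> B (\<zeta> (Suc (lev v)))" by (rule B[OF w in_shadow[OF b(1)]])
      also have "\<dots> \<le> Max (B ` ch v)" using w finite_ch[OF v(1)] by (intro Max_ge) auto
      finally show ?thesis .
    qed
    then show False using v(2) by (auto simp: Q_def)
  qed
  ultimately obtain \<zeta> where z: "\<zeta> \<in> boundary T" "\<And>n. Q (\<zeta> n)" using koenig[of Q] by auto
  obtain n where n: "\<forall>\<zeta>'\<in>shadow (\<zeta> (Suc n)). \<phi> \<zeta>' \<in> {\<phi> \<zeta> - 1<..<\<phi> \<zeta> + 1}"
    using continuous_nbhd[OF open_greaterThanLessThan z(1), of "\<phi> \<zeta> - 1" "\<phi> \<zeta> + 1"] by auto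
  have "\<forall>\<zeta>'\<in>shadow (\<zeta> (Suc n)). \<bar>\<phi> \<zeta>'\<bar> \<le> \<bar>\<phi> \<zeta>\<bar> + 1"
  proof
    fix \<zeta>' assume "\<zeta>' \<in> shadow (\<zeta> (Suc n))"
    then have "\<phi> \<zeta>' \<in> {\<phi> \<zeta> - 1<..<\<phi> \<zeta> + 1}" using n by blast
    then show "\<bar>\<phi> \<zeta>'\<bar> \<le> \<bar>\<phi> \<zeta>\<bar> + 1" by auto
  qed
  then show False using z(2)[of "Suc n"] by (auto simp: Q_def)
qed

text \<open>Extension of \<phi> by 0 to \<open>o\<close>, so that the set integral in
  \<open>poisson_integral\<close> becomes an ordinary expectation.\<close>

definition exit_fun :: "'a compact_point \<Rightarrow> real" where
  "exit_fun p = indicator (End ` boundary T) p * \<phi> (geodesic p)"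

definition exit_value :: "(nat \<Rightarrow> 'a) \<Rightarrow> real" where
  "exit_value z = exit_fun (walk_limit T z)"

lemma exit_fun_measurable: "exit_fun \<in> borel_measurable (exit_borel T)"
proof (rule borel_measurableI)
  fix S :: "real set" assume S: "open S"
  let ?f = exit_fun
  note exit_fun_def [simp]
  \<comment> \<open>Whole branches are taken to make the set open. Their vertices drop out:
    \<open>o\<close> is the only vertex among the exit points and lies in no \<open>sub v\<close>
    with \<open>v \<noteq> rt\<close>.\<close>
  let ?W = "\<Union>v\<in>{v \<in> verts T - {rt}. \<forall>\<zeta>\<in>shadow v. \<phi> \<zeta> \<in> S}. Vertex ` sub v \<union> End ` shadow v"
  have "openin (compactification T) ?W" using basic_open by (intro openin_Union) auto
  then have 1: "?W \<inter> exit_points T \<in> sets (exit_borel T)" by (rule exit_open_sets)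
  have 2: "{Vertex rt} \<inter> exit_points T \<in> sets (exit_borel T)" by (rule exit_open_sets[OF vertex_open[OF rt_verts]])
  have "?f -` S \<inter> space (exit_borel T) = (?W \<inter> exit_points T) \<union> (if 0 \<in> S then {Vertex rt} \<inter> exit_points T else {})"
  proof (intro equalityI subsetI)
    fix p assume "p \<in> ?f -` S \<inter> space (exit_borel T)"
    then have p: "?f p \<in> S" "p \<in> exit_points T" by (auto simp: space_exit_borel)
    show "p \<in> (?W \<inter> exit_points T) \<union> (if 0 \<in> S then {Vertex rt} \<inter> exit_points T else {})"
    proof (cases "p = Vertex rt")
      case True
      moreover have "Vertex rt \<notin> End ` boundary T" by auto
      ultimately show ?thesis using p by simp
    next
      case False
      then obtain \<zeta> where z: "p = End \<zeta>" "\<zeta> \<in> boundary T" using p(2) by (auto simp: exit_points_def)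
      then have "\<phi> \<zeta> \<in> S" using p(1) by simp
      then obtain n where "\<forall>\<zeta>'\<in>shadow (\<zeta> (Suc n)). \<phi> \<zeta>' \<in> S" using continuous_nbhd[OF S z(2)] by blast
      then have "p \<in> ?W" using z in_shadow[OF z(2), of "Suc n"] boundaryD[OF z(2)]
        by (intro UN_I[of "\<zeta> (Suc n)"]) auto
      then show ?thesis using p(2) by simp
    qed
  next
    fix p assume p: "p \<in> (?W \<inter> exit_points T) \<union> (if 0 \<in> S then {Vertex rt} \<inter> exit_points T else {})"
    then show "p \<in> ?f -` S \<inter> space (exit_borel T)"
    proof
      assume "p \<in> ?W \<inter> exit_points T"
      then obtain v where v: "v \<in> verts T - {rt}" "\<forall>\<zeta>\<in>shadow v. \<phi> \<zeta> \<in> S" "p \<in> Vertex ` sub v \<union> End ` shadow v" "p \<in> exit_points T"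
        by auto
      have "p \<notin> Vertex ` sub v" using v rt_notin_sub[of v] by (auto simp: exit_points_def)
      then obtain \<zeta> where "p = End \<zeta>" "\<zeta> \<in> shadow v" using v by auto
      moreover have "End \<zeta> \<in> End ` boundary T" using calculation shadow_subset by blast
      ultimately show ?thesis using v by (simp add: space_exit_borel)
    next
      assume "p \<in> (if 0 \<in> S then {Vertex rt} \<inter> exit_points T else {})"
      then show ?thesis by (auto simp: space_exit_borel indicator_def split: if_splits)
    qed
  qed
  also have "\<dots> \<in> sets (exit_borel T)" using 1 2 by auto
  finally show "?f -` S \<inter> space (exit_borel T) \<in> sets (exit_borel T)" .
qed

lemma exit_value_measurable: "exit_value \<in> borel_measurable path_space"
proof -
  have "exit_value = (\<lambda>z. exit_fun (walk_limit T z))" by (simp add: exit_value_def fun_eq_iff)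
  then show ?thesis using measurable_compose[OF walk_limit_measurable exit_fun_measurable] by simp
qed

lemma poisson_integral_eq: "poisson_integral T \<phi> x = (\<integral>z. exit_value z \<partial>walk_law T x)"
proof -
  have "poisson_integral T \<phi> x = (\<integral>p. exit_fun p \<partial>distr (walk_law T x) (exit_borel T) (walk_limit T))"
    unfolding poisson_integral_def set_lebesgue_integral_def harmonic_measure_def exit_fun_def by simp
  also have "\<dots> = (\<integral>z. exit_fun (walk_limit T z) \<partial>walk_law T x)"
    by (rule integral_distr[OF measurable_walk_law[OF walk_limit_measurable] exit_fun_measurable])
  finally show ?thesis by (simp only: exit_value_def)
qed

lemma exit_value_shift: "exit_value (\<lambda>n. z (Suc n)) = exit_value z"
  unfolding exit_value_def by (rule arg_cong[where f = exit_fun, OF walk_limit_shift])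

lemma exit_value_bounded: "\<exists>B\<ge>0. \<forall>z. \<bar>exit_value z\<bar> \<le> B"
proof -
  obtain B where B: "\<forall>\<zeta>\<in>boundary T. \<bar>\<phi> \<zeta>\<bar> \<le> B" using continuous_bounded by auto
  have "\<bar>exit_value z\<bar> \<le> max B 0" for z
  proof (cases "walk_limit T z \<in> End ` boundary T")
    case True
    then obtain \<zeta> where "walk_limit T z = End \<zeta>" "\<zeta> \<in> boundary T" by auto
    then show ?thesis using bspec[OF B] by (simp add: exit_value_def exit_fun_def le_max_iff_disj)
  qed (simp add: exit_value_def exit_fun_def)
  then show ?thesis by (intro exI[of _ "max B 0"]) auto
qed

lemma poisson_harmonic:
  assumes "x \<in> verts T" "x \<noteq> rt"
  shows "laplacian T (poisson_integral T \<phi>) x = 0"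
proof -
  obtain B where B: "\<And>z. \<bar>exit_value z\<bar> \<le> B" using exit_value_bounded by auto
  show ?thesis
    using integral_walk_step[OF assms exit_value_measurable B exit_value_shift]
    by (simp add: laplacian_def poisson_integral_eq sum_subtractf)
qed

end

end

section \<open>Exit probabilities\<close>

context rooted_tree
begin

section \<open>Supermartingale bounds and transience\<close>

lemma nn_integral_walk_step:
  assumes "y \<in> verts T" "y \<noteq> rt" "\<And>u. 0 \<le> g u"
  shows "(\<integral>\<^sup>+u. ennreal (g u) \<partial>walk_step T y) = ennreal ((\<Sum>u\<in>nbrs T y. g u) / real (card (nbrs T y)))"
proof -
  have c: "0 < card (nbrs T y)" using nbrs_nonempty[OF assms(1)] locally_finite[OF assms(1)] by (simp add: card_gt_0_iff)
  have "(\<integral>\<^sup>+u. ennreal (g u) \<partial>walk_step T y) = (\<Sum>u\<in>nbrs T y. ennreal (g u)) / ennreal (real (card (nbrs T y)))"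
    using assms nbrs_nonempty[OF assms(1)] locally_finite[OF assms(1)]
    by (simp add: walk_step_def nn_integral_pmf_of_set ennreal_of_nat_eq_real_of_nat)
  also have "\<dots> = ennreal ((\<Sum>u\<in>nbrs T y. g u) / real (card (nbrs T y)))"
    using c assms(3) by (simp add: sum_ennreal divide_ennreal sum_nonneg)
  finally show ?thesis .
qed

text \<open>Here \<open>e\<close> bounds the loss of expectation of \<open>g\<close> per step from
  below, and the losses telescope. With \<open>e\<close> supported at a vertex it counts visits;
  with \<open>e = 0\<close> it is the supermartingale inequality. The walk rests at
  \<open>o\<close>, whence \<open>e rt = 0\<close>.\<close>

lemma supermartingale_sum:
  assumes x: "x \<in> verts T" and g: "\<And>u. 0 \<le> g u" and e: "\<And>u. 0 \<le> e u" "e rt = 0"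
    and super: "\<And>y. y \<in> verts T \<Longrightarrow> y \<noteq> rt \<Longrightarrow>
      (\<Sum>u\<in>nbrs T y. g u) / real (card (nbrs T y)) + e y \<le> g y"
  shows "(\<integral>\<^sup>+u. ennreal (g u) \<partial>walk_pmf T x N) + (\<Sum>n<N. \<integral>\<^sup>+u. ennreal (e u) \<partial>walk_pmf T x n) \<le> ennreal (g x)"
proof (induction N)
  case 0
  then show ?case by simp
next
  case (Suc N)
  have "(\<integral>\<^sup>+u. ennreal (g u) \<partial>walk_pmf T x (Suc N)) + (\<integral>\<^sup>+u. ennreal (e u) \<partial>walk_pmf T x N) =
     (\<integral>\<^sup>+y. ((\<integral>\<^sup>+u. ennreal (g u) \<partial>walk_step T y) + ennreal (e y)) \<partial>walk_pmf T x N)"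
    by (simp add: nn_integral_add)
  also have "\<dots> \<le> (\<integral>\<^sup>+y. ennreal (g y) \<partial>walk_pmf T x N)"
  proof (rule nn_integral_mono_AE, rule AE_pmfI)
    fix y assume "y \<in> set_pmf (walk_pmf T x N)"
    then have y: "y \<in> verts T" using set_walk_pmf[OF x] by auto
    show "(\<integral>\<^sup>+u. ennreal (g u) \<partial>walk_step T y) + ennreal (e y) \<le> ennreal (g y)"
    proof (cases "y = rt")
      case True
      then show ?thesis by (simp add: walk_step_def e g)
    next
      case False
      have "0 \<le> (\<Sum>u\<in>nbrs T y. g u) / real (card (nbrs T y))" using g by (simp add: sum_nonneg)
      then show ?thesis unfolding nn_integral_walk_step[OF y False g]
        using super[OF y False] e(1)[of y] by (simp add: ennreal_plus[symmetric] ennreal_leI del: ennreal_plus)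
    qed
  qed
  finally have "(\<integral>\<^sup>+u. ennreal (g u) \<partial>walk_pmf T x (Suc N)) + (\<integral>\<^sup>+u. ennreal (e u) \<partial>walk_pmf T x N) +
      (\<Sum>n<N. \<integral>\<^sup>+u. ennreal (e u) \<partial>walk_pmf T x n)
    \<le> (\<integral>\<^sup>+u. ennreal (g u) \<partial>walk_pmf T x N) + (\<Sum>n<N. \<integral>\<^sup>+u. ennreal (e u) \<partial>walk_pmf T x n)"
    by (rule add_right_mono)
  also have "\<dots> \<le> ennreal (g x)" by (rule Suc.IH)
  finally show ?case by (simp add: ac_simps del: walk_pmf.simps)
qed

text \<open>The distance from \<open>o\<close> at which the geodesics to \<open>v\<close> and to \<open>y\<close> separate. Off \<open>o\<close> its Laplacian is
  \<open>-1\<close> at \<open>v\<close> and \<open>0\<close> elsewhere, so it bounds the expected number of visits to \<open>v\<close>, up to the degree.\<close>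

definition green :: "'a \<Rightarrow> 'a \<Rightarrow> real" where
  "green v y = real (card (set (rpath v) \<inter> set (rpath y) - {rt}))"

lemma green_par:
  assumes "y \<in> verts T" "y \<noteq> rt"
  shows "green v y = green v (par y) + (if y \<in> set (rpath v) then 1 else 0)"
proof -
  note f = rpath_set_par[OF assms]
  show ?thesis
  proof (cases "y \<in> set (rpath v)")
    case True
    then have "set (rpath v) \<inter> set (rpath y) - {rt} = insert y (set (rpath v) \<inter> set (rpath (par y)) - {rt})"
      using f assms by auto
    then show ?thesis using True f by (simp add: green_def)
  next
    case False
    then have "set (rpath v) \<inter> set (rpath y) - {rt} = set (rpath v) \<inter> set (rpath (par y)) - {rt}"
      using f by auto
    then show ?thesis using False by (simp add: green_def)
  qed
qed

text \<open>At a vertex on the geodesic to \<open>v\<close> the parent's value is smaller by 1,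
  compensated by the one child on the geodesic except at \<open>v\<close> itself; off the geodesic
  nothing changes.\<close>

lemma green_super:
  assumes v: "v \<in> verts T" and y: "y \<in> verts T" "y \<noteq> rt"
  shows "(\<Sum>u\<in>nbrs T y. green v u) + (if y = v then 1 else 0) \<le> real (card (nbrs T y)) * green v y"
proof -
  let ?b = "\<lambda>u. if u \<in> set (rpath v) then (1::real) else 0"
  have "(\<Sum>u\<in>ch y. green v u) = (\<Sum>u\<in>ch y. green v y + ?b u)"
    by (rule sum.cong) (use green_par chD in auto)
  also have "\<dots> = real (card (ch y)) * green v y + real (card (ch y \<inter> set (rpath v)))"
    using finite_ch[OF y(1)] by (simp add: sum.distrib sum.If_cases Int_def)
  finally have ch: "(\<Sum>u\<in>ch y. green v u) = real (card (ch y)) * green v y + real (card (ch y \<inter> set (rpath v)))" .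
  have key: "real (card (ch y \<inter> set (rpath v))) + (if y = v then 1 else 0) \<le> ?b y"
  proof (cases "ch y \<inter> set (rpath v) = {}")
    case True
    then show ?thesis using self_in_rpath[OF v] by auto
  next
    case False
    then obtain w where w: "w \<in> ch y" "w \<in> set (rpath v)" by auto
    have vw: "v \<in> sub w" using w v by (simp add: sub_def)
    have wy: "w \<in> sub y" by (rule sub_ch[OF w(1) sub_self[OF y(1)]])
    have "v \<in> sub y" using sub_trans[OF vw wy] .
    then have 1: "y \<in> set (rpath v)" by (simp add: sub_def)
    have 2: "y \<noteq> v" using sub_lev_le[OF vw] lev_ch[OF w(1)] by auto
    have "ch y \<inter> set (rpath v) \<subseteq> {w}"
    proof
      fix u assume u: "u \<in> ch y \<inter> set (rpath v)"
      then have "v \<in> sub u" using v by (simp add: sub_def)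
      then show "u \<in> {w}" using sub_lev_unique[OF _ vw] lev_ch[OF w(1)] lev_ch[of u y] u by auto
    qed
    then have "card (ch y \<inter> set (rpath v)) \<le> 1" using card_mono[of "{w}"] by fastforce
    then show ?thesis using 1 2 by simp
  qed
  have "(\<Sum>u\<in>nbrs T y. green v u) = green v (par y) + (\<Sum>u\<in>ch y. green v u)"
    unfolding nbrs_eq[OF y] using par_notin_ch[OF y] finite_ch[OF y(1)] by simp
  moreover have "real (card (nbrs T y)) = 1 + real (card (ch y))"
    unfolding nbrs_eq[OF y] using par_notin_ch[OF y] finite_ch[OF y(1)] by simp
  ultimately show ?thesis using ch key green_par[OF y, of v] by (simp add: algebra_simps)
qed

text \<open>The visit probabilities, divided by the degree of \<open>v\<close>, have partial sums at
  most \<open>green v x\<close>; Borel-Cantelli finishes.\<close>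

lemma AE_finite_visits:
  assumes x: "x \<in> verts T" and v: "v \<in> verts T" "v \<noteq> rt"
  shows "AE z in walk_law T x. \<forall>\<^sub>F n in sequentially. z n \<noteq> v"
proof -
  let ?c = "real (card (nbrs T v))"
  define e where "e u = (if u = v then 1 / ?c else 0)" for u
  have c: "0 < ?c" using nbrs_nonempty[OF v(1)] locally_finite[OF v(1)] by (simp add: card_gt_0_iff)
  have super: "(\<Sum>u\<in>nbrs T y. green v u) / real (card (nbrs T y)) + e y \<le> green v y" if y: "y \<in> verts T" "y \<noteq> rt" for y
  proof -
    have cy: "0 < real (card (nbrs T y))" using nbrs_nonempty[OF y(1)] locally_finite[OF y(1)] by (simp add: card_gt_0_iff)
    have "(\<Sum>u\<in>nbrs T y. green v u) / real (card (nbrs T y)) + e y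
       = ((\<Sum>u\<in>nbrs T y. green v u) + (if y = v then 1 else 0)) / real (card (nbrs T y))"
      by (simp add: e_def add_divide_distrib)
    also have "\<dots> \<le> green v y" using green_super[OF v(1) y] cy by (simp add: field_simps)
    finally show ?thesis .
  qed
  have int_e: "(\<integral>\<^sup>+u. ennreal (e u) \<partial>walk_pmf T x n) = ennreal (pmf (walk_pmf T x n) v / ?c)" for n
  proof -
    have "(\<integral>\<^sup>+u. ennreal (e u) \<partial>walk_pmf T x n) = (\<integral>\<^sup>+u. ennreal (1 / ?c) * indicator {v} u \<partial>walk_pmf T x n)"
      by (rule nn_integral_cong) (simp add: e_def split: split_indicator)
    also have "\<dots> = ennreal (1 / ?c) * ennreal (pmf (walk_pmf T x n) v)"
      by (subst nn_integral_cmult_indicator) (simp_all add: emeasure_pmf_single)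
    also have "\<dots> = ennreal (pmf (walk_pmf T x n) v / ?c)" using c by (simp add: ennreal_mult[symmetric])
    finally show ?thesis .
  qed
  have bound: "(\<Sum>n<N. pmf (walk_pmf T x n) v / ?c) \<le> green v x" for N
  proof -
    have "ennreal (\<Sum>n<N. pmf (walk_pmf T x n) v / ?c) = (\<Sum>n<N. \<integral>\<^sup>+u. ennreal (e u) \<partial>walk_pmf T x n)"
      unfolding int_e using c by (simp add: sum_ennreal)
    also have "\<dots> \<le> (\<integral>\<^sup>+u. ennreal (green v u) \<partial>walk_pmf T x N) + (\<Sum>n<N. \<integral>\<^sup>+u. ennreal (e u) \<partial>walk_pmf T x n)"
      by simp
    also have "\<dots> \<le> ennreal (green v x)"
      by (rule supermartingale_sum[OF x _ _ _ super]) (use v c in \<open>auto simp: green_def e_def\<close>)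
    finally show ?thesis by (simp add: green_def)
  qed
  have m: "measure (walk_law T x) {z. z n = v} = pmf (walk_pmf T x n) v" for n
    using emeasure_walk_law[of T x n "{v}"] by (simp add: measure_def emeasure_pmf_single)
  have "summable (\<lambda>n. pmf (walk_pmf T x n) v / ?c)"
    by (rule bounded_imp_summable[of _ "green v x"]) (use c bound[of "Suc _"] in \<open>simp_all add: lessThan_Suc_atMost\<close>)
  then have summ: "summable (\<lambda>n. measure (walk_law T x) {z. z n = v})"
    unfolding m using c by (simp add: summable_divide_iff)
  have s: "{z. z n = v} \<in> sets (walk_law T x)" for n
    using sets_coord[of n "{v}"] by (simp add: sets_walk_law)
  have "AE z in walk_law T x. \<forall>\<^sub>F n in sequentially. z \<in> space (walk_law T x) - {z. z n = v}"
  proof (rule borel_cantelli_AE1[OF s _ summ])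
    interpret prob_space "walk_law T x" by (rule prob_space_walk_law)
    show "emeasure (walk_law T x) {z. z n = v} < \<infinity>" for n by (simp add: less_top[symmetric])
  qed
  then show ?thesis by simp
qed

text \<open>A purely deterministic statement: after its last visit to \<open>u\<close>, a trajectory
  that enters \<open>sub u\<close> remains there. So it settles in one branch per level, which
  determines an end.\<close>

lemma transient_path_limit:
  assumes zv: "\<And>n. z n \<in> verts T" and step: "\<And>n. z (Suc n) \<in> set_pmf (walk_step T (z n))"
    and fin: "\<And>u. u \<in> verts T \<Longrightarrow> u \<noteq> rt \<Longrightarrow> \<forall>\<^sub>F n in sequentially. z n \<noteq> u"
    and v: "v \<in> verts T" "v \<noteq> rt" and freq: "\<not> (\<forall>\<^sub>F n in sequentially. z n \<notin> sub v)"
  shows "walk_limit T z \<in> End ` shadow v"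
proof -
  \<comment> \<open>A visit to \<open>o\<close> would be final, contradicting infinitely many visits
    to \<open>sub v\<close>.\<close>
  have nrt: "z n \<noteq> rt" for n
  proof
    assume n: "z n = rt"
    have "z m = rt" if "n \<le> m" for m
      using that
    proof (induction m rule: dec_induct)
      case (step m)
      then show ?case using assms(2)[of m] set_walk_step[OF rt_verts] by auto
    qed (rule n)
    then have "\<forall>\<^sub>F m in sequentially. z m \<notin> sub v"
      using rt_notin_sub[OF v(2)] unfolding eventually_sequentially by (intro exI[of _ n]) simp
    then show False using freq by simp
  qed
  have fin': "\<forall>\<^sub>F n in sequentially. z n \<noteq> u" if "u \<in> verts T" for u
    using fin[OF that] nrt by (cases "u = rt") auto
  have nb: "z (Suc n) = par (z n) \<or> z (Suc n) \<in> ch (z n)" for n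
    using step[of n] set_walk_step[OF zv[of n]] nbrs_eq[OF zv nrt] nrt[of n] by auto
  have stay: "\<forall>\<^sub>F n in sequentially. z n \<in> sub u"
    if u: "u \<in> verts T" and fr: "\<not> (\<forall>\<^sub>F n in sequentially. z n \<notin> sub u)" for u
  proof -
    obtain N where N: "\<And>n. n \<ge> N \<Longrightarrow> z n \<noteq> u" using fin'[OF u] by (auto simp: eventually_sequentially)
    obtain n0 where n0: "n0 \<ge> N" "z n0 \<in> sub u" using fr by (auto simp: eventually_sequentially)
    have "z m \<in> sub u" if "n0 \<le> m" for m
      using that
    proof (induction m rule: dec_induct)
      case (step m)
      then have "z m \<noteq> u" using N n0 by auto
      then have "par (z m) \<in> sub u" using sub_par[OF zv nrt] step by blast
      then show ?case using nb[of m] sub_ch step by metis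
    qed (rule n0)
    then show ?thesis by (auto simp: eventually_sequentially)
  qed
  define Q where "Q u \<longleftrightarrow> (\<forall>\<^sub>F n in sequentially. z n \<in> sub u)" for u
  have "Q rt" by (simp add: Q_def sub_rt zv)
  moreover have "\<exists>w\<in>ch u. Q w" if u: "u \<in> verts T" "Q u" for u
  proof (rule ccontr)
    assume "\<not> ?thesis"
    then have "\<forall>w\<in>ch u. \<forall>\<^sub>F n in sequentially. z n \<notin> sub w"
      using stay chD unfolding Q_def by blast
    then have "\<forall>\<^sub>F n in sequentially. \<forall>w\<in>ch u. z n \<notin> sub w"
      by (rule eventually_ball_finite[OF finite_ch[OF u(1)]])
    moreover have "\<forall>\<^sub>F n in sequentially. z n \<in> sub u" using u(2) by (simp add: Q_def)
    moreover note fin'[OF u(1)]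
    ultimately have "\<forall>\<^sub>F n in sequentially. False" by eventually_elim (use sub_split in blast)
    then show False by simp
  qed
  ultimately obtain \<zeta> where z: "\<zeta> \<in> boundary T" "\<And>n. Q (\<zeta> n)" using koenig[of Q] by auto
  then have "tends_to_end z \<zeta>" by (simp add: tends_to_end_def Q_def)
  then show ?thesis unfolding walk_limit_shadow[OF v(1)] using stay[OF v(1) freq] by blast
qed

lemma AE_walk_limit:
  assumes x: "x \<in> verts T" and v: "v \<in> verts T" "v \<noteq> rt"
  shows "AE z in walk_law T x. walk_limit T z \<in> End ` shadow v \<or> (\<forall>\<^sub>F n in sequentially. z n \<notin> sub v)"
proof -
  have "countable (verts T - {rt})" using countable_verts by simp
  then have "AE z in walk_law T x. \<forall>u\<in>verts T - {rt}. \<forall>\<^sub>F n in sequentially. z n \<noteq> u"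
    using AE_finite_visits[OF x] by (simp add: AE_ball_countable)
  then show ?thesis using AE_walk_verts[OF x] AE_walk_step[OF x]
  proof eventually_elim
    case (elim z)
    then show ?case using transient_path_limit[of z v] v by auto
  qed
qed

text \<open>A superharmonic majorant of the probability, seen from \<open>y\<close>, of exiting outside the boundary
  arc below \<open>v\<close>.\<close>

definition barrier :: "'a \<Rightarrow> 'a \<Rightarrow> real" where
  "barrier v y = (if y \<in> sub v then min 1 (surv cap y / surv cap (par v)) else 1)"

lemma barrier_bounds: "0 \<le> barrier v y" "barrier v y \<le> 1"
  using surv_cap_pos[of y] surv_cap_pos[of "par v"] by (auto simp: barrier_def)

text \<open>Where the barrier is 1 it is maximal. Elsewhere the harmonic ratio dominates it at all
  neighbours: the only one outside the branch is \<open>par v\<close>, reached from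
  \<open>v\<close>, where the ratio is exactly 1.\<close>

lemma barrier_super:
  assumes v: "v \<in> verts T" "v \<noteq> rt" and y: "y \<in> verts T" "y \<noteq> rt"
  shows "(\<Sum>u\<in>nbrs T y. barrier v u) / real (card (nbrs T y)) \<le> barrier v y"
proof -
  let ?c = "real (card (nbrs T y))" and ?p = "surv cap (par v)"
  have c: "0 < ?c" using nbrs_nonempty[OF y(1)] locally_finite[OF y(1)] by (simp add: card_gt_0_iff)
  have p: "0 < ?p" by (rule surv_cap_pos)
  show ?thesis
  proof (cases "barrier v y = 1")
    case True
    have "(\<Sum>u\<in>nbrs T y. barrier v u) \<le> (\<Sum>u\<in>nbrs T y. 1)" by (intro sum_mono barrier_bounds)
    then show ?thesis using True c by (simp add: field_simps)
  next
    case False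
    then have ys: "y \<in> sub v" and bary: "barrier v y = surv cap y / ?p" by (auto simp: barrier_def min_def split: if_splits)
    have "barrier v u \<le> surv cap u / ?p" if u: "u \<in> nbrs T y" for u
    proof (cases "u \<in> sub v")
      case True
      then show ?thesis by (simp add: barrier_def)
    next
      case False
      have "u = par y \<or> u \<in> ch y" using u nbrs_eq[OF y] by auto
      then have uy: "u = par y" using False sub_ch[OF _ ys] by blast
      then have "y = v" using False ys sub_par[OF y, of v] by blast
      then show ?thesis using uy p by (simp add: barrier_def)
    qed
    then have "(\<Sum>u\<in>nbrs T y. barrier v u) \<le> (\<Sum>u\<in>nbrs T y. surv cap u / ?p)" by (intro sum_mono)
    also have "\<dots> = ?c * surv cap y / ?p"
      using surv_cap_harmonic[OF y] by (simp add: sum_divide_distrib[symmetric])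
    finally show ?thesis using bary c by (simp add: field_simps)
  qed
qed

lemma exit_elsewhere_measurable:
  assumes "v \<in> verts T"
  shows "{z. walk_limit T z \<notin> End ` shadow v} \<in> sets (walk_law T x)"
proof -
  have "{z. walk_limit T z \<in> End ` shadow v} \<in> sets path_space"
    unfolding walk_limit_shadow[OF assms] Collect_conj_eq
    by (intro sets.Int ex_end_measurable eventually_sub_measurable)
  from sets.compl_sets[OF this] show ?thesis
    by (simp add: sets_walk_law space_PiM set_diff_eq)
qed

text \<open>Trajectories not ending in the arc are almost surely outside the branch from some time
  on, where the barrier is 1. Fatou's lemma and the supermartingale inequality carry this back to
  time 0.\<close>

lemma exit_elsewhere_le:
  assumes x: "x \<in> verts T" and v: "v \<in> verts T" "v \<noteq> rt"
  shows "measure (walk_law T x) {z. walk_limit T z \<notin> End ` shadow v} \<le> barrier v x"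
proof -
  let ?E = "{z. walk_limit T z \<notin> End ` shadow v}"
  interpret prob_space "walk_law T x" by (rule prob_space_walk_law)
  have E: "?E \<in> sets (walk_law T x)" by (rule exit_elsewhere_measurable[OF v(1)])
  have le: "(\<integral>\<^sup>+z. ennreal (barrier v (z n)) \<partial>walk_law T x) \<le> ennreal (barrier v x)" for n
    using supermartingale_sum[OF x, of "barrier v" "\<lambda>_. 0" n] barrier_super[OF v] barrier_bounds
    by (simp add: nn_integral_walk_law[where g = "\<lambda>u. ennreal (barrier v u)"])
  have "emeasure (walk_law T x) ?E = (\<integral>\<^sup>+z. indicator ?E z \<partial>walk_law T x)" using E by simp
  also have "\<dots> \<le> (\<integral>\<^sup>+z. liminf (\<lambda>n. ennreal (barrier v (z n))) \<partial>walk_law T x)"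
  proof (rule nn_integral_mono_AE)
    show "AE z in walk_law T x. indicator ?E z \<le> liminf (\<lambda>n. ennreal (barrier v (z n)))"
      using AE_walk_limit[OF x v]
    proof eventually_elim
      case (elim z)
      show ?case
      proof (cases "z \<in> ?E")
        case True
        then have "\<forall>\<^sub>F n in sequentially. z n \<notin> sub v" using elim by simp
        then have "\<forall>\<^sub>F n in sequentially. 1 \<le> ennreal (barrier v (z n))"
          by eventually_elim (simp add: barrier_def)
        then have "1 \<le> liminf (\<lambda>n. ennreal (barrier v (z n)))" by (rule Liminf_bounded)
        then show ?thesis using True by simp
      qed simp
    qed
  qed
  also have "\<dots> \<le> liminf (\<lambda>n. \<integral>\<^sup>+z. ennreal (barrier v (z n)) \<partial>walk_law T x)"
    by (rule nn_integral_liminf) (rule measurable_walk_law, rule measurable_compose[OF measurable_coord], simp)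
  also have "\<dots> \<le> liminf (\<lambda>n. ennreal (barrier v x))"
    by (rule Liminf_mono) (simp add: le)
  finally have "emeasure (walk_law T x) ?E \<le> ennreal (barrier v x)" by (simp add: Liminf_const)
  then show ?thesis using barrier_bounds[of v x] by (simp add: emeasure_eq_measure)
qed

lemma poisson_radial_limit:
  assumes cont: "continuous_map (boundary_topology T) euclideanreal \<phi>" and reg: "regular_point T \<zeta>"
  shows "(\<lambda>j. poisson_integral T \<phi> (\<zeta> j)) \<longlonglongrightarrow> \<phi> \<zeta>"
proof (rule LIMSEQ_I)
  fix r :: real assume r: "0 < r"
  note z = regular_surv_tendsto(1)[OF reg] and lim = regular_surv_tendsto(2)[OF reg]
  let ?G = "exit_value \<phi>"
  obtain B where B: "0 \<le> B" "\<And>z. \<bar>?G z\<bar> \<le> B" using exit_value_bounded[OF cont] by auto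
  \<comment> \<open>Bounds the deviation from \<open>\<phi> \<zeta>\<close> on every trajectory,
    also where the exit value is 0; the summand 1 makes it positive in all cases.\<close>
  let ?D = "B + \<bar>\<phi> \<zeta>\<bar> + 1"
  have D: "0 < ?D" using B(1) by simp
  \<comment> \<open>\<open>k\<close> is fixed by continuity before \<open>j\<close> grows, so the
    denominator \<open>?p\<close> does not move in the limit.\<close>
  obtain k where k: "\<forall>\<zeta>'\<in>shadow (\<zeta> (Suc k)). \<phi> \<zeta>' \<in> {\<phi> \<zeta> - r / 2<..<\<phi> \<zeta> + r / 2}"
    using continuous_nbhd[OF cont open_greaterThanLessThan z, of "\<phi> \<zeta> - r / 2" "\<phi> \<zeta> + r / 2"] r by auto
  let ?v = "\<zeta> (Suc k)" and ?p = "surv cap (\<zeta> k)"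
  have v: "?v \<in> verts T" "?v \<noteq> rt" "par ?v = \<zeta> k" using boundaryD[OF z] by auto
  have p: "0 < ?p" by (rule surv_cap_pos)
  have est: "\<bar>poisson_integral T \<phi> (\<zeta> j) - \<phi> \<zeta>\<bar> \<le> r / 2 + ?D * (surv cap (\<zeta> j) / ?p)" if j: "Suc k \<le> j" for j
  proof -
    let ?P = "walk_law T (\<zeta> j)" and ?E = "{z. walk_limit T z \<notin> End ` shadow ?v}"
    interpret P: prob_space ?P by (rule prob_space_walk_law)
    have E: "?E \<in> sets ?P" by (rule exit_elsewhere_measurable[OF v(1)])
    have mG: "?G \<in> borel_measurable ?P" by (rule measurable_walk_law[OF exit_value_measurable[OF cont]])
    have iG: "integrable ?P ?G" by (rule P.integrable_const_bound[of _ B]) (use B mG in auto)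
    have iE: "integrable ?P (\<lambda>z. r / 2 + ?D * indicator ?E z)"
      by (rule P.integrable_const_bound[of _ "r / 2 + ?D"]) (use r D E in \<open>auto split: split_indicator\<close>)
    have pw: "\<bar>?G z - \<phi> \<zeta>\<bar> \<le> r / 2 + ?D * indicator ?E z" for z
    proof (cases "z \<in> ?E")
      case True
      then show ?thesis using B(2)[of z] r by (simp add: abs_le_iff) linarith
    next
      case False
      then obtain \<zeta>' where z': "walk_limit T z = End \<zeta>'" "\<zeta>' \<in> shadow ?v" by auto
      have "End \<zeta>' \<in> End ` boundary T" using z'(2) shadow_subset by blast
      then have "?G z = \<phi> \<zeta>'"
        by (simp add: exit_value_def[OF cont] exit_fun_def[OF cont] z'(1))
      moreover have "\<bar>\<phi> \<zeta>' - \<phi> \<zeta>\<bar> \<le> r / 2"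
        unfolding abs_le_iff using bspec[OF k z'(2)] by (intro conjI) simp_all
      ultimately show ?thesis using False by simp
    qed
    have "\<bar>poisson_integral T \<phi> (\<zeta> j) - \<phi> \<zeta>\<bar> = \<bar>\<integral>z. ?G z - \<phi> \<zeta> \<partial>?P\<bar>"
      unfolding poisson_integral_eq[OF cont] using iG P.prob_space by simp
    also have "\<dots> \<le> (\<integral>z. \<bar>?G z - \<phi> \<zeta>\<bar> \<partial>?P)" by (rule integral_abs_bound)
    also have "\<dots> \<le> (\<integral>z. r / 2 + ?D * indicator ?E z \<partial>?P)"
      by (rule integral_mono) (use iG iE pw in auto)
    also have "\<dots> = r / 2 + ?D * measure ?P ?E"
    proof -
      have "integrable ?P (indicator ?E :: _ \<Rightarrow> real)"
        by (rule integrable_real_indicator[OF E]) (simp add: less_top[symmetric])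
      then show ?thesis using P.prob_space by (simp add: Bochner_Integration.integral_add)
    qed
    also have "\<dots> \<le> r / 2 + ?D * (surv cap (\<zeta> j) / ?p)"
    proof (intro add_left_mono mult_left_mono)
      have "measure ?P ?E \<le> barrier ?v (\<zeta> j)" by (rule exit_elsewhere_le) (use v boundaryD[OF z] in auto)
      also have "\<dots> \<le> surv cap (\<zeta> j) / ?p" using boundary_sub[OF z j] v by (simp add: barrier_def)
      finally show "measure ?P ?E \<le> surv cap (\<zeta> j) / ?p" .
    qed (use D in simp)
    finally show ?thesis .
  qed
  have "(\<lambda>j. ?D * (surv cap (\<zeta> j) / ?p)) \<longlonglongrightarrow> ?D * (0 / ?p)"
    by (intro tendsto_intros lim) (use p in simp)
  then have "\<forall>\<^sub>F j in sequentially. ?D * (surv cap (\<zeta> j) / ?p) < r / 2"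
    by (rule order_tendstoD(2)) (use r in simp)
  then have "\<forall>\<^sub>F j in sequentially. norm (poisson_integral T \<phi> (\<zeta> j) - \<phi> \<zeta>) < r"
    using eventually_ge_at_top[of "Suc k"]
  proof eventually_elim
    case (elim j)
    have "\<bar>poisson_integral T \<phi> (\<zeta> j) - \<phi> \<zeta>\<bar> < r / 2 + r / 2"
      by (rule order_le_less_trans[OF est[OF elim(2)] add_strict_left_mono[OF elim(1)]])
    then show ?case by simp
  qed
  then show "\<exists>no. \<forall>n\<ge>no. norm (poisson_integral T \<phi> (\<zeta> n) - \<phi> \<zeta>) < r"
    by (simp add: eventually_sequentially)
qed

end

theorem theorem3p5:
  fixes T :: "'a edge_rooted_graph" and \<phi> :: "(nat \<Rightarrow> 'a) \<Rightarrow> real"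
  assumes "rooted_tree T"
    and "continuous_map (boundary_topology T) euclideanreal \<phi>"
  shows "(\<forall>x \<in> verts T - {base T}. laplacian T (poisson_integral T \<phi>) x = 0) \<and>
         (\<forall>\<zeta>. regular_point T \<zeta> \<longrightarrow> (\<lambda>j. poisson_integral T \<phi> (\<zeta> j)) \<longlonglongrightarrow> \<phi> \<zeta>)"
proof -
  interpret rooted_tree T by (rule assms(1))
  show ?thesis using poisson_harmonic[OF assms(2)] poisson_radial_limit[OF assms(2)] by simp
qed

end
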